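(* Let $\mathbb{F}=\mathbb{R}$ or $\mathbb{F}=\mathbb{C}$, let $m,n$ be positive integers, and let $\underline{d}=(d_1,\ldots,d_m)$ be a list of nonnegative integers with $\max_{1\le i\le m} d_i>0$. Let $M(\lambda)\in\mathbb{F}[\lambda]^{m\times(m+n)}_{\underline{d}}$ be a polynomial matrix with full-trimmed-Sylvester-rank, let $k'=\left\lceil \frac{\sum_{i=1}^m d_i}{n}\right\rceil$, let $t$ be defined by $nk'=\sum_{i=1}^m d_i+t$ (so $0\le t<n$), and let $N(\lambda)\in\mathbb{F}[\lambda]^{n\times(m+n)}_{k'}$ be a minimal basis dual to $M(\lambda)$ with highest-row-degree coefficient matrix $N_{hr}\in\mathbb{F}^{n\times(m+n)}$. Define $\theta_1(M)$ and $\theta_2(M)$ as follows. (a) If $k'>1$ and $t>0$, $$\theta_1(M):=\min\left\{\frac{\sigma_{(k'-1)(m+n)}(T_{k'-1}(M))}{\sqrt{k'-1}},\ \frac{\sigma_{(k'm+\sum_{i=1}^m d_i)}(T_{k'}(M))}{\sqrt{k'}},\ \frac{\sigma_{(k'm+m+\sum_{i=1}^m d_i)}(T_{k'+1}(M))}{\sqrt{k'+1}}\right\},$$ $$\theta_2(M):=\min\left\{\frac{\sigma_{(k'm+\sum_{i=1}^m d_i)}(T_{k'}(M))}{\sqrt{k'}},\ \frac{\sigma_{(k'm+m+\sum_{i=1}^m d_i)}(T_{k'+1}(M))}{\sqrt{k'+1}}\right\}.$$ (b) If $k'=1$ and $t>0$, $$\theta_1(M)=\theta_2(M):=\min\left\{\sigma_{(m+\sum_{i=1}^m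 d_i)}(T_1(M)),\ \frac{\sigma_{(2m+\sum_{i=1}^m d_i)}(T_2(M))}{\sqrt{2}}\right\}.$$ (c) If $t=0$, $$\theta_1(M):=\min\left\{\frac{\sigma_{(k'm+\sum_{i=1}^m d_i)}(T_{k'}(M))}{\sqrt{k'}},\ \frac{\sigma_{(k'm+m+\sum_{i=1}^m d_i)}(T_{k'+1}(M))}{\sqrt{k'+1}}\right\},\qquad \theta_2(M):=\frac{\sigma_{(k'm+m+\sum_{i=1}^m d_i)}(T_{k'+1}(M))}{\sqrt{k'+1}}.$$ Then every $\widetilde M(\lambda)\in\mathbb{F}[\lambda]^{m\times(m+n)}_{\underline{d}}$ such that $$\|T_1(M)-T_1(\widetilde M)\|_2<\frac12\cdot\theta_1(M)\cdot\frac{\sigma_n(N_{hr})}{\|S_1(N)\|_F}$$ has full-trimmed-Sylvester-rank and has a dual minimal basis $\widetilde N(\lambda)\in\mathbb{F}[\lambda]^{n\times(m+n)}_{k'}$ that satisfies $$\frac{\|S_1(N)-S_1(\widetilde N)\|_F}{\|S_1(N)\|_F}\le\frac{2}{\theta_2(M)}\cdot\|T_1(M)-T_1(\widetilde M)\|_2 .$$ In addition, if $t=0$, then all the row degrees of $\widetilde N(\lambda)$ and $N(\lambda)$ are equal to $k'$.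
   Context: Spaces: $\mathbb{F}[\lambda]^{m\times(m+n)}_{\underline{d}}$ is the $\mathbb{F}$-linear space of $m\times(m+n)$ polynomial matrices $M(\lambda)$ whose $i$th row has the form $R_i(\lambda)=R_{i,0}+R_{i,1}\lambda+\cdots+R_{i,d_i}\lambda^{d_i}$ with $R_{i,j}\in\mathbb{F}^{1\times(m+n)}$, $i=1,\ldots,m$. For an integer $k'$, $\mathbb{F}[\lambda]^{n\times(m+n)}_{k'}$ is the space of $n\times(m+n)$ polynomial matrices of degree at most $k'$. Sylvester matrices: for a polynomial matrix $P(\lambda)=P_0+P_1\lambda+\cdots+P_e\lambda^e$ considered in the space of polynomial matrices of degree at most $e$, the $k$th Sylvester matrix $S_k(P)$ is the block matrix with $k+e$ block rows (indexed $0,\ldots,k+e-1$) and $k$ block columns (indexed $0,\ldots,k-1$) whose $(p,q)$ block is $P_{p-q}$ if $0\le p-q\le e$ and $0$ otherwise; in particular $S_1(P)$ is the block column with blocks $P_0,\ldots,P_e$. For $N,\widetilde N$ take $e=k'$. Trimmed Sylvester matrices: for $M(\lambda)\in\mathbb{F}[\lambda]^{m\times(m+n)}_{\underline{d}}$ put $d=\max_i d_i$ and form $S_k(M)$ with $e=d$. The $k$th trimmed Sylvester matrix $T_k(M)\in\mathbb{F}^{(km+\sum_{i=1}^m d_i)\times k(m+n)}$ is obtained from $S_k(M)$ by deleting, for every $i=1,\ldots,m$, the $i$th row of each of the last $d-d_i$ block rows (these rows are always zero), keeping the order of the remaining rows. $M(\lambda)$ has full-trimmed-Sylvester-rank if $\operatorname{rank}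 T_k(M)=\min\{km+\sum_{i=1}^m d_i,\;k(m+n)\}$ for all $k=1,2,\ldots$. Minimal bases: a minimal basis of a subspace $\mathcal V\subseteq\mathbb{F}(\lambda)^{q}$ is a basis of $\mathcal V$ consisting of polynomial vectors with minimal sum of degrees among all polynomial bases of $\mathcal V$. A polynomial matrix with more columns than rows is called a minimal basis if its rows form a minimal basis of the rational subspace they span. Full row rank polynomial matrices $M(\lambda)\in\mathbb{F}[\lambda]^{m\times(m+n)}$ and $N(\lambda)\in\mathbb{F}[\lambda]^{n\times(m+n)}$ are dual minimal bases if both are minimal bases and $M(\lambda)N(\lambda)^T=0$. The highest-row-degree coefficient matrix $N_{hr}$ of $N(\lambda)$ is the constant matrix whose $j$th row is the coefficient of $\lambda^{\varepsilon_j}$ in the $j$th row of $N(\lambda)$, where $\varepsilon_j$ is the degree of that row. Notation: $\|\cdot\|_2$ is the spectral norm, $\|\cdot\|_F$ the Frobenius norm; $\sigma_1(A)\ge\cdots\ge\sigma_{\min\{p,q\}}(A)$ are the singular values of $A\in\mathbb{F}^{p\times q}$. *)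

theory Defs
  imports
    "HOL-Analysis.L2_Norm"
    "HOL-Computational_Algebra.Normalized_Fraction"
    "Jordan_Normal_Form.DL_Rank"
    "Jordan_Normal_Form.DL_Submatrix"
    "Jordan_Normal_Form.Char_Poly"
    "Jordan_Normal_Form.Schur_Decomposition"
begin

section \<open>The scalar field\<close>

text \<open>
  The axioms determine the field up to isomorphism: its members are exactly the real and the
  complex numbers, with the modulus as norm and the usual conjugation (the identity in the real
  case, since \<open>z * conjugate z = z\<^sup>2\<close> there).
\<close>

class real_or_complex = real_normed_field + conjugatable_field +
  assumes mult_conjugate: "z * conjugate z = (norm z)\<^sup>2 *\<^sub>R 1"
    and real_or_complex:
      "(\<forall>z. \<exists>a. z = a *\<^sub>R 1) \<or>
       (\<exists>i. i * i = - 1 \<and> (\<forall>z. \<exists>a b. z = a *\<^sub>R 1 + b *\<^sub>R i))"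

instance real :: real_or_complex
  by standard (auto simp: power2_eq_square)

instance complex :: real_or_complex
proof
  fix z :: complex
  show "z * conjugate z = (norm z)\<^sup>2 *\<^sub>R 1"
    using complex_norm_square[of z] by (simp add: scaleR_conv_of_real)
  have "\<i> * \<i> = - 1 \<and> (\<forall>z. \<exists>a b. z = a *\<^sub>R 1 + b *\<^sub>R \<i>)"
    by (simp add: complex_eq_iff)
  then show "(\<forall>z::complex. \<exists>a. z = a *\<^sub>R 1) \<or>
      (\<exists>i::complex. i * i = - 1 \<and> (\<forall>z. \<exists>a b. z = a *\<^sub>R 1 + b *\<^sub>R i))"
    by blast
qed


section \<open>Norms and singular values\<close>

definition euclidean_norm :: "'a::real_normed_vector vec \<Rightarrow> real" where
  "euclidean_norm v = L2_set (\<lambda>i. norm (v $ i)) {..<dim_vec v}"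

definition spectral_norm :: "'a::real_normed_field mat \<Rightarrow> real" where
  "spectral_norm A =
     Sup {euclidean_norm (A *\<^sub>v v) | v. v \<in> carrier_vec (dim_col A) \<and> euclidean_norm v = 1}"

definition frobenius_norm :: "'a::real_normed_vector mat \<Rightarrow> real" where
  "frobenius_norm A = L2_set (\<lambda>ij. norm (A $$ ij)) ({..<dim_row A} \<times> {..<dim_col A})"

text \<open>
  The nonnegative square roots of the eigenvalues of \<open>A\<^sup>*A\<close>, counted with multiplicity and in
  nonincreasing order. The list has length \<open>dim_col A\<close>; if there are more columns than rows, the
  entries after the first \<open>dim_row A\<close> are zeros. So \<open>\<sigma> i A\<close>, which counts from 1, is the
  \<open>i\<close>th singular value for \<open>1 \<le> i \<le> min (dim_row A) (dim_col A)\<close>.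
\<close>

definition singular_values :: "'a::real_or_complex mat \<Rightarrow> real list" where
  "singular_values A =
     (THE s. sorted_wrt (\<ge>) s \<and> (\<forall>x\<in>set s. 0 \<le> x) \<and>
        char_poly (mat_adjoint A * A) = (\<Prod>x\<leftarrow>s. [:- of_real (x\<^sup>2), 1:]))"

definition \<sigma> :: "nat \<Rightarrow> 'a::real_or_complex mat \<Rightarrow> real" where
  "\<sigma> i A = singular_values A ! (i - 1)"


section \<open>Spaces of polynomial matrices and Sylvester matrices\<close>

definition polymats_rowdeg :: "nat list \<Rightarrow> nat \<Rightarrow> 'a::zero poly mat set" where
  "polymats_rowdeg ds q =
     {M \<in> carrier_mat (length ds) q. \<forall>i<length ds. \<forall>j<q. degree (M $$ (i, j)) \<le> ds ! i}"

definition polymats_deg :: "nat \<Rightarrow> nat \<Rightarrow> nat \<Rightarrow> 'a::zero poly mat set" where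
  "polymats_deg p q e = {N \<in> carrier_mat p q. \<forall>i<p. \<forall>j<q. degree (N $$ (i, j)) \<le> e}"

text \<open>\<open>sylvester e k P\<close> is \<open>S\<^sub>k(P)\<close> for \<open>P\<close> regarded as a matrix of degree at most \<open>e\<close>.\<close>

definition sylvester :: "nat \<Rightarrow> nat \<Rightarrow> 'a::zero poly mat \<Rightarrow> 'a mat" where
  "sylvester e k P =
     mat ((k + e) * dim_row P) (k * dim_col P)
       (\<lambda>(a, b).
          let p = a div dim_row P; q = b div dim_col P in
          if q \<le> p \<and> p - q \<le> e
          then coeff (P $$ (a mod dim_row P, b mod dim_col P)) (p - q) else 0)"

text \<open>
  Row \<open>a\<close> of the Sylvester matrix is row \<open>a mod m\<close> of block row \<open>a div m\<close>, and it is deleted iff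
  that is one of the last \<open>d - ds ! (a mod m)\<close> of the \<open>k + d\<close> block rows, where \<open>d\<close> is the
  maximum of \<open>ds\<close>.
\<close>

definition trimmed_sylvester :: "nat list \<Rightarrow> nat \<Rightarrow> 'a::zero poly mat \<Rightarrow> 'a mat" where
  "trimmed_sylvester ds k M =
     (let d = Max (set ds); m = dim_row M in
      submatrix (sylvester d k M) {a. \<not> (k + d) - (d - ds ! (a mod m)) \<le> a div m} UNIV)"

definition mat_rank :: "'a::field mat \<Rightarrow> nat" where
  "mat_rank A = vec_space.rank (dim_row A) A"

definition full_trimmed_sylvester_rank :: "nat list \<Rightarrow> 'a::field poly mat \<Rightarrow> bool" where
  "full_trimmed_sylvester_rank ds M \<longleftrightarrow>
     (\<forall>k\<ge>1. mat_rank (trimmed_sylvester ds k M) =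
        min (k * dim_row M + sum_list ds) (k * dim_col M))"


section \<open>Minimal bases\<close>

definition vec_degree :: "'a::zero poly vec \<Rightarrow> nat" where
  "vec_degree v = Max ((\<lambda>j. degree (v $ j)) ` {..<dim_vec v})"

definition row_degree :: "'a::zero poly mat \<Rightarrow> nat \<Rightarrow> nat" where
  "row_degree P i = vec_degree (row P i)"

definition highest_row_degree_coeff :: "'a::zero poly mat \<Rightarrow> 'a mat" where
  "highest_row_degree_coeff P =
     mat (dim_row P) (dim_col P) (\<lambda>(i, j). coeff (P $$ (i, j)) (row_degree P i))"

text \<open>
  A list of polynomial vectors is a basis of the subspace \<open>V\<close> of the space of vectors of length
  \<open>q\<close> over the field of rational functions.
\<close>

definition polynomial_basis ::
    "nat \<Rightarrow> 'a::field poly fract vec set \<Rightarrow> 'a poly vec list \<Rightarrow> bool" where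
  "polynomial_basis q V vs \<longleftrightarrow>
     (let B = map_vec to_fract ` set vs; W = module_vec TYPE('a poly fract) q in
      set vs \<subseteq> carrier_vec q \<and> distinct vs \<and>
      \<not> LinearCombinations.module.lin_dep class_ring W B \<and>
      LinearCombinations.module.span class_ring W B = V)"

definition minimal_basis_of ::
    "nat \<Rightarrow> 'a::field poly fract vec set \<Rightarrow> 'a poly vec list \<Rightarrow> bool" where
  "minimal_basis_of q V vs \<longleftrightarrow>
     polynomial_basis q V vs \<and>
     (\<forall>ws. polynomial_basis q V ws \<longrightarrow>
        sum_list (map vec_degree vs) \<le> sum_list (map vec_degree ws))"

definition minimal_basis :: "'a::field poly mat \<Rightarrow> bool" where
  "minimal_basis P \<longleftrightarrow>
     dim_row P < dim_col P \<and>
     minimal_basis_of (dim_col P) (vec_space.row_space (dim_col P) (map_mat to_fract P)) (rows P)"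

definition full_row_rank :: "'a::field poly mat \<Rightarrow> bool" where
  "full_row_rank P \<longleftrightarrow> mat_rank (map_mat to_fract P) = dim_row P"

definition dual_minimal_bases :: "nat \<Rightarrow> nat \<Rightarrow> 'a::field poly mat \<Rightarrow> 'a poly mat \<Rightarrow> bool" where
  "dual_minimal_bases m n M N \<longleftrightarrow>
     M \<in> carrier_mat m (m + n) \<and> N \<in> carrier_mat n (m + n) \<and>
     full_row_rank M \<and> full_row_rank N \<and> minimal_basis M \<and> minimal_basis N \<and>
     M * transpose_mat N = 0\<^sub>m m n"


section \<open>The quantities \<open>\<theta>\<^sub>1\<close> and \<open>\<theta>\<^sub>2\<close>\<close>

definition \<theta>\<^sub>1 ::
    "nat \<Rightarrow> nat \<Rightarrow> nat list \<Rightarrow> nat \<Rightarrow> nat \<Rightarrow> 'a::real_or_complex poly mat \<Rightarrow> real" where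
  "\<theta>\<^sub>1 m n ds k' t M =
     (let D = sum_list ds; T = (\<lambda>k. trimmed_sylvester ds k M) in
      if t = 0 then
        min (\<sigma> (k' * m + D) (T k') / sqrt (real k'))
            (\<sigma> (k' * m + m + D) (T (k' + 1)) / sqrt (real (k' + 1)))
      else if k' = 1 then
        min (\<sigma> (m + D) (T 1)) (\<sigma> (2 * m + D) (T 2) / sqrt 2)
      else
        min (\<sigma> ((k' - 1) * (m + n)) (T (k' - 1)) / sqrt (real (k' - 1)))
            (min (\<sigma> (k' * m + D) (T k') / sqrt (real k'))
                 (\<sigma> (k' * m + m + D) (T (k' + 1)) / sqrt (real (k' + 1)))))"

definition \<theta>\<^sub>2 ::
    "nat \<Rightarrow> nat list \<Rightarrow> nat \<Rightarrow> nat \<Rightarrow> 'a::real_or_complex poly mat \<Rightarrow> real" where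
  "\<theta>\<^sub>2 m ds k' t M =
     (let D = sum_list ds; T = (\<lambda>k. trimmed_sylvester ds k M) in
      if t = 0 then
        \<sigma> (k' * m + m + D) (T (k' + 1)) / sqrt (real (k' + 1))
      else if k' = 1 then
        min (\<sigma> (m + D) (T 1)) (\<sigma> (2 * m + D) (T 2) / sqrt 2)
      else
        min (\<sigma> (k' * m + D) (T k') / sqrt (real k'))
            (\<sigma> (k' * m + m + D) (T (k' + 1)) / sqrt (real (k' + 1))))"

end

theory Submission
  imports Defs
begin

text \<open>
  Row \<open>i\<close> of \<open>T\<^sub>k(M)\<close> applied to the coefficients of a polynomial vector \<open>x\<close> of degree less than
  \<open>k\<close> gives the coefficients of \<open>(M x)\<^sub>i\<close>, which has degree less than \<open>k + d\<^sub>i\<close>. Surjectivity of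
  \<open>x \<mapsto> M x\<close> passes from \<open>k\<close> to \<open>k + 1\<close> and injectivity from \<open>k\<close> to \<open>k - 1\<close>, so full rank for all
  \<open>k\<close> follows from full rank near \<open>k'\<close>, where it is stable because \<open>\<parallel>T\<^sub>k(M) - T\<^sub>k(M')\<parallel>\<close> is at most
  \<open>\<surd>k \<parallel>T\<^sub>1(M) - T\<^sub>1(M')\<parallel>\<close>. Each row of \<open>N\<close> has degree \<open>k' - 1\<close> or \<open>k'\<close> and is corrected by a solution
  of small norm of a linear system with matrix \<open>T\<^sub>k(M')\<close>, where \<open>k\<close> exceeds its degree by one, so that
  the row degrees are kept and the leading coefficients stay independent. Minimality is a dimension
  count: by surjectivity of \<open>x \<mapsto> M' x\<close> every polynomial basis of the kernel of \<open>M'\<close> has degree sum at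
  least \<open>\<Sum> d\<^sub>i\<close>, and exchanging rows of \<open>N\<close> for the kernel vectors of \<open>M\<close> of degree \<open>k' - 1\<close> shows
  that the row degrees of \<open>N\<close> sum to at most \<open>\<Sum> d\<^sub>i\<close>.
\<close>

section \<open>Singular values\<close>

text \<open>Singular values enter only through the smallest one, as a lower bound for a tall matrix
  and, via the adjoint, for a wide one; only for this are the roots of \<open>char_poly\<close>
  compared with norms. The factor 1/2 in the hypothesis and the 2 in the conclusion have one origin:
  \<sigma>_n(N_hr) is at most the Frobenius norm of S_1(N), so the hypothesis gives \<nu> <
  \<open>\<theta>\<^sub>1\<close> / 2 for the size \<nu> of the perturbation, and each relevant
  singular value keeps at least half of its size. The remaining factor of the hypothesis keeps the
  leading coefficients of the perturbed rows independent. \<open>\<theta>\<^sub>2\<close> involves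
  only the sizes k at which a row of N is corrected, its degree plus one;
  \<open>\<theta>\<^sub>1\<close> also involves those at which surjectivity or injectivity of T_k
  has to survive. Minimality is a comparison with all polynomial bases and thus needs lower bounds
  for degree sums: for the kernel by counting dimensions in high degree, for the row space of M by
  the absence of cancellation among its leading coefficients and a nonvanishing term of a
  determinant.\<close>

lemma conjugate_of_real [simp]: "conjugate (of_real r :: 'a::real_or_complex) = of_real r"
proof (cases "r = 0")
  case False
  have "of_real r * conjugate (of_real r :: 'a) = of_real r * of_real r"
    using mult_conjugate[of "of_real r :: 'a"] False
    by (simp add: scaleR_conv_of_real power2_eq_square)
  with False show ?thesis by simp
qed simp

lemma conjugate_diff: "conjugate (a - b) = conjugate a - conjugate b" for a b :: "'a::real_or_complex"
  using conjugate_dist_add[of a "- b"] by (simp add: conjugate_neg)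

lemma mult_conjugate_of_real:
  "z * conjugate z = of_real ((norm z)\<^sup>2)" for z :: "'a::real_or_complex"
  by (simp add: mult_conjugate scaleR_conv_of_real)

lemma norm_conjugate [simp]: "norm (conjugate z) = norm z" for z :: "'a::real_or_complex"
proof (cases "z = 0")
  case False
  have "norm z * norm (conjugate z) = norm z * norm z"
    using arg_cong[OF mult_conjugate_of_real[of z], of norm]
    by (simp add: norm_mult power2_eq_square)
  with False show ?thesis by simp
qed simp

lemma euclidean_norm_nonneg [simp]: "0 \<le> euclidean_norm v"
  by (simp add: euclidean_norm_def L2_set_nonneg)

lemma euclidean_norm_sq: "(euclidean_norm v)\<^sup>2 = (\<Sum>i<dim_vec v. (norm (v $ i))\<^sup>2)"
  unfolding euclidean_norm_def L2_set_def by (simp add: sum_nonneg)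

lemma euclidean_norm_0 [simp]: "euclidean_norm (0\<^sub>v n) = 0"
  by (simp add: euclidean_norm_def L2_set_def)

lemma euclidean_norm_eq_0: "v \<in> carrier_vec n \<Longrightarrow> euclidean_norm v = 0 \<longleftrightarrow> v = 0\<^sub>v n"
  by (auto simp: euclidean_norm_def L2_set_eq_0_iff)

lemma euclidean_norm_smult:
  "euclidean_norm (c \<cdot>\<^sub>v v) = norm c * euclidean_norm (v :: 'a::real_normed_field vec)"
  by (simp add: euclidean_norm_def norm_mult L2_set_right_distrib cong: L2_set_cong_simp)

lemma euclidean_norm_add:
  assumes "v \<in> carrier_vec n" "w \<in> carrier_vec n"
  shows "euclidean_norm (v + w) \<le> euclidean_norm v + euclidean_norm w"
proof -
  have "euclidean_norm (v + w) \<le> L2_set (\<lambda>i. norm (v $ i) + norm (w $ i)) {..<n}"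
    unfolding euclidean_norm_def using assms
    by (auto intro!: L2_set_mono norm_triangle_ineq)
  also have "\<dots> \<le> euclidean_norm v + euclidean_norm w"
    using assms L2_set_triangle_ineq by (auto simp: euclidean_norm_def)
  finally show ?thesis .
qed

lemma euclidean_norm_normalize:
  fixes v :: "'a::real_normed_field vec"
  assumes "v \<in> carrier_vec n" "v \<noteq> 0\<^sub>v n"
  shows "euclidean_norm (of_real (1 / euclidean_norm v) \<cdot>\<^sub>v v) = 1"
  using euclidean_norm_eq_0[OF assms(1)] assms(2) by (simp add: euclidean_norm_smult norm_divide)

lemma scalar_prod_self:
  "v \<bullet>c v = of_real ((euclidean_norm v)\<^sup>2)" for v :: "'a::real_or_complex vec"
  by (simp add: scalar_prod_def euclidean_norm_sq mult_conjugate_of_real atLeast0LessThan)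

lemma scalar_prod_conj_conjugate:
  "v \<in> carrier_vec n \<Longrightarrow> w \<in> carrier_vec n \<Longrightarrow> conjugate (w \<bullet>c v) = v \<bullet>c w"
  for v w :: "'a::real_or_complex vec"
  by (simp add: scalar_prod_def sum_conjugate conjugate_dist_mul mult.commute)

lemma scalar_prod_Cauchy_Schwarz:
  fixes v w :: "'a::real_or_complex vec"
  assumes "v \<in> carrier_vec n" "w \<in> carrier_vec n"
  shows "norm (v \<bullet> w) \<le> euclidean_norm v * euclidean_norm w"
proof -
  have "norm (v \<bullet> w) \<le> (\<Sum>i<n. \<bar>norm (v $ i)\<bar> * \<bar>norm (w $ i)\<bar>)"
    unfolding scalar_prod_def using assms
    by (auto intro!: sum_norm_le simp: norm_mult atLeast0LessThan)
  also have "\<dots> \<le> euclidean_norm v * euclidean_norm w"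
    using assms L2_set_mult_ineq[of "\<lambda>i. norm (v $ i)" "\<lambda>i. norm (w $ i)" "{..<n}"]
    by (auto simp: euclidean_norm_def)
  finally show ?thesis .
qed

lemma euclidean_norm_conjugate [simp]:
  "euclidean_norm (conjugate v) = euclidean_norm v" for v :: "'a::real_or_complex vec"
  by (simp add: euclidean_norm_def cong: L2_set_cong_simp)

lemma mat_adjoint_carrier [simp]:
  "A \<in> carrier_mat p q \<Longrightarrow> mat_adjoint A \<in> carrier_mat q p"
  unfolding mat_adjoint_def by auto

lemma dim_mat_adjoint [simp]:
  "dim_row (mat_adjoint A) = dim_col A" "dim_col (mat_adjoint A) = dim_row A"
  by (simp_all add: mat_adjoint_def)

lemma index_mat_adjoint [simp]:
  "i < dim_col A \<Longrightarrow> j < dim_row A \<Longrightarrow> mat_adjoint A $$ (i, j) = conjugate (A $$ (j, i))"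
  by (simp add: mat_adjoint_def mat_of_rows_index)

lemma mat_adjoint_adjoint [simp]: "mat_adjoint (mat_adjoint A) = A"
  by (rule eq_matI) auto

lemma scalar_prod_mat_adjoint:
  fixes A :: "'a::real_or_complex mat"
  assumes "A \<in> carrier_mat p q" "x \<in> carrier_vec q" "y \<in> carrier_vec p"
  shows "(A *\<^sub>v x) \<bullet>c y = x \<bullet>c (mat_adjoint A *\<^sub>v y)"
proof -
  have "(A *\<^sub>v x) \<bullet>c y = (\<Sum>i = 0..<p. \<Sum>j = 0..<q. A $$ (i, j) * x $ j * conjugate (y $ i))"
    using assms by (simp add: scalar_prod_def sum_distrib_right)
  also have "\<dots> = (\<Sum>j = 0..<q. \<Sum>i = 0..<p. A $$ (i, j) * x $ j * conjugate (y $ i))"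
    by (rule sum.swap)
  also have "\<dots> = x \<bullet>c (mat_adjoint A *\<^sub>v y)"
    using assms by (simp add: scalar_prod_def sum_distrib_left sum_conjugate conjugate_dist_mul mult_ac)
  finally show ?thesis .
qed

lemma euclidean_norm_mult_mat_vec_le:
  fixes A :: "'a::real_or_complex mat"
  assumes "A \<in> carrier_mat p q" "x \<in> carrier_vec q"
  shows "euclidean_norm (A *\<^sub>v x) \<le> frobenius_norm A * euclidean_norm x"
proof -
  have "euclidean_norm (A *\<^sub>v x) \<le> L2_set (\<lambda>i. euclidean_norm (row A i) * euclidean_norm x) {..<p}"
    unfolding euclidean_norm_def[of "A *\<^sub>v x"] using assms
    by (auto intro!: L2_set_mono scalar_prod_Cauchy_Schwarz[of _ q])
  also have "\<dots> = L2_set (\<lambda>i. euclidean_norm (row A i)) {..<p} * euclidean_norm x"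
    by (simp add: L2_set_left_distrib)
  also have "L2_set (\<lambda>i. euclidean_norm (row A i)) {..<p} = frobenius_norm A"
    using assms by (simp add: L2_set_def frobenius_norm_def euclidean_norm_sq sum.cartesian_product)
  finally show ?thesis .
qed

lemma frobenius_norm_nonneg [simp]: "0 \<le> frobenius_norm A"
  by (simp add: frobenius_norm_def L2_set_nonneg)

lemma frobenius_norm_adjoint [simp]:
  "frobenius_norm (mat_adjoint A) = frobenius_norm A" for A :: "'a::real_or_complex mat"
proof -
  have "(\<Sum>ij\<in>{..<dim_col A} \<times> {..<dim_row A}. (norm (mat_adjoint A $$ ij))\<^sup>2)
      = (\<Sum>ij\<in>{..<dim_row A} \<times> {..<dim_col A}. (norm (A $$ ij))\<^sup>2)"
    by (rule sum.reindex_bij_witness[where i = prod.swap and j = prod.swap]) auto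
  then show ?thesis by (simp add: frobenius_norm_def L2_set_def)
qed

lemma spectral_norm_ge:
  fixes A :: "'a::real_or_complex mat"
  assumes A: "A \<in> carrier_mat p q" and x: "x \<in> carrier_vec q"
  shows "euclidean_norm (A *\<^sub>v x) \<le> spectral_norm A * euclidean_norm x"
proof (cases "x = 0\<^sub>v q")
  case True
  moreover have "A *\<^sub>v 0\<^sub>v q = 0\<^sub>v p" using A by (intro eq_vecI) auto
  ultimately show ?thesis by simp
next
  case False
  let ?S = "{euclidean_norm (A *\<^sub>v v) | v. v \<in> carrier_vec (dim_col A) \<and> euclidean_norm v = 1}"
  let ?c = "1 / euclidean_norm x"
  have pos: "0 < euclidean_norm x"
    using euclidean_norm_eq_0[OF x] False by (simp add: less_le)
  \<comment> \<open>The Frobenius norm bounds the set, so its supremum really is an upper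
    bound.\<close>
  have "bdd_above ?S"
    using A euclidean_norm_mult_mat_vec_le[OF A] by (intro bdd_aboveI[of _ "frobenius_norm A"]) force
  moreover have "euclidean_norm (A *\<^sub>v (of_real ?c \<cdot>\<^sub>v x)) \<in> ?S"
    using A x euclidean_norm_normalize[OF x False] by auto
  ultimately have "euclidean_norm (A *\<^sub>v (of_real ?c \<cdot>\<^sub>v x)) \<le> spectral_norm A"
    unfolding spectral_norm_def by (rule cSup_upper[rotated])
  moreover have "euclidean_norm (A *\<^sub>v (of_real ?c \<cdot>\<^sub>v x)) = euclidean_norm (A *\<^sub>v x) / euclidean_norm x"
    using mult_mat_vec[OF A x] pos by (simp add: euclidean_norm_smult norm_divide)
  ultimately have "euclidean_norm (A *\<^sub>v x) / euclidean_norm x \<le> spectral_norm A" by simp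
  then show ?thesis using pos by (simp add: field_simps)
qed

text \<open>\<open>0 < q\<close> provides a unit vector; for \<open>q = 0\<close> the supremum in
  \<open>spectral_norm\<close> is taken over the empty set and has no known sign.\<close>

lemma spectral_norm_nonneg:
  fixes A :: "'a::real_or_complex mat"
  assumes "A \<in> carrier_mat p q" "0 < q"
  shows "0 \<le> spectral_norm A"
proof -
  have "euclidean_norm (unit_vec q 0 :: 'a vec) = 1"
  proof -
    have "(\<Sum>i<q. (norm (unit_vec q 0 $ i :: 'a))\<^sup>2) = (\<Sum>i<q. if i = 0 then 1 else 0)"
      by (intro sum.cong) auto
    then show ?thesis using assms(2) by (simp add: euclidean_norm_def L2_set_def)
  qed
  then show ?thesis
    using spectral_norm_ge[OF assms(1), of "unit_vec q 0"]
    by (metis euclidean_norm_nonneg mult.right_neutral order_trans unit_vec_carrier)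
qed

text \<open>For w = adjoint of A applied to u, |w|^2 = <A w, u> <= c |w| |u|, and |w| cancels. This
  transfers a bound on A - A' to the adjoint, where surjectivity is tested.\<close>

lemma euclidean_norm_adjoint_le:
  fixes A :: "'a::real_or_complex mat"
  assumes A: "A \<in> carrier_mat p q" and c: "0 \<le> c"
    and le: "\<And>x. x \<in> carrier_vec q \<Longrightarrow> euclidean_norm (A *\<^sub>v x) \<le> c * euclidean_norm x"
    and u: "u \<in> carrier_vec p"
  shows "euclidean_norm (mat_adjoint A *\<^sub>v u) \<le> c * euclidean_norm u"
proof -
  let ?w = "mat_adjoint A *\<^sub>v u"
  have w: "?w \<in> carrier_vec q" using mat_adjoint_carrier[OF A] u by simp
  have "of_real ((euclidean_norm ?w)\<^sup>2) = (A *\<^sub>v ?w) \<bullet>c u"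
    using scalar_prod_mat_adjoint[OF A w u] scalar_prod_self[of ?w] by simp
  then have "(euclidean_norm ?w)\<^sup>2 = norm ((A *\<^sub>v ?w) \<bullet>c u)"
    by (metis norm_of_real abs_of_nonneg zero_le_power2)
  also have "\<dots> \<le> euclidean_norm (A *\<^sub>v ?w) * euclidean_norm u"
    using scalar_prod_Cauchy_Schwarz[of "A *\<^sub>v ?w" p "conjugate u"] A w u by simp
  also have "\<dots> \<le> c * euclidean_norm ?w * euclidean_norm u"
    by (intro mult_right_mono le w) simp
  finally have "euclidean_norm ?w * euclidean_norm ?w \<le> euclidean_norm ?w * (c * euclidean_norm u)"
    by (simp add: power2_eq_square mult_ac)
  then show ?thesis
    using c euclidean_norm_nonneg[of ?w]
    by (cases "euclidean_norm ?w = 0") (auto simp: mult_le_cancel_left less_le)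
qed

text \<open>Sylvester's determinant identity, from the block matrix X with block rows (x I, A) and
  (B, I). Multiplication by L1 from the right makes X block triangular with diagonal x I - A B, I;
  by L2 from the left, with diagonal x I, x I - B A.\<close>

lemma char_poly_mult_swap:
  fixes A B :: "'a::idom mat"
  assumes A: "A \<in> carrier_mat p q" and B: "B \<in> carrier_mat q p"
  shows "[:0, 1:] ^ q * char_poly (A * B) = [:0, 1:] ^ p * char_poly (B * A)"
proof -
  let ?x = "[:0, 1::'a:]"
  let ?c = "map_mat (\<lambda>a. [:a:])"
  let ?A = "?c A" and ?B = "?c B"
  have cA: "?A \<in> carrier_mat p q" and cB: "?B \<in> carrier_mat q p" using A B by auto
  have hom: "?c (C * D) = ?c C * ?c D" if "C \<in> carrier_mat l m" "D \<in> carrier_mat m n"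
    for C D :: "'a mat" and l m n
  proof -
    interpret comm_ring_hom "\<lambda>a::'a. [:a:]" by unfold_locales (auto simp: one_pCons)
    show ?thesis using mat_hom_mult[OF that] .
  qed
  have cp: "char_poly_matrix C = ?x \<cdot>\<^sub>m 1\<^sub>m n - ?c C" if "C \<in> carrier_mat n n" for C :: "'a mat" and n
    using that by (intro eq_matI) (auto simp: char_poly_matrix_def)
  define X where "X = four_block_mat (?x \<cdot>\<^sub>m 1\<^sub>m p) ?A ?B (1\<^sub>m q)"
  define L1 where "L1 = four_block_mat (1\<^sub>m p) (0\<^sub>m p q) (- ?B) (1\<^sub>m q)"
  define L2 where "L2 = four_block_mat (1\<^sub>m p) (0\<^sub>m p q) (- ?B) (?x \<cdot>\<^sub>m 1\<^sub>m q)"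
  have X: "X \<in> carrier_mat (p + q) (p + q)" and L1: "L1 \<in> carrier_mat (p + q) (p + q)"
    and L2: "L2 \<in> carrier_mat (p + q) (p + q)"
    using cA cB by (auto simp: X_def L1_def L2_def)
  have "X * L1 = four_block_mat (?x \<cdot>\<^sub>m 1\<^sub>m p * 1\<^sub>m p + ?A * (- ?B)) (?x \<cdot>\<^sub>m 1\<^sub>m p * 0\<^sub>m p q + ?A * 1\<^sub>m q)
      (?B * 1\<^sub>m p + 1\<^sub>m q * (- ?B)) (?B * 0\<^sub>m p q + 1\<^sub>m q * 1\<^sub>m q)"
    unfolding X_def L1_def by (rule mult_four_block_mat) (use cA cB in auto)
  also have "\<dots> = four_block_mat (char_poly_matrix (A * B)) ?A (0\<^sub>m q p) (1\<^sub>m q)"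
  proof -
    have "?x \<cdot>\<^sub>m 1\<^sub>m p * 1\<^sub>m p + ?A * (- ?B) = char_poly_matrix (A * B)"
      using A B cA cB by (subst cp[of _ p]) (auto simp: hom[OF A B])
    moreover have "?B * 1\<^sub>m p + 1\<^sub>m q * (- ?B) = 0\<^sub>m q p" using cB by auto
    ultimately show ?thesis using cA cB by simp
  qed
  finally have 1: "det X * det L1 = char_poly (A * B)"
    using det_mult[OF X L1] A B cA
      det_four_block_mat_lower_left_zero[of "char_poly_matrix (A * B)" p ?A q "0\<^sub>m q p" "1\<^sub>m q"]
    by (auto simp: char_poly_def)
  have d1: "det L1 = 1"
    unfolding L1_def using det_four_block_mat_upper_right_zero[of "1\<^sub>m p" p "0\<^sub>m p q" q "- ?B" "1\<^sub>m q"] cB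
    by auto
  have d2: "det L2 = ?x ^ q"
    unfolding L2_def
    using det_four_block_mat_upper_right_zero[of "1\<^sub>m p" p "0\<^sub>m p q" q "- ?B" "?x \<cdot>\<^sub>m 1\<^sub>m q"] cB
    by auto
  have "L2 * X = four_block_mat (1\<^sub>m p * (?x \<cdot>\<^sub>m 1\<^sub>m p) + 0\<^sub>m p q * ?B) (1\<^sub>m p * ?A + 0\<^sub>m p q * 1\<^sub>m q)
      ((- ?B) * (?x \<cdot>\<^sub>m 1\<^sub>m p) + ?x \<cdot>\<^sub>m 1\<^sub>m q * ?B) ((- ?B) * ?A + ?x \<cdot>\<^sub>m 1\<^sub>m q * 1\<^sub>m q)"
    unfolding X_def L2_def by (rule mult_four_block_mat) (use cA cB in auto)
  also have "\<dots> = four_block_mat (?x \<cdot>\<^sub>m 1\<^sub>m p) ?A (0\<^sub>m q p) (char_poly_matrix (B * A))"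
  proof -
    have "(- ?B) * ?A + ?x \<cdot>\<^sub>m 1\<^sub>m q * 1\<^sub>m q = char_poly_matrix (B * A)"
      using A B cA cB by (subst cp[of _ q]) (auto simp: hom[OF B A])
    moreover have "(- ?B) * (?x \<cdot>\<^sub>m 1\<^sub>m p) + ?x \<cdot>\<^sub>m 1\<^sub>m q * ?B = 0\<^sub>m q p"
    proof (intro eq_matI)
      fix i j assume "i < dim_row (0\<^sub>m q p :: 'a poly mat)" "j < dim_col (0\<^sub>m q p :: 'a poly mat)"
      moreover have "- ?B * (?x \<cdot>\<^sub>m 1\<^sub>m p) = ?x \<cdot>\<^sub>m (- ?B)"
        using cB mult_smult_distrib[of "- ?B" q p "1\<^sub>m p" p ?x] by simp
      moreover have "?x \<cdot>\<^sub>m 1\<^sub>m q * ?B = ?x \<cdot>\<^sub>m ?B"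
        using cB mult_smult_assoc_mat[of "1\<^sub>m q" q q ?B p ?x] by simp
      ultimately show "((- ?B) * (?x \<cdot>\<^sub>m 1\<^sub>m p) + ?x \<cdot>\<^sub>m 1\<^sub>m q * ?B) $$ (i, j) = 0\<^sub>m q p $$ (i, j)"
        using cB B by simp
    qed (use cB in auto)
    ultimately show ?thesis using cA cB by simp
  qed
  finally have "det L2 * det X = ?x ^ p * char_poly (B * A)"
    using det_mult[OF L2 X] A B cA
      det_four_block_mat_lower_left_zero[of "?x \<cdot>\<^sub>m 1\<^sub>m p" p ?A q "0\<^sub>m q p" "char_poly_matrix (B * A)"]
    by (auto simp: char_poly_def)
  with 1 d1 d2 show ?thesis by simp
qed


section \<open>Eigenvalues of \<open>mat_adjoint A * A\<close> and the infimum of the Rayleigh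
  quotient\<close>

lemma scalar_prod_minus_smult:
  fixes u w :: "'a::real_or_complex vec"
  assumes "u \<in> carrier_vec n" "w \<in> carrier_vec n"
  shows "of_real ((euclidean_norm (u - of_real t \<cdot>\<^sub>v w))\<^sup>2)
    = of_real ((euclidean_norm u)\<^sup>2) - of_real t * (u \<bullet>c w + w \<bullet>c u)
      + of_real (t\<^sup>2 * (euclidean_norm w)\<^sup>2)"
proof -
  have "(u - of_real t \<cdot>\<^sub>v w) \<bullet>c (u - of_real t \<cdot>\<^sub>v w)
      = u \<bullet>c u - of_real t * (u \<bullet>c w + w \<bullet>c u) + (of_real t)\<^sup>2 * (w \<bullet>c w)"
    using assms
    by (simp add: scalar_prod_def conjugate_diff conjugate_dist_mul algebra_simps power2_eq_square
        sum.distrib sum_subtractf sum_distrib_left)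
  then show ?thesis by (simp add: scalar_prod_self)
qed

text \<open>The Rayleigh quotient of an eigenvector v is its eigenvalue and also the square of |A v|
  / |v|. Applied over the complex numbers, it shows that all roots of the characteristic polynomial
  are squares of reals.\<close>

lemma eigenvalue_adjoint_mult:
  fixes A :: "'a::real_or_complex mat"
  assumes A: "A \<in> carrier_mat p q" and ev: "eigenvalue (mat_adjoint A * A) e"
  shows "\<exists>s\<ge>0. e = of_real (s\<^sup>2)"
proof -
  note A' = mat_adjoint_carrier[OF A]
  obtain v where v: "v \<in> carrier_vec q" "v \<noteq> 0\<^sub>v q" and e: "(mat_adjoint A * A) *\<^sub>v v = e \<cdot>\<^sub>v v"
    using ev A by (auto simp: eigenvalue_def eigenvector_def)
  have Av: "A *\<^sub>v v \<in> carrier_vec p" using A v by simp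
  have pos: "euclidean_norm v \<noteq> 0" using euclidean_norm_eq_0[OF v(1)] v(2) by simp
  have "of_real ((euclidean_norm (A *\<^sub>v v))\<^sup>2) = v \<bullet>c (e \<cdot>\<^sub>v v)"
    using scalar_prod_mat_adjoint[OF A v(1) Av] e assoc_mult_mat_vec[OF A' A v(1)]
    by (simp add: scalar_prod_self)
  also have "\<dots> = conjugate e * of_real ((euclidean_norm v)\<^sup>2)"
    using v by (simp add: conjugate_smult_vec scalar_prod_self)
  finally have "conjugate e = of_real ((euclidean_norm (A *\<^sub>v v) / euclidean_norm v)\<^sup>2)"
    using pos by (simp add: field_simps power_divide)
  then have "e = of_real ((euclidean_norm (A *\<^sub>v v) / euclidean_norm v)\<^sup>2)"
    by (metis conjugate_id conjugate_of_real)
  then show ?thesis by (metis divide_nonneg_nonneg euclidean_norm_nonneg)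
qed

text \<open>The witness m is the infimum of |A x|^2 over unit vectors. Attainment is not shown;
  instead, if \<open>mat_adjoint A * A\<close> minus m were invertible, then |A x|^2 - m |x|^2 would
  be bounded away from 0 on unit vectors, contrary to the choice of m.\<close>

lemma least_eigenvalue_adjoint_mult:
  fixes A :: "'a::real_or_complex mat"
  assumes A: "A \<in> carrier_mat p q" and q: "0 < q"
  obtains m where "0 \<le> m" "eigenvalue (mat_adjoint A * A) (of_real m)"
    "\<And>x. x \<in> carrier_vec q \<Longrightarrow> m * (euclidean_norm x)\<^sup>2 \<le> (euclidean_norm (A *\<^sub>v x))\<^sup>2"
proof -
  note A' = mat_adjoint_carrier[OF A]
  let ?n = euclidean_norm
  let ?R = "{(?n (A *\<^sub>v x))\<^sup>2 | x. x \<in> carrier_vec q \<and> ?n x = 1}"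
  define m where "m = Inf ?R"
  have "(unit_vec q 0 :: 'a vec) \<noteq> 0\<^sub>v q"
    using q by (auto simp: vec_eq_iff)
  then have "\<exists>x\<in>carrier_vec q. ?n (x :: 'a vec) = 1"
    using euclidean_norm_normalize[of "unit_vec q 0 :: 'a vec" q] by (meson smult_carrier_vec unit_vec_carrier)
  then have ne: "?R \<noteq> {}" by blast
  have bdd: "bdd_below ?R" by (auto intro!: bdd_belowI[of _ 0])
  have m0: "0 \<le> m" unfolding m_def using ne by (intro cInf_greatest) auto
  have lower: "m * (?n x)\<^sup>2 \<le> (?n (A *\<^sub>v x))\<^sup>2" if x: "x \<in> carrier_vec q" for x
  proof (cases "x = 0\<^sub>v q")
    case False
    let ?y = "of_real (1 / ?n x) \<cdot>\<^sub>v x"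
    have pos: "0 < ?n x" using euclidean_norm_eq_0[OF x] False by (simp add: less_le)
    have "m \<le> (?n (A *\<^sub>v ?y))\<^sup>2"
      unfolding m_def using bdd x euclidean_norm_normalize[OF x False] by (intro cInf_lower) auto
    also have "?n (A *\<^sub>v ?y) = ?n (A *\<^sub>v x) / ?n x"
      unfolding mult_mat_vec[OF A x] euclidean_norm_smult using pos by (simp add: norm_divide)
    finally show ?thesis using pos by (simp add: field_simps)
  qed simp
  let ?H = "mat_adjoint A * A"
  have H: "?H \<in> carrier_mat q q" by (rule mult_carrier_mat[OF A' A])
  have "eigenvalue ?H (of_real m)"
  proof (rule ccontr)
    assume "\<not> ?thesis"
    then have det: "det (char_matrix ?H (of_real m)) \<noteq> 0"
      using eigenvalue_det[OF H] by simp
    let ?G = "char_matrix ?H (of_real m)"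
    have G: "?G \<in> carrier_mat q q" using H by simp
    obtain B where B: "B \<in> carrier_mat q q" and BG: "B * ?G = 1\<^sub>m q"
      using det_non_zero_imp_unit[OF G det] by (auto simp: Units_def ring_mat_def)
    have cm: "char_matrix K e *\<^sub>v x = K *\<^sub>v x - e \<cdot>\<^sub>v x"
      if "K \<in> carrier_mat q q" "x \<in> carrier_vec q" for K :: "'a mat" and e x
      unfolding char_matrix_def using that
      by (intro eq_vecI) (auto simp: add_scalar_prod_distrib[of _ q])
    have Gx: "?G *\<^sub>v x = mat_adjoint A *\<^sub>v (A *\<^sub>v x) - of_real m \<cdot>\<^sub>v x" if x: "x \<in> carrier_vec q" for x
      using cm[OF H x] assoc_mult_mat_vec[OF A' A x] by simp
    define C where "C = (frobenius_norm A)\<^sup>2 + 1"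
    have C: "0 < C" unfolding C_def by (simp add: add_nonneg_pos)
    \<comment> \<open>The nonnegative quadratic form of G = \<open>?G\<close>. The claim
      \<open>gap\<close> is |G x|^2 <= C <G x, x>, proved by evaluating the form at x - y / C with y
      = G x: there it equals g x - 2 |y|^2 / C + g y / C^2, and g y <= C |y|^2.\<close>
    define g where "g x = (?n (A *\<^sub>v x))\<^sup>2 - m * (?n x)\<^sup>2" for x
    have gap: "(?n (?G *\<^sub>v x))\<^sup>2 \<le> C * g x" if x: "x \<in> carrier_vec q" for x
    proof -
      define y where "y = ?G *\<^sub>v x"
      have y: "y \<in> carrier_vec q" unfolding y_def using G x by simp
      have Ax: "A *\<^sub>v x \<in> carrier_vec p" and Ay: "A *\<^sub>v y \<in> carrier_vec p" using A x y by auto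
      define z where "z = x - of_real (1 / C) \<cdot>\<^sub>v y"
      have z: "z \<in> carrier_vec q" unfolding z_def using x y by simp
      have cross: "(A *\<^sub>v y) \<bullet>c (A *\<^sub>v x) = y \<bullet>c (mat_adjoint A *\<^sub>v (A *\<^sub>v x))"
        using scalar_prod_mat_adjoint[OF A y Ax] .
      have yy: "y \<bullet>c y = (A *\<^sub>v y) \<bullet>c (A *\<^sub>v x) - of_real m * (y \<bullet>c x)"
      proof -
        have w: "mat_adjoint A *\<^sub>v (A *\<^sub>v x) \<in> carrier_vec q" using A' Ax by simp
        have "y \<bullet>c (w - of_real m \<cdot>\<^sub>v x) = y \<bullet>c w - of_real m * (y \<bullet>c x)"
          if "w \<in> carrier_vec q" for w
          using that x y by (simp add: scalar_prod_def conjugate_diff conjugate_dist_mul algebra_simps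
              sum_subtractf sum_distrib_left)
        from this[OF w] show ?thesis unfolding cross Gx[OF x, folded y_def, symmetric] .
      qed
      \<comment> \<open>The conjugate of \<open>yy\<close>, because the expansion of g at z contains
        the mixed inner products in both orders.\<close>
      have yy': "y \<bullet>c y = (A *\<^sub>v x) \<bullet>c (A *\<^sub>v y) - of_real m * (x \<bullet>c y)"
      proof -
        have "conjugate (y \<bullet>c y) = y \<bullet>c y" by (simp only: scalar_prod_self conjugate_of_real)
        moreover have "conjugate ((A *\<^sub>v y) \<bullet>c (A *\<^sub>v x) - of_real m * (y \<bullet>c x))
          = (A *\<^sub>v x) \<bullet>c (A *\<^sub>v y) - of_real m * (x \<bullet>c y)"
          using scalar_prod_conj_conjugate[OF Ax Ay] scalar_prod_conj_conjugate[OF x y]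
          by (simp add: conjugate_diff conjugate_dist_mul)
        ultimately show ?thesis using yy by metis
      qed
      have "A *\<^sub>v z = A *\<^sub>v x - of_real (1 / C) \<cdot>\<^sub>v (A *\<^sub>v y)"
        unfolding z_def using A x y mult_minus_distrib_mat_vec[OF A x] mult_mat_vec[OF A y] by simp
      then have "(of_real (g z) :: 'a) = of_real (g x) - of_real (1 / C) * (y \<bullet>c y + y \<bullet>c y)
          + of_real ((1 / C)\<^sup>2 * g y)"
        unfolding g_def of_real_diff of_real_mult[of m]
        using scalar_prod_minus_smult[OF Ax Ay, of "1 / C"] scalar_prod_minus_smult[OF x y, of "1 / C", folded z_def]
        by (subst (1) yy', subst yy) (simp only: of_real_diff of_real_mult right_diff_distrib, simp add: algebra_simps)
      then have "(of_real (g z) :: 'a) = of_real (g x - (1 / C) * (2 * (?n y)\<^sup>2) + (1 / C)\<^sup>2 * g y)"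
        by (simp add: scalar_prod_self)
      then have "g z = g x - (1 / C) * (2 * (?n y)\<^sup>2) + (1 / C)\<^sup>2 * g y"
        by (simp only: of_real_eq_iff)
      moreover have "0 \<le> g z" using lower[OF z] by (simp add: g_def)
      moreover have "g y \<le> C * (?n y)\<^sup>2"
      proof -
        have "g y \<le> (?n (A *\<^sub>v y))\<^sup>2" using m0 by (simp add: g_def)
        also have "\<dots> \<le> (frobenius_norm A * ?n y)\<^sup>2"
          using euclidean_norm_mult_mat_vec_le[OF A y] by (intro power_mono) auto
        also have "\<dots> \<le> C * (?n y)\<^sup>2" by (simp add: C_def power_mult_distrib algebra_simps)
        finally show ?thesis .
      qed
      then have "(1 / C)\<^sup>2 * g y \<le> (1 / C)\<^sup>2 * (C * (?n y)\<^sup>2)" by (intro mult_left_mono) auto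
      moreover have "(1 / C)\<^sup>2 * (C * (?n y)\<^sup>2) = (1 / C) * (?n y)\<^sup>2"
        using C by (simp add: power2_eq_square)
      ultimately have "(1 / C) * (?n y)\<^sup>2 \<le> g x" by simp
      then show ?thesis using C by (simp add: y_def field_simps)
    qed
    define F where "F = (frobenius_norm B)\<^sup>2 + 1"
    have F: "0 < F" unfolding F_def by (simp add: add_nonneg_pos)
    \<comment> \<open>B inverts G, so 1 <= |B| |G x| for unit x, and \<open>gap\<close> keeps every
      value of the quotient at least 1 / (F C) above the infimum of all of them.\<close>
    have "m + 1 / (F * C) \<le> m"
    proof (subst (2) m_def, rule cInf_greatest[OF ne])
      fix r assume "r \<in> ?R"
      then obtain x where x: "x \<in> carrier_vec q" "?n x = 1" and r: "r = (?n (A *\<^sub>v x))\<^sup>2" by auto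
      have "x = B *\<^sub>v (?G *\<^sub>v x)"
        using assoc_mult_mat_vec[OF B G x(1)] BG x by simp
      then have "1 \<le> frobenius_norm B * ?n (?G *\<^sub>v x)"
        using euclidean_norm_mult_mat_vec_le[OF B, of "?G *\<^sub>v x"] G x by simp
      then have "1 \<le> (frobenius_norm B * ?n (?G *\<^sub>v x))\<^sup>2" by simp
      also have "\<dots> \<le> F * (?n (?G *\<^sub>v x))\<^sup>2" by (simp add: F_def power_mult_distrib algebra_simps)
      also have "\<dots> \<le> F * (C * g x)" using gap[OF x(1)] F by (intro mult_left_mono) auto
      finally have "1 / (F * C) \<le> g x" using F C by (simp add: field_simps)
      then show "m + 1 / (F * C) \<le> r" using x by (simp add: g_def r)
    qed
    then show False using F C by (simp add: field_simps)
  qed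
  then show ?thesis using that m0 lower by blast
qed


text \<open>Over the complex numbers the characteristic polynomial splits, and the embedding carries
  this back to the abstract field. It is given by real coordinates with respect to 1, or to 1 and i,
  following the dichotomy in the class axiom.\<close>

lemma real_or_complex_embedding:
  obtains h :: "'a::real_or_complex \<Rightarrow> complex"
  where "inj_comm_ring_hom h" "\<And>r. h (of_real r) = of_real r" "\<And>z. h (conjugate z) = conjugate (h z)"
proof -
  consider (real) "\<forall>z::'a. \<exists>a. z = a *\<^sub>R 1"
    | (complex) i :: 'a where "i * i = - 1" "\<forall>z. \<exists>a b. z = a *\<^sub>R 1 + b *\<^sub>R i"
    using real_or_complex by auto
  then show thesis
  proof cases
    case real
    then have "\<forall>z::'a. \<exists>a. z = of_real a" by (simp add: scaleR_conv_of_real)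
    then obtain f where f: "\<And>z::'a. z = of_real (f z)" by metis
    have f_of_real [simp]: "f (of_real r) = r" for r by (metis f of_real_eq_iff)
    have hom: "f (a + b) = f a + f b" "f (a * b) = f a * f b" for a b
      by (metis f f_of_real of_real_add, metis f f_of_real of_real_mult)
    have "f 0 = 0" "f 1 = 1" using f_of_real[of 0] f_of_real[of 1] by simp_all
    then have "inj_comm_ring_hom (\<lambda>z. of_real (f z) :: complex)"
      by unfold_locales (use f hom in \<open>auto intro: f[THEN trans]\<close>)
    moreover have "conjugate z = z" for z :: 'a by (metis f conjugate_of_real)
    ultimately show ?thesis using that[of "\<lambda>z. of_real (f z)"] by simp
  next
    case complex
    then have "\<forall>z. \<exists>w. z = of_real (Re w) + of_real (Im w) * i"
      by (metis complex.sel scaleR_conv_of_real mult.right_neutral)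
    then obtain f where f: "\<And>z. z = of_real (Re (f z)) + of_real (Im (f z)) * i" by metis
    \<comment> \<open>Coordinates with respect to 1 and i are unique, since (a + b i)(a - b i) = a^2
      + b^2 vanishes only for a = b = 0.\<close>
    have zero: "a = 0 \<and> b = 0" if "of_real a + of_real b * i = 0" for a b
    proof -
      have "of_real (a * a + b * b) = (of_real a + of_real b * i) * (of_real a - of_real b * i)"
      proof -
        have "of_real b * i * (of_real b * i) = of_real b * of_real b * (i * i)" by (simp only: mult_ac)
        then have "of_real b * i * (of_real b * i) = - of_real (b * b)" using complex(1) by simp
        then show ?thesis by (simp add: algebra_simps)
      qed
      also have "\<dots> = of_real 0" using that by simp
      finally have "a * a + b * b = 0" by (simp only: of_real_eq_iff)
      then show ?thesis by (simp add: sum_squares_eq_zero_iff)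
    qed
    have uniq: "f z = Complex a b" if "z = of_real a + of_real b * i" for z a b
    proof -
      have "of_real (Re (f z) - a) + of_real (Im (f z) - b) * i = 0"
        using that f[of z] by (simp add: algebra_simps)
      from zero[OF this] show ?thesis by (simp add: complex_eq_iff)
    qed
    have f_of_real: "f (of_real r) = of_real r" for r
      using uniq[of "of_real r" r 0] by (simp add: complex_eq_iff)
    have add: "f (a + b) = f a + f b" for a b
      by (subst uniq[of _ "Re (f a) + Re (f b)" "Im (f a) + Im (f b)"], subst f[of a], subst f[of b])
        (simp_all add: complex_eq_iff algebra_simps)
    have mult: "f (a * b) = f a * f b" for a b
    proof -
      have "of_real x * i * (of_real y * i) = - of_real (x * y)" for x y
      proof -
        have "of_real x * i * (of_real y * i) = of_real x * of_real y * (i * i)" by (simp only: mult_ac)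
        then show ?thesis using complex(1) by simp
      qed
      then have "a * b = of_real (Re (f a) * Re (f b) - Im (f a) * Im (f b))
          + of_real (Re (f a) * Im (f b) + Im (f a) * Re (f b)) * i"
        by (subst f[of a], subst f[of b]) (simp add: algebra_simps)
      from uniq[OF this] show ?thesis by (simp add: complex_eq_iff)
    qed
    \<comment> \<open>The axioms do not name the conjugate of i. From |i| = 1 it is an inverse of i,
      and so is - i.\<close>
    have "norm i * norm i = 1" using arg_cong[OF complex(1), of norm] by (simp add: norm_mult)
    then have "i * conjugate i = 1" by (simp add: mult_conjugate_of_real power2_eq_square)
    moreover have "i * (- i) = 1" using complex(1) by simp
    ultimately have i: "conjugate i = - i" by (metis mult_cancel_left mult_zero_left zero_neq_one)
    have "f (conjugate z) = conjugate (f z)" for z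
    proof -
      have "conjugate z = of_real (Re (f z)) + of_real (- Im (f z)) * i"
        by (subst f[of z]) (simp add: conjugate_dist_add conjugate_dist_mul i)
      from uniq[OF this] show ?thesis by (simp add: complex_eq_iff)
    qed
    moreover have "inj_comm_ring_hom f"
    proof
      show "f 0 = 0" "f 1 = 1" using f_of_real[of 0] f_of_real[of 1] by simp_all
      show "f x = 0 \<Longrightarrow> x = 0" for x using f[of x] by simp
    qed (use add mult in auto)
    ultimately show ?thesis using that f_of_real by blast
  qed
qed

lemma mset_eq_if_prod_linear_eq:
  fixes xs ys :: "'a::idom list"
  assumes "(\<Prod>x\<leftarrow>xs. [:- x, 1:]) = (\<Prod>y\<leftarrow>ys. [:- y, 1:])"
  shows "mset xs = mset ys"
  using assms
proof (induction xs arbitrary: ys)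
  case Nil
  then have "degree (\<Prod>y\<leftarrow>ys. [:- y, 1:]) = 0" by (metis degree_1 list.simps(8) prod_list.Nil)
  then show ?case using degree_linear_factors[of uminus ys] by simp
next
  case (Cons x xs)
  have "poly (\<Prod>y\<leftarrow>ys. [:- y, 1:]) x = 0" unfolding Cons.prems[symmetric] by simp
  then have x: "x \<in> set ys" by (induction ys) auto
  then have "mset ys = add_mset x (mset (remove1 x ys))" by simp
  then have ys: "(\<Prod>y\<leftarrow>ys. [:- y, 1:]) = [:- x, 1:] * (\<Prod>y\<leftarrow>remove1 x ys. [:- y, 1:])"
    by (simp only: prod_mset_prod_list[symmetric] mset_map image_mset_add_mset prod_mset.add_mset)
  have "[:- x, 1:] * (\<Prod>x\<leftarrow>xs. [:- x, 1:]) = [:- x, 1:] * (\<Prod>y\<leftarrow>remove1 x ys. [:- y, 1:])"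
    using Cons.prems unfolding ys by simp
  then have "(\<Prod>x\<leftarrow>xs. [:- x, 1:]) = (\<Prod>y\<leftarrow>remove1 x ys. [:- y, 1:])"
    by (subst (asm) mult_cancel_left) simp
  from Cons.IH[OF this] x show ?case by simp
qed

text \<open>The condition under \<open>THE\<close> in \<open>singular_values\<close>, named so that
  existence and uniqueness can be proved separately.\<close>

definition is_singular_values :: "'a::real_or_complex mat \<Rightarrow> real list \<Rightarrow> bool" where
  "is_singular_values A s \<longleftrightarrow> sorted_wrt (\<ge>) s \<and> (\<forall>x\<in>set s. 0 \<le> x) \<and>
     char_poly (mat_adjoint A * A) = (\<Prod>x\<leftarrow>s. [:- of_real (x\<^sup>2), 1:])"

lemma eq_if_prod_linear_squares_eq:
  fixes s s' :: "real list"
  assumes "sorted_wrt (\<ge>) s" "\<forall>x\<in>set s. 0 \<le> x" "sorted_wrt (\<ge>) s'" "\<forall>x\<in>set s'. 0 \<le> x"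
    and "(\<Prod>x\<leftarrow>s. [:- of_real (x\<^sup>2), 1 :: 'a::real_normed_field:]) = (\<Prod>x\<leftarrow>s'. [:- of_real (x\<^sup>2), 1:])"
  shows "s = s'"
proof -
  let ?f = "\<lambda>x. of_real (x\<^sup>2) :: 'a" and ?g = "\<lambda>y :: 'a. sqrt (norm y)"
  have inv: "map ?g (map ?f s) = s" if "\<forall>x\<in>set s. 0 \<le> x" for s
    using that by (induction s) (auto simp: norm_power)
  have "mset (map ?f s) = mset (map ?f s')"
    using assms(5) by (intro mset_eq_if_prod_linear_eq) (simp add: o_def)
  then have "mset (map ?g (map ?f s)) = mset (map ?g (map ?f s'))"
    by (simp only: mset_map)
  then have "mset (rev s) = mset (rev s')"
    unfolding inv[OF assms(2)] inv[OF assms(4)] by simp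
  moreover have "sorted (rev s)" "sorted (rev s')"
    using assms by (simp_all add: sorted_wrt_rev)
  ultimately show ?thesis using properties_for_sort[of "rev s" "rev s'"] sorted_sort_id by fastforce
qed

text \<open>The complex factorization has only roots r^2 with r real, and the embedding h fixes
  reals. So it is the image of a factorization over the original field, and injectivity of h on
  polynomials pulls it back.\<close>

lemma ex_is_singular_values: "\<exists>s. is_singular_values A s" for A :: "'a::real_or_complex mat"
proof -
  define p q where "p = dim_row A" and "q = dim_col A"
  have "\<exists>h :: 'a \<Rightarrow> complex. inj_comm_ring_hom h \<and> (\<forall>r. h (of_real r) = of_real r)
      \<and> (\<forall>z. h (conjugate z) = conjugate (h z))"
    by (rule real_or_complex_embedding[where 'a = 'a]) blast
  then obtain h :: "'a \<Rightarrow> complex" where hom: "inj_comm_ring_hom h"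
    and h_real: "\<And>r. h (of_real r) = of_real r" and h_conj: "\<And>z. h (conjugate z) = conjugate (h z)"
    by blast
  interpret h: inj_comm_ring_hom h by (fact hom)
  interpret hp: map_poly_inj_comm_ring_hom h ..
  have A: "A \<in> carrier_mat p q" by (intro carrier_matI) (simp_all add: p_def q_def)
  have hA: "map_mat h A \<in> carrier_mat p q" using A by simp
  have H: "mat_adjoint A * A \<in> carrier_mat q q" by (rule mult_carrier_mat[OF mat_adjoint_carrier[OF A] A])
  have adj: "map_mat h (mat_adjoint A * A) = mat_adjoint (map_mat h A) * map_mat h A"
    unfolding h.mat_hom_mult[OF mat_adjoint_carrier[OF A] A]
    by (intro arg_cong2[of _ _ _ _ times] eq_matI) (auto simp: h_conj)
  obtain es where es: "char_poly (map_mat h (mat_adjoint A * A)) = (\<Prod>e\<leftarrow>es. [:- e, 1:])"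
    using char_poly_factorized[of "map_mat h (mat_adjoint A * A)" q] H by auto
  have "\<exists>s\<ge>0. e = of_real (s\<^sup>2)" if "e \<in> set es" for e
  proof (rule eigenvalue_adjoint_mult[OF hA])
    have "poly (char_poly (map_mat h (mat_adjoint A * A))) e = 0"
      unfolding es using that by (auto simp: poly_prod_list o_def prod_list_zero_iff)
    moreover have "map_mat h (mat_adjoint A * A) \<in> carrier_mat q q" using H by simp
    ultimately show "eigenvalue (mat_adjoint (map_mat h A) * map_mat h A) e"
      unfolding adj using eigenvalue_root_char_poly by blast
  qed
  then obtain g where g: "\<And>e. e \<in> set es \<Longrightarrow> 0 \<le> g e \<and> e = of_real ((g e)\<^sup>2)" by metis
  define s where "s = rev (sort (map g es))"
  have "(\<Prod>e\<leftarrow>es. [:- e, 1:]) = (\<Prod>x\<leftarrow>map g es. [:- of_real (x\<^sup>2), 1 :: complex:])"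
    unfolding map_map o_def using g by (metis (no_types, lifting) map_cong)
  also have "\<dots> = (\<Prod>x\<leftarrow>s. [:- of_real (x\<^sup>2), 1:])"
    by (subst (1 2) prod_mset_prod_list[symmetric]) (simp add: s_def image_mset.compositionality o_def)
  also have "\<dots> = map_poly h (\<Prod>x\<leftarrow>s. [:- of_real (x\<^sup>2), 1:])"
  proof -
    have lin: "map_poly h [:- of_real r, 1:] = [:- of_real r, 1:]" for r
      by (simp add: map_poly_pCons h_real h.hom_uminus)
    show ?thesis
      by (induction s) (simp_all only: list.map prod_list.Cons prod_list.Nil hp.hom_mult hp.hom_one lin)
  qed
  finally have "map_poly h (char_poly (mat_adjoint A * A)) = map_poly h (\<Prod>x\<leftarrow>s. [:- of_real (x\<^sup>2), 1:])"
    using es h.char_poly_hom[OF H] by simp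
  then have "char_poly (mat_adjoint A * A) = (\<Prod>x\<leftarrow>s. [:- of_real (x\<^sup>2), 1:])"
    by (simp only: hp.eq_iff)
  moreover have "sorted_wrt (\<ge>) s" by (simp add: s_def sorted_wrt_rev)
  moreover have "\<forall>x\<in>set s. 0 \<le> x" using g by (auto simp: s_def)
  ultimately show ?thesis by (auto simp: is_singular_values_def)
qed

lemma is_singular_values_unique:
  "is_singular_values A s \<Longrightarrow> is_singular_values A s' \<Longrightarrow> s = s'"
  unfolding is_singular_values_def by (metis eq_if_prod_linear_squares_eq)

lemma is_singular_values_singular_values: "is_singular_values A (singular_values A)"
proof -
  have "\<exists>!s. is_singular_values A s"
    using ex_is_singular_values is_singular_values_unique by blast
  from theI'[OF this] show ?thesis
    unfolding singular_values_def is_singular_values_def .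
qed

lemma length_singular_values: "length (singular_values A) = dim_col A"
proof -
  have "degree (char_poly (mat_adjoint A * A)) = length (singular_values A)"
    using is_singular_values_singular_values[of A]
      degree_linear_factors[of "\<lambda>x. - of_real (x\<^sup>2) :: 'a" "singular_values A"]
    by (simp add: is_singular_values_def)
  moreover have "mat_adjoint A * A \<in> carrier_mat (dim_col A) (dim_col A)" by (intro carrier_matI) simp_all
  ultimately show ?thesis using degree_monic_char_poly by metis
qed

lemma \<sigma>_nonneg: "0 < i \<Longrightarrow> i \<le> dim_col A \<Longrightarrow> 0 \<le> \<sigma> i A"
  using is_singular_values_singular_values[of A] length_singular_values[of A]
  by (auto simp: \<sigma>_def is_singular_values_def)

text \<open>The list is nonincreasing of length q, so entry q is its least. The lower bound m of the
  Rayleigh quotient is an eigenvalue, hence the square of some entry.\<close>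

lemma \<sigma>_dim_col_le:
  fixes A :: "'a::real_or_complex mat"
  assumes A: "A \<in> carrier_mat p q" and q: "0 < q" and x: "x \<in> carrier_vec q"
  shows "\<sigma> q A * euclidean_norm x \<le> euclidean_norm (A *\<^sub>v x)"
proof -
  let ?s = "singular_values A"
  have s: "sorted_wrt (\<ge>) ?s" "\<forall>x\<in>set ?s. 0 \<le> x"
    "char_poly (mat_adjoint A * A) = (\<Prod>x\<leftarrow>?s. [:- of_real (x\<^sup>2), 1:])"
    using is_singular_values_singular_values[of A] by (auto simp: is_singular_values_def)
  obtain m where m: "0 \<le> m" "eigenvalue (mat_adjoint A * A) (of_real m)"
    "m * (euclidean_norm x)\<^sup>2 \<le> (euclidean_norm (A *\<^sub>v x))\<^sup>2"
    using least_eigenvalue_adjoint_mult[OF A q] x by metis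
  have "poly (char_poly (mat_adjoint A * A)) (of_real m) = 0"
    using m(2) eigenvalue_root_char_poly[of "mat_adjoint A * A" q] A mat_adjoint_carrier[OF A] by simp
  then have "\<exists>x\<in>set ?s. (of_real m :: 'a) = of_real (x\<^sup>2)"
    unfolding s(3) by (auto simp: poly_prod_list o_def prod_list_zero_iff)
  then obtain j where j: "j < length ?s" and mj: "m = (?s ! j)\<^sup>2"
    by (metis in_set_conv_nth of_real_eq_iff)
  have "\<sigma> q A \<le> ?s ! j"
    using s(1) j length_singular_values[of A] A q
    by (cases "j = q - 1") (auto simp: \<sigma>_def sorted_wrt_iff_nth_less)
  moreover have "0 \<le> \<sigma> q A" using \<sigma>_nonneg[of q A] A q by simp
  ultimately have "(\<sigma> q A)\<^sup>2 \<le> m" unfolding mj by (intro power_mono)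
  then have "(\<sigma> q A * euclidean_norm x)\<^sup>2 \<le> m * (euclidean_norm x)\<^sup>2"
    by (simp add: power_mult_distrib mult_right_mono)
  with m(3) have "(\<sigma> q A * euclidean_norm x)\<^sup>2 \<le> (euclidean_norm (A *\<^sub>v x))\<^sup>2" by simp
  then show ?thesis by (rule power2_le_imp_le) simp
qed

text \<open>By \<open>char_poly_mult_swap\<close> the two characteristic polynomials differ by the
  factor x^(q - p), which only appends q - p zeros to the shorter list.\<close>

lemma \<sigma>_mat_adjoint:
  fixes A :: "'a::real_or_complex mat"
  assumes A: "A \<in> carrier_mat p q" and pq: "p \<le> q" and i: "0 < i" "i \<le> p"
  shows "\<sigma> i (mat_adjoint A) = \<sigma> i A"
proof -
  let ?s = "singular_values (mat_adjoint A)"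
  have s: "sorted_wrt (\<ge>) ?s" "\<forall>x\<in>set ?s. 0 \<le> x"
    "char_poly (A * mat_adjoint A) = (\<Prod>x\<leftarrow>?s. [:- of_real (x\<^sup>2), 1:])"
    using is_singular_values_singular_values[of "mat_adjoint A"] by (auto simp: is_singular_values_def)
  have "[:0, 1:] ^ p * char_poly (mat_adjoint A * A)
      = [:0, 1:] ^ p * ([:0, 1:] ^ (q - p) * char_poly (A * mat_adjoint A))"
    using char_poly_mult_swap[OF A mat_adjoint_carrier[OF A]] pq
    by (simp add: mult.assoc[symmetric] power_add[symmetric])
  then have "char_poly (mat_adjoint A * A) = [:0, 1:] ^ (q - p) * char_poly (A * mat_adjoint A)"
    by simp
  also have "\<dots> = (\<Prod>x\<leftarrow>?s @ replicate (q - p) 0. [:- of_real (x\<^sup>2), 1:])"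
    by (simp add: s(3) mult.commute)
  finally have "is_singular_values A (?s @ replicate (q - p) 0)"
    using s(1,2) unfolding is_singular_values_def
    by (intro conjI) (auto simp: sorted_wrt_append sorted_wrt_iff_nth_less[of _ "replicate _ _"])
  then have "singular_values A = ?s @ replicate (q - p) 0"
    using is_singular_values_singular_values is_singular_values_unique by blast
  then show ?thesis using length_singular_values[of "mat_adjoint A"] A i
    by (auto simp: \<sigma>_def nth_append)
qed

section \<open>Solvability and injectivity under perturbations smaller than the smallest singular
  value\<close>

lemma \<sigma>_dim_row_le:
  fixes A :: "'a::real_or_complex mat"
  assumes A: "A \<in> carrier_mat p q" and "0 < p" "p \<le> q" and "u \<in> carrier_vec p"
  shows "\<sigma> p A * euclidean_norm u \<le> euclidean_norm (mat_adjoint A *\<^sub>v u)"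
  using \<sigma>_dim_col_le[OF mat_adjoint_carrier[OF A]] \<sigma>_mat_adjoint[OF A] assms by simp

text \<open>Let B be the adjoint of A'. The solution is x = B w with A' B w = b. The bound |B u| >=
  (\<sigma>_p - c) |u| makes A' B invertible, and |x|^2 = <b, w> <= |b| |w| together with the same
  bound for u = w gives the estimate.\<close>

lemma perturbed_mat_surj:
  fixes A A' :: "'a::real_or_complex mat"
  assumes A: "A \<in> carrier_mat p q" and A': "A' \<in> carrier_mat p q" and p: "0 < p" "p \<le> q"
    and c: "0 \<le> c" "c < \<sigma> p A"
    and le: "\<And>x. x \<in> carrier_vec q \<Longrightarrow> euclidean_norm ((A - A') *\<^sub>v x) \<le> c * euclidean_norm x"
    and b: "b \<in> carrier_vec p"
  shows "\<exists>x\<in>carrier_vec q. A' *\<^sub>v x = b \<and> (\<sigma> p A - c) * euclidean_norm x \<le> euclidean_norm b"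
proof -
  note B = mat_adjoint_carrier[OF A'] and Ad = mat_adjoint_carrier[OF A]
  let ?d = "\<sigma> p A - c"
  have lower: "?d * euclidean_norm u \<le> euclidean_norm (mat_adjoint A' *\<^sub>v u)" if u: "u \<in> carrier_vec p" for u
  proof -
    have "mat_adjoint (A - A') = mat_adjoint A - mat_adjoint A'"
      using A A' by (intro eq_matI) (auto simp: conjugate_diff)
    then have "mat_adjoint A *\<^sub>v u = mat_adjoint (A - A') *\<^sub>v u + mat_adjoint A' *\<^sub>v u"
      using u A A' B Ad minus_mult_distrib_mat_vec[OF Ad B u] by (intro eq_vecI) auto
    then have "euclidean_norm (mat_adjoint A *\<^sub>v u)
        \<le> euclidean_norm (mat_adjoint (A - A') *\<^sub>v u) + euclidean_norm (mat_adjoint A' *\<^sub>v u)"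
      using euclidean_norm_add[of "mat_adjoint (A - A') *\<^sub>v u" q "mat_adjoint A' *\<^sub>v u"] A A' u
        mult_mat_vec_carrier[OF mat_adjoint_carrier[OF minus_carrier_mat[OF A', of A]] u] B by simp
    moreover have "euclidean_norm (mat_adjoint (A - A') *\<^sub>v u) \<le> c * euclidean_norm u"
      using A A' by (intro euclidean_norm_adjoint_le[OF _ c(1) le u]) auto
    ultimately show ?thesis using \<sigma>_dim_row_le[OF A p u] by (simp add: algebra_simps)
  qed
  let ?G = "A' * mat_adjoint A'"
  have G: "?G \<in> carrier_mat p p" using A' B by simp
  have Gu: "?G *\<^sub>v u = A' *\<^sub>v (mat_adjoint A' *\<^sub>v u)" if "u \<in> carrier_vec p" for u
    using assoc_mult_mat_vec[OF A' B that] .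
  have sq: "(A' *\<^sub>v (mat_adjoint A' *\<^sub>v u)) \<bullet>c u = of_real ((euclidean_norm (mat_adjoint A' *\<^sub>v u))\<^sup>2)"
    if u: "u \<in> carrier_vec p" for u
    using scalar_prod_mat_adjoint[OF A' _ u, of "mat_adjoint A' *\<^sub>v u"] B u by (simp add: scalar_prod_self)
  have "det ?G \<noteq> 0"
  proof
    assume "det ?G = 0"
    then obtain v where v: "v \<in> carrier_vec p" "v \<noteq> 0\<^sub>v p" and "?G *\<^sub>v v = 0\<^sub>v p"
      using det_0_iff_vec_prod_zero_field[OF G] by auto
    then have "(of_real ((euclidean_norm (mat_adjoint A' *\<^sub>v v))\<^sup>2) :: 'a) = 0"
      using sq[OF v(1)] Gu[OF v(1)] v(1) by (simp add: scalar_prod_left_zero)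
    then have "euclidean_norm v \<le> 0" using lower[OF v(1)] c by (simp add: mult_le_0_iff)
    then show False using v euclidean_norm_eq_0[OF v(1)] euclidean_norm_nonneg[of v] by simp
  qed
  then obtain C where C: "C \<in> carrier_mat p p" and GC: "?G * C = 1\<^sub>m p"
    using det_non_zero_imp_unit[OF G] by (auto simp: Units_def ring_mat_def)
  define w where "w = C *\<^sub>v b"
  define x where "x = mat_adjoint A' *\<^sub>v w"
  have w: "w \<in> carrier_vec p" using C b by (simp add: w_def)
  have x: "x \<in> carrier_vec q" using B w by (simp add: x_def)
  have A'x: "A' *\<^sub>v x = b"
    using Gu[OF w] assoc_mult_mat_vec[OF G C b] GC b by (simp add: x_def w_def)
  have "(euclidean_norm x)\<^sup>2 = norm (b \<bullet>c w)"
    using sq[OF w] A'x by (simp add: x_def norm_power)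
  also have "\<dots> \<le> euclidean_norm b * euclidean_norm w"
    using scalar_prod_Cauchy_Schwarz[of b p "conjugate w"] b w by simp
  finally have "?d * (euclidean_norm x)\<^sup>2 \<le> euclidean_norm b * (?d * euclidean_norm w)"
    using c mult_left_mono[of "(euclidean_norm x)\<^sup>2" "euclidean_norm b * euclidean_norm w" ?d] by (simp add: mult_ac)
  also have "\<dots> \<le> euclidean_norm b * euclidean_norm x"
    unfolding x_def by (intro mult_left_mono lower[OF w]) simp
  finally have "(?d * euclidean_norm x) * euclidean_norm x \<le> euclidean_norm b * euclidean_norm x"
    by (simp add: power2_eq_square mult_ac)
  then have "?d * euclidean_norm x \<le> euclidean_norm b"
    using euclidean_norm_nonneg[of x] by (cases "euclidean_norm x = 0") (auto simp: mult_le_cancel_right)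
  with x A'x show ?thesis by blast
qed

lemma perturbed_mat_inj:
  fixes A A' :: "'a::real_or_complex mat"
  assumes A: "A \<in> carrier_mat p q" and A': "A' \<in> carrier_mat p q" and q: "0 < q"
    and c: "c < \<sigma> q A"
    and le: "\<And>x. x \<in> carrier_vec q \<Longrightarrow> euclidean_norm ((A - A') *\<^sub>v x) \<le> c * euclidean_norm x"
    and x: "x \<in> carrier_vec q" and 0: "A' *\<^sub>v x = 0\<^sub>v p"
  shows "x = 0\<^sub>v q"
proof -
  have "(A - A') *\<^sub>v x = A *\<^sub>v x"
    using minus_mult_distrib_mat_vec[OF A A' x] 0 A x by simp
  then have "\<sigma> q A * euclidean_norm x \<le> c * euclidean_norm x"
    using le[OF x] \<sigma>_dim_col_le[OF A q x] by simp
  then have "euclidean_norm x = 0"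
    using c euclidean_norm_nonneg[of x] by (auto simp: mult_le_cancel_right)
  then show ?thesis using euclidean_norm_eq_0[OF x] by simp
qed

text \<open>A single unit vector suffices: the smallest singular value bounds its image under the
  adjoint from below, the Frobenius norm from above. Needed for the matrix of leading
  coefficients.\<close>

lemma \<sigma>_dim_row_le_frobenius:
  fixes A :: "'a::real_or_complex mat"
  assumes A: "A \<in> carrier_mat p q" and p: "0 < p" "p \<le> q"
  shows "\<sigma> p A \<le> frobenius_norm A"
proof -
  let ?e = "unit_vec p 0 :: 'a vec"
  have "?e \<noteq> 0\<^sub>v p" using p by (auto simp: vec_eq_iff)
  then have pos: "0 < euclidean_norm ?e"
    by (metis euclidean_norm_eq_0 euclidean_norm_nonneg less_eq_real_def unit_vec_carrier)
  have "\<sigma> p A * euclidean_norm ?e \<le> frobenius_norm A * euclidean_norm ?e"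
    using \<sigma>_dim_row_le[OF A p, of ?e] euclidean_norm_mult_mat_vec_le[OF mat_adjoint_carrier[OF A], of ?e] by simp
  then show ?thesis using pos by simp
qed

section \<open>Rank and polynomial bases\<close>

text \<open>Fraction-free elimination: equation i removes an unknown k with nonzero pivot by
  cross-multiplication. It is stated over a domain because the unknowns are scalars in some uses and
  polynomials in others.\<close>

lemma homogeneous_system_nontrivial_solution:
  fixes A :: "'i \<Rightarrow> 'j \<Rightarrow> 'r::idom"
  assumes "finite I" "finite J" "card I < card J"
  shows "\<exists>u. (\<exists>j\<in>J. u j \<noteq> 0) \<and> (\<forall>i\<in>I. (\<Sum>j\<in>J. A i j * u j) = 0)"
  using assms
proof (induction I arbitrary: J A rule: finite_induct)
  case empty
  then obtain j where "j \<in> J" by fastforce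
  then show ?case by (intro exI[of _ "\<lambda>_. 1"]) auto
next
  case (insert i I)
  show ?case
  proof (cases "\<forall>j\<in>J. A i j = 0")
    case True
    have "card I < card J" using insert by simp
    from insert.IH[OF insert.prems(1) this, of A] True show ?thesis by auto
  next
    case False
    then obtain k where k: "k \<in> J" "A i k \<noteq> 0" by auto
    let ?J = "J - {k}"
    let ?A = "\<lambda>l j. A i k * A l j - A l k * A i j"
    have J: "finite ?J" "card I < card ?J" using insert k by auto
    from insert.IH[OF J, of ?A] obtain u where u: "\<exists>j\<in>?J. u j \<noteq> 0"
      and sol: "\<And>l. l \<in> I \<Longrightarrow> (\<Sum>j\<in>?J. ?A l j * u j) = 0" by auto
    \<comment> \<open>Scaling the other unknowns by the pivot replaces the division that back
      substitution for \<open>v k\<close> would need.\<close>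
    define v where "v j = (if j = k then - (\<Sum>j\<in>?J. A i j * u j) else A i k * u j)" for j
    have split: "(\<Sum>j\<in>J. A l j * v j) = A l k * v k + (\<Sum>j\<in>?J. A l j * (A i k * u j))" for l
      using sum.remove[OF insert.prems(1) k(1), of "\<lambda>j. A l j * v j"] by (simp add: v_def)
    have "(\<Sum>j\<in>J. A l j * v j) = (\<Sum>j\<in>?J. ?A l j * u j)" for l
      unfolding split by (simp add: v_def sum_distrib_left sum_subtractf algebra_simps)
    moreover have "(\<Sum>j\<in>J. A i j * v j) = 0"
      unfolding split by (simp add: v_def sum_distrib_left algebra_simps)
    moreover have "\<exists>j\<in>J. v j \<noteq> 0" using u k by (auto simp: v_def)
    ultimately show ?thesis using sol by (intro exI[of _ v]) auto
  qed
qed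

text \<open>\<open>set (cols A)\<close> forgets repetitions, so distinctness of the columns is
  needed next to independence: equal columns put a difference of unit vectors into the kernel, and
  rank \<open>dim_col A\<close> requires that many distinct columns.\<close>

lemma mat_rank_eq_dim_col_iff:
  fixes A :: "'a::field mat"
  shows "mat_rank A = dim_col A \<longleftrightarrow>
    (\<forall>x\<in>carrier_vec (dim_col A). A *\<^sub>v x = 0\<^sub>v (dim_row A) \<longrightarrow> x = 0\<^sub>v (dim_col A))"
proof -
  interpret vec_space "TYPE('a)" "dim_row A" .
  have A: "A \<in> carrier_mat (dim_row A) (dim_col A)" by (rule carrier_matI) simp_all
  show ?thesis unfolding mat_rank_def
  proof
    assume r: "rank A = dim_col A"
    have "lin_indpt {}" using finite_lin_indpt2[of "{}"] by auto
    then obtain S where S: "maximal S (\<lambda>T. T \<subseteq> set (cols A) \<and> lin_indpt T)"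
      using maximal_exists_superset[of "set (cols A)" "\<lambda>T. T \<subseteq> set (cols A) \<and> lin_indpt T" "{}"]
      by auto
    then have "S \<subseteq> set (cols A)" by (auto simp: maximal_def)
    then have "length (cols A) \<le> card (set (cols A))"
      using rank_card_indpt[OF A S] r by (simp add: card_mono)
    then have "distinct (cols A)" using card_distinct card_length[of "cols A"] by (simp add: card_distinct le_antisym)
    with full_rank_lin_indpt[OF A r] lin_depI[OF A]
    show "\<forall>x\<in>carrier_vec (dim_col A). A *\<^sub>v x = 0\<^sub>v (dim_row A) \<longrightarrow> x = 0\<^sub>v (dim_col A)" by blast
  next
    assume ker: "\<forall>x\<in>carrier_vec (dim_col A). A *\<^sub>v x = 0\<^sub>v (dim_row A) \<longrightarrow> x = 0\<^sub>v (dim_col A)"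
    have "distinct (cols A)"
    proof (rule ccontr)
      assume "\<not> ?thesis"
      then obtain i j where ij: "i < dim_col A" "j < dim_col A" "i \<noteq> j" "col A i = col A j"
        by (auto simp: distinct_conv_nth)
      let ?v = "unit_vec (dim_col A) i - unit_vec (dim_col A) j :: 'a vec"
      have "A *\<^sub>v ?v = 0\<^sub>v (dim_row A)"
      proof (rule eq_vecI)
        fix k assume k: "k < dim_vec (0\<^sub>v (dim_row A) :: 'a vec)"
        then have "(A *\<^sub>v ?v) $ k = col A i $ k - col A j $ k"
          using ij(1-3) by (simp add: scalar_prod_minus_distrib[of _ "dim_col A"])
        then show "(A *\<^sub>v ?v) $ k = 0\<^sub>v (dim_row A) $ k" 
          using arg_cong[OF ij(4), of "\<lambda>v. v $ k"] k ij(1,2) by simp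
      qed simp
      moreover have "?v \<in> carrier_vec (dim_col A)" by simp
      ultimately have "?v = 0\<^sub>v (dim_col A)" using ker by blast
      then have "?v $ i = 0" using ij by simp
      then show False using ij by simp
    qed
    moreover from lin_depE[OF A _ this] ker have "lin_indpt (set (cols A))" by metis
    ultimately show "rank A = dim_col A" by (rule lin_indpt_full_rank[OF A])
  qed
qed

lemma mat_rank_eq_dim_row_iff:
  fixes A :: "'a::field mat"
  shows "mat_rank A = dim_row A \<longleftrightarrow>
    (\<forall>b\<in>carrier_vec (dim_row A). \<exists>x\<in>carrier_vec (dim_col A). A *\<^sub>v x = b)"
proof -
  interpret vec_space "TYPE('a)" "dim_row A" .
  have A: "A \<in> carrier_mat (dim_row A) (dim_col A)" by (rule carrier_matI) simp_all
  have cols: "set (cols A) \<subseteq> carrier_vec (dim_row A)" by (rule cols_dim)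
  have range: "span (set (cols A)) = {y \<in> carrier_vec (dim_row A). \<exists>x\<in>carrier_vec (dim_col A). A *\<^sub>v x = y}"
    using col_space_eq[OF A] by (simp add: col_space_def)
  have "rank A = dim_row A \<longleftrightarrow> span (set (cols A)) = carrier V"
  proof
    assume r: "rank A = dim_row A"
    have "lin_indpt {}" using finite_lin_indpt2[of "{}"] by auto
    then obtain S where S: "maximal S (\<lambda>T. T \<subseteq> set (cols A) \<and> lin_indpt T)"
      using maximal_exists_superset[of "set (cols A)" "\<lambda>T. T \<subseteq> set (cols A) \<and> lin_indpt T" "{}"]
      by auto
    then have S': "S \<subseteq> set (cols A)" "lin_indpt S" by (auto simp: maximal_def)
    have "card S = dim" using rank_card_indpt[OF A S] r dim_is_n by simp
    then have "basis S"
      using S' dim_li_is_basis[OF fin_dim finite_subset[OF S'(1) finite_set] subset_trans[OF S'(1) cols]] by simp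
    then have "span S = carrier V" by (simp add: basis_def)
    moreover have "span S \<subseteq> span (set (cols A))" using S' by (intro span_is_monotone) auto
    moreover have "span (set (cols A)) \<subseteq> carrier V" unfolding range by auto
    ultimately show "span (set (cols A)) = carrier V" by auto
  next
    assume eq: "span (set (cols A)) = carrier V"
    have "vs (carrier V) = V" by (simp add: module_vec_def)
    then show "rank A = dim_row A" unfolding rank_def eq using dim_is_n by (simp only:)
  qed
  then show ?thesis unfolding mat_rank_def range by auto
qed

text \<open>A relation on \<open>insert j P\<close> with \<open>u j = 0\<close> would be a relation
  on P. The exact support of u is recorded so that relations for different j do not involve each
  other's column.\<close>

lemma maximal_independent_columns:
  fixes A :: "'i \<Rightarrow> 'j \<Rightarrow> 'r::idom"
  assumes J: "finite J"
  obtains P where "P \<subseteq> J"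
    "\<And>u. \<lbrakk>\<And>i. i \<in> I \<Longrightarrow> (\<Sum>j\<in>P. A i j * u j) = 0\<rbrakk> \<Longrightarrow> \<forall>j\<in>P. u j = 0"
    "\<And>j. j \<in> J - P \<Longrightarrow>
      \<exists>u. u j \<noteq> 0 \<and> (\<forall>k. k \<notin> insert j P \<longrightarrow> u k = 0) \<and> (\<forall>i\<in>I. (\<Sum>k\<in>J. A i k * u k) = 0)"
proof -
  define dep where "dep P \<longleftrightarrow> (\<exists>u. (\<exists>j\<in>P. u j \<noteq> 0) \<and> (\<forall>i\<in>I. (\<Sum>j\<in>P. A i j * u j) = 0))" for P
  have "\<exists>P. maximal P (\<lambda>P. P \<subseteq> J \<and> \<not> dep P)"
    using maximal_exists_superset[of J "\<lambda>P. P \<subseteq> J \<and> \<not> dep P" "{}"] J by (auto simp: dep_def)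
  then obtain P where max: "maximal P (\<lambda>P. P \<subseteq> J \<and> \<not> dep P)" ..
  then have P: "P \<subseteq> J" "\<not> dep P" by (auto simp: maximal_def)
  have fin: "finite P" using P(1) J finite_subset by blast
  show ?thesis
  proof (rule that[OF P(1)])
    show "\<forall>j\<in>P. u j = 0" if "\<And>i. i \<in> I \<Longrightarrow> (\<Sum>j\<in>P. A i j * u j) = 0" for u
      using P(2) that unfolding dep_def by blast
  next
    fix j assume j: "j \<in> J - P"
    have "dep (insert j P)"
    proof (rule ccontr)
      assume "\<not> ?thesis"
      then have "P = insert j P" using max[unfolded maximal_def] P(1) j by blast
      then show False using j by blast
    qed
    then obtain u where u: "\<exists>k\<in>insert j P. u k \<noteq> 0"
      and rel: "\<And>i. i \<in> I \<Longrightarrow> (\<Sum>k\<in>insert j P. A i k * u k) = 0"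
      unfolding dep_def by blast
    have "u j \<noteq> 0"
    proof
      assume "u j = 0"
      then have "dep P" unfolding dep_def using u rel fin j by (intro exI[of _ u]) auto
      with P(2) show False by simp
    qed
    moreover have "(\<Sum>k\<in>J. A i k * (if k \<in> insert j P then u k else 0)) = 0" if "i \<in> I" for i
    proof -
      have "(\<Sum>k\<in>J. A i k * (if k \<in> insert j P then u k else 0)) = (\<Sum>k\<in>insert j P. A i k * u k)"
        using J P(1) j by (intro sum.mono_neutral_cong_right) auto
      then show ?thesis using rel[OF that] by simp
    qed
    ultimately show "\<exists>u. u j \<noteq> 0 \<and> (\<forall>k. k \<notin> insert j P \<longrightarrow> u k = 0) \<and>
        (\<forall>i\<in>I. (\<Sum>k\<in>J. A i k * u k) = 0)"
      by (intro exI[of _ "\<lambda>k. if k \<in> insert j P then u k else 0"]) auto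
  qed
qed

text \<open>Row rank equals column rank. Fewer than p independent columns admit a nonzero y
  annihilating them and thus all columns; p or more of them form, together with b, a dependent
  family.\<close>

lemma surj_iff_left_kernel_trivial:
  fixes A :: "'a::field mat"
  assumes A: "A \<in> carrier_mat p q"
  shows "(\<forall>b\<in>carrier_vec p. \<exists>x\<in>carrier_vec q. A *\<^sub>v x = b) \<longleftrightarrow>
    (\<forall>y. (\<forall>j<q. (\<Sum>i<p. y i * A $$ (i, j)) = 0) \<longrightarrow> (\<forall>i<p. y i = 0))" (is "?S \<longleftrightarrow> ?L")
proof
  assume S: ?S
  show ?L
  proof (intro allI impI)
    fix y i assume y: "\<forall>j<q. (\<Sum>i<p. y i * A $$ (i, j)) = 0" and i: "i < p"
    obtain x where x: "x \<in> carrier_vec q" "A *\<^sub>v x = unit_vec p i" using S by (meson unit_vec_carrier)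
    have "(\<Sum>l<p. y l * (A *\<^sub>v x) $ l) = (\<Sum>j<q. (\<Sum>l<p. y l * A $$ (l, j)) * x $ j)"
      using A x(1) by (simp add: scalar_prod_def sum_distrib_left sum_distrib_right atLeast0LessThan mult_ac)
        (rule sum.swap)
    also have "\<dots> = 0" using y by simp
    finally have "(\<Sum>l<p. if l = i then y l else 0) = 0"
      using i by (simp add: x(2) unit_vec_def if_distrib cong: if_cong)
    then show "y i = 0" using i by simp
  qed
next
  assume L: ?L
  obtain P where P: "P \<subseteq> {..<q}"
    and ind: "\<And>u. \<lbrakk>\<And>i. i \<in> {..<p} \<Longrightarrow> (\<Sum>j\<in>P. A $$ (i, j) * u j) = 0\<rbrakk> \<Longrightarrow> \<forall>j\<in>P. u j = 0"
    and rel: "\<And>j. j \<in> {..<q} - P \<Longrightarrow> \<exists>u. u j \<noteq> 0 \<and> (\<forall>k. k \<notin> insert j P \<longrightarrow> u k = 0) \<and>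
      (\<forall>i\<in>{..<p}. (\<Sum>k<q. A $$ (i, k) * u k) = 0)"
    using maximal_independent_columns[of "{..<q}" "{..<p}" "\<lambda>i j. A $$ (i, j)"] by blast
  have fin: "finite P" using P finite_subset by blast
  have "p \<le> card P"
  proof (rule ccontr)
    assume "\<not> ?thesis"
    then obtain y where y: "\<exists>i<p. y i \<noteq> 0" "\<And>j. j \<in> P \<Longrightarrow> (\<Sum>i<p. A $$ (i, j) * y i) = 0"
      using homogeneous_system_nontrivial_solution[of P "{..<p}" "\<lambda>j i. A $$ (i, j)"] fin by auto
    have "(\<Sum>i<p. y i * A $$ (i, j)) = 0" if j: "j < q" for j
    proof (cases "j \<in> P")
      case True
      then show ?thesis using y(2)[of j] by (simp add: mult.commute)
    next
      case False
      then obtain u where u: "u j \<noteq> 0" "\<And>k. k \<notin> insert j P \<Longrightarrow> u k = 0"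
        and 0: "\<And>i. i < p \<Longrightarrow> (\<Sum>k<q. A $$ (i, k) * u k) = 0"
        using rel[of j] j by auto
      have "0 = (\<Sum>i<p. y i * (\<Sum>k<q. A $$ (i, k) * u k))" using 0 by simp
      also have "\<dots> = (\<Sum>k<q. (\<Sum>i<p. A $$ (i, k) * y i) * u k)"
        by (simp only: sum_distrib_left sum_distrib_right, subst sum.swap) (simp add: mult_ac)
      also have "\<dots> = (\<Sum>k<q. if k = j then (\<Sum>i<p. A $$ (i, j) * y i) * u j else 0)"
        using u(2) y(2) by (intro sum.cong refl) (metis insert_iff mult_eq_0_iff)
      finally show ?thesis using u(1) j by (simp add: mult.commute)
    qed
    with L y(1) show False by blast
  qed
  show ?S
  proof
    fix b :: "'a vec" assume b: "b \<in> carrier_vec p"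
    \<comment> \<open>\<open>None\<close> is the extra column b. Its coefficient is nonzero because
      the columns in P are independent, so the relation can be solved for b.\<close>
    let ?J = "insert None (Some ` P)"
    let ?B = "\<lambda>i j. case j of None \<Rightarrow> b $ i | Some j \<Rightarrow> A $$ (i, j)"
    have "card {..<p} < card ?J" using fin \<open>p \<le> card P\<close> by (simp add: card_image)
    then obtain u where u: "\<exists>j\<in>?J. u j \<noteq> 0" and rel: "\<And>i. i < p \<Longrightarrow> (\<Sum>j\<in>?J. ?B i j * u j) = 0"
      using homogeneous_system_nontrivial_solution[of "{..<p}" ?J ?B] fin by auto
    have rel': "b $ i * u None + (\<Sum>j\<in>P. A $$ (i, j) * u (Some j)) = 0" if "i < p" for i
      using rel[OF that] fin by (simp add: sum.reindex)
    have "u None \<noteq> 0"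
    proof
      assume "u None = 0"
      then have "\<forall>j\<in>P. u (Some j) = 0" using rel' by (intro ind) simp
      with u \<open>u None = 0\<close> show False by auto
    qed
    define x where "x = vec q (\<lambda>j. if j \<in> P then - u (Some j) / u None else 0)"
    have "A *\<^sub>v x = b"
    proof (rule eq_vecI)
      fix i assume "i < dim_vec b"
      then have i: "i < p" using b by simp
      have "(A *\<^sub>v x) $ i = (\<Sum>j<q. if j \<in> P then A $$ (i, j) * (- u (Some j) / u None) else 0)"
        using A i by (simp add: x_def scalar_prod_def atLeast0LessThan if_distrib cong: if_cong)
      also have "\<dots> = (\<Sum>j\<in>P. A $$ (i, j) * (- u (Some j) / u None))"
        using P by (simp add: sum.inter_restrict[symmetric] Int_absorb1)
      also have "\<dots> = - (\<Sum>j\<in>P. A $$ (i, j) * u (Some j)) / u None"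
        by (simp add: sum_divide_distrib sum_negf)
      also have "(\<Sum>j\<in>P. A $$ (i, j) * u (Some j)) = - (b $ i * u None)"
        using rel'[OF i] by (simp add: eq_neg_iff_add_eq_0 add.commute)
      finally show "(A *\<^sub>v x) $ i = b $ i" using \<open>u None \<noteq> 0\<close> by simp
    qed (use A b in auto)
    then show "\<exists>x\<in>carrier_vec q. A *\<^sub>v x = b" by (auto simp: x_def)
  qed
qed

text \<open>Coefficients come from the domain itself; by clearing denominators this is independence
  over the field of fractions (\<open>indep_rows_iff_fract\<close>). Indexing by position turns a
  repeated vector into a dependence.\<close>

definition indep_rows :: "nat \<Rightarrow> 'r::idom vec list \<Rightarrow> bool" where
  "indep_rows q vs \<longleftrightarrow>
     (\<forall>c. (\<forall>i<q. (\<Sum>l<length vs. c l * vs ! l $ i) = 0) \<longrightarrow> (\<forall>l<length vs. c l = 0))"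

lemma indep_rowsD:
  assumes "indep_rows q vs" "\<And>i. i < q \<Longrightarrow> (\<Sum>l<length vs. c l * vs ! l $ i) = 0" "l < length vs"
  shows "c l = 0"
  using assms unfolding indep_rows_def by blast

text \<open>The factor g clears denominators, so this is membership in the span over the field of
  fractions (\<open>in_row_span_iff_fract\<close>).\<close>

definition in_row_span :: "nat \<Rightarrow> 'r::idom vec list \<Rightarrow> 'r vec \<Rightarrow> bool" where
  "in_row_span q vs v \<longleftrightarrow> (\<exists>g c. g \<noteq> 0 \<and> (\<forall>i<q. g * v $ i = (\<Sum>l<length vs. c l * vs ! l $ i)))"

lemma in_row_span_member: "v \<in> set vs \<Longrightarrow> in_row_span q vs v"
proof -
  assume "v \<in> set vs"
  then obtain k where k: "k < length vs" "v = vs ! k" by (metis in_set_conv_nth)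
  have "1 * v $ i = (\<Sum>l<length vs. (if l = k then 1 else 0) * vs ! l $ i)" for i
    using k by (simp add: if_distrib[of "\<lambda>x. x * _"] cong: if_cong)
  then show ?thesis unfolding in_row_span_def by (metis zero_neq_one)
qed

text \<open>With more \<open>ws\<close> than \<open>vs\<close>, the coordinates of the multiples
  \<open>g l * ws ! l\<close> satisfy a nontrivial relation u, and the products
  \<open>u l * g l\<close> are then a relation among the \<open>ws\<close>.\<close>

lemma length_indep_rows_le:
  assumes ws: "indep_rows q ws" and span: "\<And>w. w \<in> set ws \<Longrightarrow> in_row_span q vs w"
  shows "length ws \<le> length vs"
proof (rule ccontr)
  assume *: "\<not> ?thesis"
  have "\<forall>l. \<exists>g c. l < length ws \<longrightarrow>
      g \<noteq> 0 \<and> (\<forall>i<q. g * ws ! l $ i = (\<Sum>j<length vs. c j * vs ! j $ i))"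
    using span[OF nth_mem] unfolding in_row_span_def by auto
  from this[unfolded choice_iff] obtain g c where gc: "\<And>l. l < length ws \<Longrightarrow> g l \<noteq> 0"
    "\<And>l i. l < length ws \<Longrightarrow> i < q \<Longrightarrow> g l * ws ! l $ i = (\<Sum>j<length vs. c l j * vs ! j $ i)"
    by blast
  obtain u where u: "\<exists>l<length ws. u l \<noteq> 0"
    and rel: "\<And>j. j < length vs \<Longrightarrow> (\<Sum>l<length ws. c l j * u l) = 0"
    using homogeneous_system_nontrivial_solution[of "{..<length vs}" "{..<length ws}" "\<lambda>j l. c l j"] *
    by auto
  have "(\<Sum>l<length ws. (u l * g l) * ws ! l $ i) = 0" if i: "i < q" for i
  proof -
    have "(\<Sum>l<length ws. (u l * g l) * ws ! l $ i)
        = (\<Sum>l<length ws. \<Sum>j<length vs. u l * (c l j * vs ! j $ i))"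
      using gc(2) i by (intro sum.cong) (auto simp: mult.assoc sum_distrib_left)
    also have "\<dots> = (\<Sum>j<length vs. (\<Sum>l<length ws. c l j * u l) * vs ! j $ i)"
      by (subst sum.swap) (simp add: sum_distrib_left mult_ac)
    finally show ?thesis using rel by simp
  qed
  then have "\<forall>l<length ws. u l * g l = 0"
    using indep_rowsD[OF ws, of "\<lambda>l. u l * g l"] by blast
  then show False using u gc(1) by auto
qed

lemma indep_rows_snoc:
  assumes vs: "indep_rows q vs" and "\<not> in_row_span q vs w"
  shows "indep_rows q (vs @ [w])"
  unfolding indep_rows_def
proof (rule allI, rule impI)
  fix c assume c: "\<forall>i<q. (\<Sum>l<length (vs @ [w]). c l * (vs @ [w]) ! l $ i) = 0"
  let ?n = "length vs"
  have split: "(\<Sum>l<?n. c l * vs ! l $ i) + c ?n * w $ i = 0" if "i < q" for i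
  proof -
    have "(\<Sum>l<?n. c l * (vs @ [w]) ! l $ i) = (\<Sum>l<?n. c l * vs ! l $ i)"
      by (intro sum.cong) (auto simp: nth_append)
    then show ?thesis using c that by (auto simp del: nth_append_length_plus)
  qed
  have "c ?n = 0"
  proof (rule ccontr)
    assume "c ?n \<noteq> 0"
    moreover have "c ?n * w $ i = (\<Sum>l<?n. (- c l) * vs ! l $ i)" if "i < q" for i
      using split[OF that] add_eq_0_iff[of "\<Sum>l<?n. c l * vs ! l $ i" "c ?n * w $ i"] by (simp add: sum_negf)
    ultimately have "in_row_span q vs w"
      unfolding in_row_span_def by (intro exI[of _ "c ?n"] exI[of _ "\<lambda>l. - c l"]) simp
    with assms show False by simp
  qed
  moreover have "\<forall>l<?n. c l = 0"
  proof (intro allI impI, rule indep_rowsD[OF vs])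
    show "(\<Sum>l<?n. c l * vs ! l $ i) = 0" if "i < q" for i
      using split[OF that] \<open>c ?n = 0\<close> by simp
  qed
  ultimately show "\<forall>l<length (vs @ [w]). c l = 0" by (auto simp: less_Suc_eq)
qed

text \<open>Steinitz exchange: a longest independent extension of xs by members of vs spans vs by
  \<open>indep_rows_snoc\<close>, hence is at least as long as vs.\<close>

lemma indep_rows_exchange:
  assumes xs: "indep_rows q xs" and vs: "indep_rows q vs"
    and span: "\<And>x. x \<in> set xs \<Longrightarrow> in_row_span q vs x"
  obtains ys where "set ys \<subseteq> set vs" "indep_rows q (xs @ ys)" "length xs + length ys = length vs"
proof -
  let ?P = "\<lambda>ys. set ys \<subseteq> set vs \<and> indep_rows q (xs @ ys)"
  have bound: "length xs + length ys \<le> length vs" if "?P ys" for ys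
    using length_indep_rows_le[of q "xs @ ys" vs] that span in_row_span_member by fastforce
  have "\<exists>ys. ?P ys \<and> (\<forall>zs. ?P zs \<longrightarrow> length zs \<le> length ys)"
  proof (rule ex_has_greatest_nat[of ?P "[]" length "Suc (length vs)"])
    show "?P []" using xs by simp
    show "\<forall>zs. ?P zs \<longrightarrow> length zs < Suc (length vs)" using bound by (metis le_imp_less_Suc add_leD2)
  qed
  then obtain ys where ys: "?P ys" and max: "\<And>zs. ?P zs \<Longrightarrow> length zs \<le> length ys" by blast
  have "in_row_span q (xs @ ys) v" if v: "v \<in> set vs" for v
  proof (rule ccontr)
    assume "\<not> ?thesis"
    from indep_rows_snoc[OF _ this] ys v have "?P (ys @ [v])" by simp
    from max[OF this] show False by simp
  qed
  from length_indep_rows_le[OF vs this] bound[OF ys] that[of ys] ys show thesis by simp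
qed

section \<open>Passage to the field of fractions: independence, spans and minimality\<close>

lemma common_denominator:
  fixes c :: "nat \<Rightarrow> 'r::idom fract"
  shows "\<exists>g p. g \<noteq> 0 \<and> (\<forall>l<n. to_fract g * c l = to_fract (p l))"
proof (induction n)
  case 0
  show ?case by (intro exI[of _ 1]) simp
next
  case (Suc n)
  then obtain g p where g: "g \<noteq> 0" "\<And>l. l < n \<Longrightarrow> to_fract g * c l = to_fract (p l)" by auto
  obtain a b where ab: "c n = Fract a b" "b \<noteq> 0" by (cases "c n") auto
  then have cn: "to_fract b * c n = to_fract a" by (simp add: Fract_conv_to_fract)
  have "to_fract (b * g) * c l = to_fract (if l = n then g * a else b * p l)" if "l < Suc n" for l
    using cn g(2)[of l] that by (cases "l = n") (auto simp: mult_ac)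
  then show ?case using ab g(1) by (intro exI[of _ "b * g"] exI[of _ "\<lambda>l. if l = n then g * a else b * p l"]) auto
qed

lemma to_fract_sum: "to_fract (sum f A) = (\<Sum>x\<in>A. to_fract (f x))"
  by (induction A rule: infinite_finite_induct) auto

lemma indep_rows_iff_fract:
  fixes vs :: "'r::idom vec list"
  shows "indep_rows q vs \<longleftrightarrow>
    (\<forall>c. (\<forall>i<q. (\<Sum>l<length vs. c l * to_fract (vs ! l $ i)) = 0) \<longrightarrow> (\<forall>l<length vs. c l = 0))"
    (is "_ \<longleftrightarrow> ?F")
proof
  assume ind: "indep_rows q vs"
  show ?F
  proof (rule allI, rule impI)
    fix c assume c: "\<forall>i<q. (\<Sum>l<length vs. c l * to_fract (vs ! l $ i)) = 0"
    obtain g p where g: "g \<noteq> 0" and p: "\<And>l. l < length vs \<Longrightarrow> to_fract g * c l = to_fract (p l)"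
      using common_denominator[of "length vs" c] by auto
    have "(\<Sum>l<length vs. p l * vs ! l $ i) = 0" if i: "i < q" for i
    proof -
      have "to_fract (\<Sum>l<length vs. p l * vs ! l $ i)
          = (\<Sum>l<length vs. to_fract g * (c l * to_fract (vs ! l $ i)))"
        unfolding to_fract_sum by (intro sum.cong) (auto simp: p[symmetric] mult_ac)
      also have "\<dots> = 0" using c i by (simp add: sum_distrib_left[symmetric])
      finally show ?thesis by (simp only: to_fract_eq_0_iff)
    qed
    then have "\<forall>l<length vs. p l = 0" using indep_rowsD[OF ind, of p] by blast
    then have "\<forall>l<length vs. to_fract g * c l = 0" using p by simp
    then show "\<forall>l<length vs. c l = 0" using g by simp
  qed
next
  assume F: ?F
  show "indep_rows q vs"
    unfolding indep_rows_def
  proof (rule allI, rule impI)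
    fix c assume c: "\<forall>i<q. (\<Sum>l<length vs. c l * vs ! l $ i) = 0"
    have "(\<Sum>l<length vs. to_fract (c l) * to_fract (vs ! l $ i)) = 0" if "i < q" for i
    proof -
      have "to_fract (\<Sum>l<length vs. c l * vs ! l $ i) = 0" using c that by simp
      then show ?thesis by (simp add: to_fract_sum)
    qed
    then have "\<forall>l<length vs. to_fract (c l) = 0" using spec[OF F, of "\<lambda>l. to_fract (c l)"] by blast
    then show "\<forall>l<length vs. c l = 0" by simp
  qed
qed

lemma in_row_span_iff_fract:
  fixes vs :: "'r::idom vec list"
  shows "in_row_span q vs v \<longleftrightarrow>
    (\<exists>c. \<forall>i<q. to_fract (v $ i) = (\<Sum>l<length vs. c l * to_fract (vs ! l $ i)))"
proof
  assume "in_row_span q vs v"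
  then obtain g c where g: "g \<noteq> 0" and c: "\<And>i. i < q \<Longrightarrow> g * v $ i = (\<Sum>l<length vs. c l * vs ! l $ i)"
    by (auto simp: in_row_span_def)
  have "to_fract (v $ i) = (\<Sum>l<length vs. (to_fract (c l) / to_fract g) * to_fract (vs ! l $ i))"
    if i: "i < q" for i
  proof -
    have "to_fract g * to_fract (v $ i) = (\<Sum>l<length vs. to_fract (c l) * to_fract (vs ! l $ i))"
      using arg_cong[OF c[OF i], of to_fract] by (simp add: to_fract_sum)
    then show ?thesis using g by (simp add: sum_divide_distrib[symmetric] field_simps)
  qed
  then show "\<exists>c. \<forall>i<q. to_fract (v $ i) = (\<Sum>l<length vs. c l * to_fract (vs ! l $ i))"
    by (intro exI[of _ "\<lambda>l. to_fract (c l) / to_fract g"]) auto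
next
  assume "\<exists>c. \<forall>i<q. to_fract (v $ i) = (\<Sum>l<length vs. c l * to_fract (vs ! l $ i))"
  then obtain c where c: "\<And>i. i < q \<Longrightarrow> to_fract (v $ i) = (\<Sum>l<length vs. c l * to_fract (vs ! l $ i))"
    by auto
  obtain g p where g: "g \<noteq> 0" and p: "\<And>l. l < length vs \<Longrightarrow> to_fract g * c l = to_fract (p l)"
    using common_denominator[of "length vs" c] by auto
  have "g * v $ i = (\<Sum>l<length vs. p l * vs ! l $ i)" if i: "i < q" for i
  proof -
    have "to_fract (g * v $ i) = to_fract (\<Sum>l<length vs. p l * vs ! l $ i)"
      unfolding to_fract_sum using c[OF i]
      by (auto simp: p[symmetric] sum_distrib_left mult_ac intro!: sum.cong)
    then show ?thesis by (simp only: to_fract_eq_iff)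
  qed
  with g show "in_row_span q vs v" unfolding in_row_span_def by blast
qed


definition fract_span :: "nat \<Rightarrow> 'r::idom vec list \<Rightarrow> 'r fract vec set" where
  "fract_span q vs =
     {v \<in> carrier_vec q. \<exists>c. \<forall>i<q. v $ i = (\<Sum>l<length vs. c l * to_fract (vs ! l $ i))}"

lemma span_eq_fract_span:
  fixes vs :: "'r::idom vec list"
  assumes "set vs \<subseteq> carrier_vec q"
  shows "LinearCombinations.module.span class_ring (module_vec TYPE('r fract) q) (map_vec to_fract ` set vs)
    = fract_span q vs"
proof -
  interpret vec_space "TYPE('r fract)" q .
  let ?F = "mat_of_cols q (map (map_vec to_fract) vs)"
  have F: "?F \<in> carrier_mat q (length vs)"
    using mat_of_cols_carrier(1)[of q "map (map_vec to_fract) vs"] by simp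
  have "set (map (map_vec to_fract) vs) \<subseteq> carrier_vec q" using assms by auto
  then have "cols ?F = map (map_vec to_fract) vs" by (rule cols_mat_of_cols)
  then have "span (map_vec to_fract ` set vs)
      = {y \<in> carrier_vec q. \<exists>x\<in>carrier_vec (length vs). ?F *\<^sub>v x = y}"
    using col_space_eq[OF F] by (simp add: col_space_def)
  also have "\<dots> = fract_span q vs" unfolding fract_span_def
  proof (intro Collect_cong conj_cong refl)
    fix y :: "'r fract vec" assume y: "y \<in> carrier_vec q"
    have mult: "(?F *\<^sub>v x) $ i = (\<Sum>l<length vs. x $ l * to_fract (vs ! l $ i))"
      if "x \<in> carrier_vec (length vs)" "i < q" for x i
    proof -
      have "dim_vec (vs ! l) = q" if "l < length vs" for l using that assms by (meson carrier_vecD nth_mem subsetD)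
      then show ?thesis using that
        by (auto simp: scalar_prod_def atLeast0LessThan mat_of_cols_index mult.commute intro!: sum.cong)
    qed
    show "(\<exists>x\<in>carrier_vec (length vs). ?F *\<^sub>v x = y) \<longleftrightarrow>
      (\<exists>c. \<forall>i<q. y $ i = (\<Sum>l<length vs. c l * to_fract (vs ! l $ i)))"
    proof
      assume "\<exists>x\<in>carrier_vec (length vs). ?F *\<^sub>v x = y"
      then obtain x where x: "x \<in> carrier_vec (length vs)" and y: "?F *\<^sub>v x = y" by auto
      have "\<forall>i<q. y $ i = (\<Sum>l<length vs. x $ l * to_fract (vs ! l $ i))"
        using mult[OF x] unfolding y by simp
      then show "\<exists>c. \<forall>i<q. y $ i = (\<Sum>l<length vs. c l * to_fract (vs ! l $ i))"
        by (intro exI[of _ "\<lambda>l. x $ l"])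
    next
      assume "\<exists>c. \<forall>i<q. y $ i = (\<Sum>l<length vs. c l * to_fract (vs ! l $ i))"
      then obtain c where c: "\<forall>i<q. y $ i = (\<Sum>l<length vs. c l * to_fract (vs ! l $ i))" by auto
      have "?F *\<^sub>v vec (length vs) c = y"
        using y c mult[of "vec (length vs) c"] by (intro eq_vecI) auto
      then show "\<exists>x\<in>carrier_vec (length vs). ?F *\<^sub>v x = y"
        by (intro bexI[of _ "vec (length vs) c"]) auto
    qed
  qed
  finally show ?thesis .
qed

text \<open>\<open>lin_dep\<close> sees only the set of vectors, \<open>indep_rows\<close> the list;
  \<open>distinct vs\<close> makes up for the difference.\<close>

lemma lin_indpt_iff_indep_rows:
  fixes vs :: "'r::idom vec list"
  assumes vs: "set vs \<subseteq> carrier_vec q"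
  shows "distinct vs \<and>
    \<not> LinearCombinations.module.lin_dep class_ring (module_vec TYPE('r fract) q) (map_vec to_fract ` set vs)
    \<longleftrightarrow> indep_rows q vs"
proof -
  interpret vec_space "TYPE('r fract)" q .
  let ?F = "mat_of_cols q (map (map_vec to_fract) vs)"
  have F: "?F \<in> carrier_mat q (length vs)"
    using mat_of_cols_carrier(1)[of q "map (map_vec to_fract) vs"] by simp
  have "set (map (map_vec to_fract) vs) \<subseteq> carrier_vec q" using vs by auto
  then have cols: "cols ?F = map (map_vec to_fract) vs" by (rule cols_mat_of_cols)
  have inj: "inj_on (map_vec (to_fract :: 'r \<Rightarrow> _)) (set vs)"
  proof (rule inj_onI)
    fix v w :: "'r vec" assume "v \<in> set vs" "w \<in> set vs" and eq: "map_vec to_fract v = map_vec to_fract w"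
    then have vw: "v \<in> carrier_vec q" "w \<in> carrier_vec q" using vs by auto
    show "v = w"
    proof (rule eq_vecI)
      fix i assume "i < dim_vec w"
      then show "v $ i = w $ i" using arg_cong[OF eq, of "\<lambda>v. v $ i"] vw by simp
    qed (use vw in simp)
  qed
  have distinct: "distinct (cols ?F) \<longleftrightarrow> distinct vs"
    unfolding cols by (simp add: distinct_map inj)
  have mult: "?F *\<^sub>v vec (length vs) c = 0\<^sub>v q \<longleftrightarrow>
      (\<forall>i<q. (\<Sum>l<length vs. c l * to_fract (vs ! l $ i)) = 0)" for c
  proof -
    have "dim_vec (vs ! l) = q" if "l < length vs" for l using that vs by (meson carrier_vecD nth_mem subsetD)
    then have "(?F *\<^sub>v vec (length vs) c) $ i = (\<Sum>l<length vs. c l * to_fract (vs ! l $ i))" if "i < q" for i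
      using that by (auto simp: scalar_prod_def atLeast0LessThan mat_of_cols_index mult.commute intro!: sum.cong)
    then show ?thesis by (auto simp: vec_eq_iff)
  qed
  show ?thesis
  proof
    assume *: "distinct vs \<and> \<not> lin_dep (map_vec to_fract ` set vs)"
    show "indep_rows q vs"
      unfolding indep_rows_iff_fract
    proof (rule allI, rule impI)
      fix c assume "\<forall>i<q. (\<Sum>l<length vs. c l * to_fract (vs ! l $ i)) = 0"
      then have "?F *\<^sub>v vec (length vs) c = 0\<^sub>v q" using mult by simp
      then have "vec (length vs) c = 0\<^sub>v (length vs)"
        using lin_depI[OF F, of "vec (length vs) c"] * distinct cols by (metis list.set_map vec_carrier)
      then show "\<forall>l<length vs. c l = 0" by (metis index_vec index_zero_vec(1))
    qed
  next
    assume ind: "indep_rows q vs"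
    have d: "distinct vs"
    proof (rule ccontr)
      assume "\<not> ?thesis"
      then obtain i j where ij: "i < length vs" "j < length vs" "i \<noteq> j" "vs ! i = vs ! j"
        by (auto simp: distinct_conv_nth)
      let ?c = "\<lambda>l. if l = i then 1 else if l = j then - 1 else 0 :: 'r"
      have "(\<Sum>l<length vs. ?c l * vs ! l $ k) = 0" for k
      proof -
        have "(\<Sum>l<length vs. ?c l * vs ! l $ k)
            = (\<Sum>l<length vs. (if l = i then vs ! i $ k else 0) - (if l = j then vs ! j $ k else 0))"
          using ij by (intro sum.cong) auto
        then show ?thesis using ij by (simp add: sum_subtractf)
      qed
      from indep_rowsD[OF ind this ij(1)] show False by simp
    qed
    moreover have "\<not> lin_dep (map_vec to_fract ` set vs)"
    proof
      assume "lin_dep (map_vec to_fract ` set vs)"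
      then have "lin_dep (set (cols ?F))" by (simp add: cols)
      then obtain v where v: "v \<in> carrier_vec (length vs)" "v \<noteq> 0\<^sub>v (length vs)" "?F *\<^sub>v v = 0\<^sub>v q"
        using lin_depE[OF F] distinct d by metis
      have vec: "vec (length vs) (($) v) = v" using v(1) by auto
      then have "\<forall>l<length vs. v $ l = 0"
        using mult[of "($) v"] v(3) ind unfolding indep_rows_iff_fract vec by blast
      then show False using v by (auto simp: vec_eq_iff)
    qed
    ultimately show "distinct vs \<and> \<not> lin_dep (map_vec to_fract ` set vs)" by simp
  qed
qed

lemma polynomial_basis_iff:
  "polynomial_basis q V ws \<longleftrightarrow> set ws \<subseteq> carrier_vec q \<and> indep_rows q ws \<and> fract_span q ws = V"
  unfolding polynomial_basis_def Let_def
  using lin_indpt_iff_indep_rows[of ws q] span_eq_fract_span[of ws q] by auto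

lemma row_space_eq_fract_span:
  assumes P: "P \<in> carrier_mat r q"
  shows "vec_space.row_space q (map_mat to_fract P) = fract_span q (rows P)"
proof -
  have "set (rows (map_mat to_fract P)) = map_vec to_fract ` set (rows P)"
    unfolding rows_def using P by (auto simp: image_image intro!: image_cong eq_vecI)
  then show ?thesis
    unfolding vec_space.row_space_def using span_eq_fract_span[of "rows P" q] rows_carrier[of P] P by auto
qed

lemma fract_span_mono:
  fixes vs ws :: "'r::idom vec list"
  assumes "\<And>w. w \<in> set ws \<Longrightarrow> in_row_span q vs w"
  shows "fract_span q ws \<subseteq> fract_span q vs"
proof
  fix v assume "v \<in> fract_span q ws"
  then obtain c where v: "v \<in> carrier_vec q" "\<And>i. i < q \<Longrightarrow> v $ i = (\<Sum>l<length ws. c l * to_fract (ws ! l $ i))"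
    by (auto simp: fract_span_def)
  have "\<forall>l. \<exists>b. l < length ws \<longrightarrow>
      (\<forall>i<q. to_fract (ws ! l $ i) = (\<Sum>j<length vs. b j * to_fract (vs ! j $ i)))"
    using assms[OF nth_mem] unfolding in_row_span_iff_fract by auto
  then obtain b where b: "\<And>l i. l < length ws \<Longrightarrow> i < q \<Longrightarrow>
      to_fract (ws ! l $ i) = (\<Sum>j<length vs. b l j * to_fract (vs ! j $ i))"
    by metis
  have "v $ i = (\<Sum>j<length vs. (\<Sum>l<length ws. c l * b l j) * to_fract (vs ! j $ i))" if i: "i < q" for i
  proof -
    have "v $ i = (\<Sum>l<length ws. \<Sum>j<length vs. c l * (b l j * to_fract (vs ! j $ i)))"
      unfolding v(2)[OF i] using b i by (intro sum.cong) (auto simp: sum_distrib_left)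
    also have "\<dots> = (\<Sum>j<length vs. (\<Sum>l<length ws. c l * b l j) * to_fract (vs ! j $ i))"
      by (subst sum.swap) (simp add: sum_distrib_left sum_distrib_right mult_ac)
    finally show ?thesis .
  qed
  with v(1) show "v \<in> fract_span q vs"
    by (auto simp: fract_span_def intro!: exI[of _ "\<lambda>j. \<Sum>l<length ws. c l * b l j"])
qed

lemma in_row_span_if_fract_span_eq:
  assumes ws: "set ws \<subseteq> carrier_vec q" and sub: "fract_span q ws \<subseteq> fract_span q vs" and w: "w \<in> set ws"
  shows "in_row_span q vs w"
proof -
  obtain c where c: "\<And>i. i < q \<Longrightarrow> to_fract (w $ i) = (\<Sum>l<length ws. c l * to_fract (ws ! l $ i))"
    using in_row_span_member[OF w, of q] unfolding in_row_span_iff_fract by auto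
  have "map_vec to_fract w \<in> fract_span q ws"
    unfolding fract_span_def using ws w c by (auto intro!: exI[of _ c])
  with sub have "map_vec to_fract w \<in> fract_span q vs" by auto
  then show ?thesis
    unfolding in_row_span_iff_fract fract_span_def using ws w by auto
qed

lemma full_row_rank_iff_indep_rows:
  fixes P :: "'a::field poly mat"
  assumes P: "P \<in> carrier_mat r q"
  shows "full_row_rank P \<longleftrightarrow> indep_rows q (rows P)"
proof -
  have F: "map_mat to_fract P \<in> carrier_mat r q" using P by simp
  have "full_row_rank P \<longleftrightarrow>
      (\<forall>b\<in>carrier_vec r. \<exists>x\<in>carrier_vec q. map_mat to_fract P *\<^sub>v x = b)"
    unfolding full_row_rank_def using mat_rank_eq_dim_row_iff[of "map_mat to_fract P"] P by simp
  also have "\<dots> \<longleftrightarrow> indep_rows q (rows P)"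
    unfolding surj_iff_left_kernel_trivial[OF F] indep_rows_iff_fract using P by (simp add: atLeast0LessThan)
  finally show ?thesis .
qed

text \<open>A polynomial basis of the row space is independent and spans the r independent rows, so
  it has exactly r members, and only lists of that length have to be compared.\<close>

lemma minimal_basisI:
  fixes P :: "'a::field poly mat"
  assumes P: "P \<in> carrier_mat r q" and rq: "r < q" and ind: "indep_rows q (rows P)"
    and min: "\<And>ws. set ws \<subseteq> carrier_vec q \<Longrightarrow> length ws = r \<Longrightarrow> indep_rows q ws \<Longrightarrow>
      (\<And>w. w \<in> set ws \<Longrightarrow> in_row_span q (rows P) w) \<Longrightarrow>
      sum_list (map vec_degree (rows P)) \<le> sum_list (map vec_degree ws)"
  shows "minimal_basis P"
proof -
  have rows: "set (rows P) \<subseteq> carrier_vec q" using rows_carrier[of P] P by auto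
  have "sum_list (map vec_degree (rows P)) \<le> sum_list (map vec_degree ws)"
    if ws: "set ws \<subseteq> carrier_vec q" "indep_rows q ws" and eq: "fract_span q ws = fract_span q (rows P)" for ws
  proof (rule min)
    show span: "in_row_span q (rows P) w" if "w \<in> set ws" for w
      using in_row_span_if_fract_span_eq[OF ws(1) _ that] eq by simp
    have "in_row_span q ws v" if "v \<in> set (rows P)" for v
      using in_row_span_if_fract_span_eq[OF rows _ that] eq by simp
    then show "length ws = r"
      using length_indep_rows_le[OF ws(2) span] length_indep_rows_le[OF ind, of ws] P by simp
  qed (use ws in auto)
  then show ?thesis
    unfolding minimal_basis_def minimal_basis_of_def polynomial_basis_iff
    using P rq rows ind row_space_eq_fract_span[OF P] by simp
qed

text \<open>r independent vectors in the span of r rows already span it: a row outside their span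
  could be appended, giving r + 1 independent vectors. So ws is one of the bases in the definition
  of minimality.\<close>

lemma minimal_basisD:
  fixes P :: "'a::field poly mat"
  assumes min: "minimal_basis P" and P: "P \<in> carrier_mat r q"
    and ws: "set ws \<subseteq> carrier_vec q" "length ws = r" "indep_rows q ws"
    and span: "\<And>w. w \<in> set ws \<Longrightarrow> in_row_span q (rows P) w"
  shows "sum_list (map vec_degree (rows P)) \<le> sum_list (map vec_degree ws)"
proof -
  have rows: "set (rows P) \<subseteq> carrier_vec q" using rows_carrier[of P] P by auto
  have "in_row_span q ws v" if v: "v \<in> set (rows P)" for v
  proof (rule ccontr)
    assume "\<not> ?thesis"
    from indep_rows_snoc[OF ws(3) this] have "length (ws @ [v]) \<le> length (rows P)"
      by (rule length_indep_rows_le) (use span v in_row_span_member in auto)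
    then show False using ws(2) P by simp
  qed
  then have "fract_span q ws = fract_span q (rows P)"
    using fract_span_mono[of ws q "rows P"] fract_span_mono[of "rows P" q ws] span by blast
  then show ?thesis
    using min P ws unfolding minimal_basis_def minimal_basis_of_def polynomial_basis_iff
    by (simp add: row_space_eq_fract_span[OF P])
qed

section \<open>Polynomial vectors and degree counts\<close>

text \<open>For every k this leaves exactly k free coefficients, and for \<open>k = 0\<close> only
  the zero polynomial; \<open>degree p < k\<close> would fail at \<open>k = 0\<close> because
  \<open>degree 0 = 0\<close>.\<close>

definition deg_lt :: "nat \<Rightarrow> 'a::zero poly \<Rightarrow> bool" where
  "deg_lt k p \<longleftrightarrow> (\<forall>s\<ge>k. coeff p s = 0)"

lemma deg_lt_0 [simp]: "deg_lt k 0" by (simp add: deg_lt_def)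

lemma deg_lt_zero_iff: "deg_lt 0 p \<longleftrightarrow> p = 0" by (auto simp: deg_lt_def poly_eq_iff)

lemma deg_lt_mono: "deg_lt k p \<Longrightarrow> k \<le> l \<Longrightarrow> deg_lt l p" by (simp add: deg_lt_def)

lemma deg_lt_add: "deg_lt k p \<Longrightarrow> deg_lt k q \<Longrightarrow> deg_lt k (p + q)" by (simp add: deg_lt_def)

lemma deg_lt_sum: "(\<And>x. x \<in> A \<Longrightarrow> deg_lt k (f x)) \<Longrightarrow> deg_lt k (sum f A)"
  by (simp add: deg_lt_def coeff_sum)

lemma deg_lt_smult: "deg_lt k p \<Longrightarrow> deg_lt k (smult a p)" by (simp add: deg_lt_def)

lemma deg_lt_monom: "s < k \<Longrightarrow> deg_lt k (monom a s)" by (simp add: deg_lt_def)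

lemma deg_lt_degree: "degree p < k \<Longrightarrow> deg_lt k p"
  by (simp add: deg_lt_def coeff_eq_0)

lemma degree_le_if_deg_lt: "deg_lt (Suc k) p \<Longrightarrow> degree p \<le> k"
  by (auto simp: deg_lt_def intro!: degree_le)

lemma deg_lt_mult:
  assumes "deg_lt k p" "degree q \<le> d"
  shows "deg_lt (k + d) (p * q)"
  unfolding deg_lt_def
proof (intro allI impI)
  fix s assume s: "k + d \<le> s"
  have "coeff p i * coeff q (s - i) = 0" if "i \<le> s" for i
    using assms s that by (cases "k \<le> i") (auto simp: deg_lt_def coeff_eq_0)
  then show "coeff (p * q) s = 0" by (simp add: coeff_mult)
qed

lemma coeff_sum_monom: "coeff (\<Sum>s<K. monom (a s) s) t = (if t < K then a t else 0)"
  by (simp add: coeff_sum)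

lemma sum_smult_eq_0_iff:
  assumes "\<And>j. j \<in> J \<Longrightarrow> deg_lt K (f j)"
  shows "(\<Sum>j\<in>J. smult (u j) (f j)) = 0 \<longleftrightarrow> (\<forall>s<K. (\<Sum>j\<in>J. coeff (f j) s * u j) = 0)"
proof -
  have "(\<Sum>j\<in>J. coeff (f j) s * u j) = 0" if "\<not> s < K" for s
    using assms that by (intro sum.neutral) (simp add: deg_lt_def)
  then show ?thesis by (auto simp: poly_eq_iff coeff_sum mult.commute)
qed

lemma poly_family_dependent:
  fixes f :: "'j \<Rightarrow> 'i \<Rightarrow> 'a::idom poly"
  assumes "finite I" "finite J" and deg: "\<And>j i. j \<in> J \<Longrightarrow> i \<in> I \<Longrightarrow> deg_lt (K i) (f j i)"
    and "(\<Sum>i\<in>I. K i) < card J"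
  shows "\<exists>u. (\<exists>j\<in>J. u j \<noteq> 0) \<and> (\<forall>i\<in>I. (\<Sum>j\<in>J. smult (u j) (f j i)) = 0)"
proof -
  let ?I = "SIGMA i:I. {..<K i}" and ?A = "\<lambda>p j. coeff (f j (fst p)) (snd p)"
  have "finite ?I" "card ?I < card J" using assms by simp_all
  then obtain u where u: "\<exists>j\<in>J. u j \<noteq> 0" and rel: "\<forall>p\<in>?I. (\<Sum>j\<in>J. ?A p j * u j) = 0"
    using homogeneous_system_nontrivial_solution[of ?I J ?A] assms(2) by blast
  have "(\<Sum>j\<in>J. smult (u j) (f j i)) = 0" if "i \<in> I" for i
    using rel that deg by (subst sum_smult_eq_0_iff[of _ "K i"]) auto
  with u show ?thesis by blast
qed

section \<open>Multiplication by M on polynomial vectors of bounded degree\<close>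

definition mult_poly_vec :: "'a::comm_ring_1 poly mat \<Rightarrow> (nat \<Rightarrow> 'a poly) \<Rightarrow> nat \<Rightarrow> 'a poly" where
  "mult_poly_vec M x i = (\<Sum>c<dim_col M. M $$ (i, c) * x c)"

text \<open>Full row rank of T_k(M) by \<open>mat_rank_trimmed_sylvester_surj\<close>, phrased with
  polynomials so that multiplication by the variable is available as an operation.\<close>

definition sylvester_surj :: "nat list \<Rightarrow> nat \<Rightarrow> 'a::comm_ring_1 poly mat \<Rightarrow> bool" where
  "sylvester_surj ds k M \<longleftrightarrow> (\<forall>y. (\<forall>i<dim_row M. deg_lt (k + ds ! i) (y i)) \<longrightarrow>
     (\<exists>x. (\<forall>c<dim_col M. deg_lt k (x c)) \<and> (\<forall>i<dim_row M. mult_poly_vec M x i = y i)))"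

definition sylvester_inj :: "nat \<Rightarrow> 'a::comm_ring_1 poly mat \<Rightarrow> bool" where
  "sylvester_inj k M \<longleftrightarrow> (\<forall>x. (\<forall>c<dim_col M. deg_lt k (x c)) \<longrightarrow>
     (\<forall>i<dim_row M. mult_poly_vec M x i = 0) \<longrightarrow> (\<forall>c<dim_col M. x c = 0))"

lemma mult_poly_vec_sum:
  "mult_poly_vec M (\<lambda>c. \<Sum>l\<in>A. f l c) i = (\<Sum>l\<in>A. mult_poly_vec M (f l) i)"
  unfolding mult_poly_vec_def sum_distrib_left by (rule sum.swap)

lemma mult_poly_vec_add:
  "mult_poly_vec M (\<lambda>c. x c + y c) i = mult_poly_vec M x i + mult_poly_vec M y i"
  by (simp add: mult_poly_vec_def algebra_simps sum.distrib)

lemma mult_poly_vec_mult: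
  "mult_poly_vec M (\<lambda>c. p * x c) i = p * mult_poly_vec M x i"
  by (simp add: mult_poly_vec_def sum_distrib_left mult_ac)

lemma mult_poly_vec_smult:
  "mult_poly_vec M (\<lambda>c. smult a (x c)) i = smult a (mult_poly_vec M x i)"
  using mult_poly_vec_mult[of M "[:a:]" x i] by simp

lemma mult_poly_vec_cong:
  "(\<And>c. c < dim_col M \<Longrightarrow> x c = y c) \<Longrightarrow> mult_poly_vec M x i = mult_poly_vec M y i"
  by (simp add: mult_poly_vec_def)

lemma sylvester_inj_mono: "sylvester_inj k M \<Longrightarrow> l \<le> k \<Longrightarrow> sylvester_inj l M"
  unfolding sylvester_inj_def using deg_lt_mono by blast

lemma sylvester_inj_0: "sylvester_inj 0 M"
  by (simp add: sylvester_inj_def deg_lt_zero_iff)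

lemma sylvester_surjD:
  assumes "sylvester_surj ds k M" "M \<in> carrier_mat m q" "\<And>i. i < m \<Longrightarrow> deg_lt (k + ds ! i) (y i)"
  shows "\<exists>x. (\<forall>c<q. deg_lt k (x c)) \<and> (\<forall>i<m. mult_poly_vec M x i = y i)"
  using assms(1)[unfolded sylvester_surj_def, rule_format, of y] assms(2,3) by auto

text \<open>Split y into its constant term and the variable times the rest; both parts have
  preimages at k, and shifting the second one raises the degree by one.\<close>

lemma sylvester_surj_Suc:
  fixes M :: "'a::comm_ring_1 poly mat"
  assumes surj: "sylvester_surj ds k M" and k: "1 \<le> k"
  shows "sylvester_surj ds (Suc k) M"
  unfolding sylvester_surj_def
proof (intro allI impI)
  fix y :: "nat \<Rightarrow> 'a poly" assume y: "\<forall>i<dim_row M. deg_lt (Suc k + ds ! i) (y i)"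
  have "\<forall>i. \<exists>z. y i = pCons (coeff (y i) 0) z" by (metis coeff_pCons_0 pCons_cases)
  then obtain z where z: "\<And>i. y i = pCons (coeff (y i) 0) (z i)" by metis
  have "deg_lt (k + ds ! i) (z i)" if "i < dim_row M" for i
  proof -
    have "coeff (z i) s = coeff (y i) (Suc s)" for s by (subst z) simp
    then show ?thesis using y that by (simp add: deg_lt_def)
  qed
  then obtain x1 where x1: "\<And>c. c < dim_col M \<Longrightarrow> deg_lt k (x1 c)"
    "\<And>i. i < dim_row M \<Longrightarrow> mult_poly_vec M x1 i = z i"
    using surj unfolding sylvester_surj_def by metis
  \<comment> \<open>\<open>1 <= k\<close> puts constants into the target even for rows with
    \<open>ds ! i = 0\<close>.\<close>
  have "deg_lt (k + ds ! i) [:coeff (y i) 0:]" for i using k by (intro deg_lt_degree) simp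
  then obtain x0 where x0: "\<And>c. c < dim_col M \<Longrightarrow> deg_lt k (x0 c)"
    "\<And>i. i < dim_row M \<Longrightarrow> mult_poly_vec M x0 i = [:coeff (y i) 0:]"
    using surj[unfolded sylvester_surj_def, rule_format, of "\<lambda>i. [:coeff (y i) 0:]"] by auto
  let ?x = "\<lambda>c. x0 c + [:0, 1:] * x1 c"
  have "mult_poly_vec M ?x i = y i" if "i < dim_row M" for i
  proof -
    have "mult_poly_vec M ?x i = [:coeff (y i) 0:] + [:0, 1:] * z i"
      unfolding mult_poly_vec_add mult_poly_vec_mult using x0(2) x1(2) that by simp
    also have "\<dots> = pCons (coeff (y i) 0) (z i)" by simp
    finally show ?thesis using z[of i] by simp
  qed
  moreover have "deg_lt (Suc k) (?x c)" if "c < dim_col M" for c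
  proof (rule deg_lt_add)
    show "deg_lt (Suc k) (x0 c)" using x0(1)[OF that] by (rule deg_lt_mono) simp
    show "deg_lt (Suc k) ([:0, 1:] * x1 c)"
      using deg_lt_mult[OF x1(1)[OF that], of "[:0, 1:]" 1] by (simp add: mult.commute)
  qed
  ultimately show "\<exists>x. (\<forall>c<dim_col M. deg_lt (Suc k) (x c)) \<and> (\<forall>i<dim_row M. mult_poly_vec M x i = y i)"
    by (intro exI[of _ ?x]) simp
qed

lemma sylvester_surj_mono:
  assumes "sylvester_surj ds k M" "1 \<le> k" "k \<le> l"
  shows "sylvester_surj ds l M"
  using assms(3)
proof (induction l rule: dec_induct)
  case base
  show ?case by fact
next
  case (step l)
  show ?case using step assms(2) by (intro sylvester_surj_Suc) auto
qed

section \<open>Lower bounds for degree sums of bases of the kernel and of the row space\<close>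

lemma degree_le_vec_degree: "c < dim_vec v \<Longrightarrow> degree (v $ c) \<le> vec_degree v"
  unfolding vec_degree_def by (intro Max_ge) auto

lemma vec_degree_le:
  "0 < dim_vec v \<Longrightarrow> (\<And>c. c < dim_vec v \<Longrightarrow> degree (v $ c) \<le> d) \<Longrightarrow> vec_degree v \<le> d"
  unfolding vec_degree_def by (intro Max.boundedI) auto

lemma sum_list_map_nth: "sum_list (map f xs) = (\<Sum>l<length xs. f (xs ! l))"
  by (simp add: sum_list_sum_nth atLeast0LessThan)

lemma sum_smult_monom_mult:
  fixes p :: "'a::comm_ring_1 poly"
  shows "(\<Sum>s\<in>S. smult (a s) (monom 1 s * p)) = (\<Sum>s\<in>S. monom (a s) s) * p"
  by (simp add: sum_distrib_right mult_smult_left[symmetric] smult_monom)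

text \<open>
  Compare two independent families inside the space of polynomial vectors of degree less than
  \<open>k\<close>: the multiples of the \<open>ws\<close> and preimages of a basis of the target of \<open>M\<close>.
\<close>
lemma kernel_degree_sum_ge:
  fixes M :: "'a::field poly mat"
  assumes M: "M \<in> carrier_mat m (m + n)"
    and surj: "sylvester_surj ds K M" "1 \<le> K"
    and ws: "set ws \<subseteq> carrier_vec (m + n)" "length ws = n" "indep_rows (m + n) ws"
    and ker: "\<And>w i. w \<in> set ws \<Longrightarrow> i < m \<Longrightarrow> mult_poly_vec M (($) w) i = 0"
  shows "(\<Sum>i<m. ds ! i) \<le> sum_list (map vec_degree ws)"
proof (rule ccontr)
  assume "\<not> ?thesis"
  define e where "e l = vec_degree (ws ! l)" for l
  from \<open>\<not> ?thesis\<close> have less: "(\<Sum>l<n. e l) < (\<Sum>i<m. ds ! i)"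
    by (simp add: sum_list_map_nth ws(2) e_def)
  \<comment> \<open>The summand K gives surjectivity; the sum of the \<open>e l\<close> ensures
    \<open>e l \<le> k\<close>, so that the truncated differences \<open>k - e l\<close> are
    exact.\<close>
  define k where "k = K + (\<Sum>l<n. e l)"
  have ke: "e l \<le> k" if "l < n" for l
  proof -
    have "e l \<le> (\<Sum>l<n. e l)" using that by (intro member_le_sum) auto
    then show ?thesis by (simp add: k_def)
  qed
  have surj_k: "sylvester_surj ds k M" using surj by (rule sylvester_surj_mono) (simp add: k_def)
  have "\<exists>x. (\<forall>c<m + n. deg_lt k (x c)) \<and>
      (\<forall>i'<m. mult_poly_vec M x i' = (if i' = i then monom 1 s else 0))" if "s < k + ds ! i" for i s
    using that by (intro sylvester_surjD[OF surj_k M]) (auto intro: deg_lt_monom)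
  then have "\<forall>i s. \<exists>x. s < k + ds ! i \<longrightarrow> (\<forall>c<m + n. deg_lt k (x c)) \<and>
      (\<forall>i'<m. mult_poly_vec M x i' = (if i' = i then monom 1 s else 0))" by blast
  from this[unfolded choice_iff] obtain X
    where X': "\<forall>i s. s < k + ds ! i \<longrightarrow> (\<forall>c<m + n. deg_lt k (X i s c)) \<and>
        (\<forall>i'<m. mult_poly_vec M (X i s) i' = (if i' = i then monom 1 s else 0))" ..
  have X: "s < k + ds ! i \<Longrightarrow> c < m + n \<Longrightarrow> deg_lt k (X i s c)"
    "s < k + ds ! i \<Longrightarrow> i' < m \<Longrightarrow> mult_poly_vec M (X i s) i' = (if i' = i then monom 1 s else 0)"
    for i s c i'
    using X' by blast+
  \<comment> \<open>\<open>J1\<close> indexes the multiples of the ws by powers of the variable,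
    \<open>J2\<close> the monomial basis of the target. Their number is (m + n) k plus the sum of
    the d_i minus the sum of the \<open>e l\<close>, which exceeds the dimension (m + n) k.\<close>
  define J1 where "J1 = (SIGMA l:{..<n}. {..<k - e l})"
  define J2 where "J2 = (SIGMA i:{..<m}. {..<k + ds ! i})"
  let ?J = "Inl ` J1 \<union> Inr ` J2"
  define f where "f j c = (case j of Inl (l, s) \<Rightarrow> monom 1 s * ws ! l $ c | Inr (i, s) \<Rightarrow> X i s c)" for j c
  have fin: "finite J1" "finite J2" by (auto simp: J1_def J2_def)
  have "deg_lt k (f j c)" if "j \<in> ?J" "c < m + n" for j c
    using that
  proof (elim UnE imageE)
    fix ls assume j: "j = Inl ls" "ls \<in> J1"
    obtain l s where ls: "ls = (l, s)" by (cases ls)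
    have "ws ! l \<in> carrier_vec (m + n)" using ws j ls by (auto simp: J1_def)
    then have "degree (ws ! l $ c) \<le> e l"
      using degree_le_vec_degree[of c "ws ! l"] that(2) by (auto simp: e_def)
    then have "deg_lt (k - e l + e l) (monom 1 s * ws ! l $ c)"
      using j ls by (intro deg_lt_mult deg_lt_monom) (auto simp: J1_def)
    then show ?thesis using ke[of l] j ls by (simp add: f_def J1_def)
  qed (use X(1) that(2) in \<open>auto simp: f_def J2_def\<close>)
  moreover have "(\<Sum>c<m + n. k) < card ?J"
  proof -
    have "card ?J = card J1 + card J2"
      using fin by (subst card_Un_disjoint) (auto simp: card_image)
    also have "\<dots> = (\<Sum>l<n. k - e l) + (\<Sum>i<m. k + ds ! i)" by (simp add: J1_def J2_def)
    also have "(\<Sum>l<n. k - e l) = n * k - (\<Sum>l<n. e l)"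
      using ke sum_subtractf_nat[of "{..<n}" e "\<lambda>_. k"] by simp
    also have "(\<Sum>i<m. k + ds ! i) = m * k + (\<Sum>i<m. ds ! i)" by (simp add: sum.distrib)
    finally have "card ?J = n * k - (\<Sum>l<n. e l) + (m * k + (\<Sum>i<m. ds ! i))" .
    moreover have "(\<Sum>l<n. e l) \<le> n * k"
      using sum_mono[of "{..<n}" e "\<lambda>_. k"] ke by simp
    ultimately show ?thesis using less by (simp add: algebra_simps)
  qed
  ultimately have "\<exists>u. (\<exists>j\<in>?J. u j \<noteq> 0) \<and> (\<forall>c\<in>{..<m + n}. (\<Sum>j\<in>?J. smult (u j) (f j c)) = 0)"
    using fin by (intro poly_family_dependent[of _ _ "\<lambda>_. k"]) auto
  then obtain u where u: "\<exists>j\<in>?J. u j \<noteq> 0"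
    and rel: "\<forall>c\<in>{..<m + n}. (\<Sum>j\<in>?J. smult (u j) (f j c)) = 0" by blast
  \<comment> \<open>Collected by l and by i, the scalars u become polynomials: the p-combination of
    the ws plus x2 is 0, and M maps x2 to v. Applying M kills the first part, so v and then x2
    vanish, and independence of the ws gives p = 0.\<close>
  define p where "p l = (\<Sum>s<k - e l. monom (u (Inl (l, s))) s)" for l
  define v where "v i = (\<Sum>s<k + ds ! i. monom (u (Inr (i, s))) s)" for i
  define x2 where "x2 c = (\<Sum>(i, s)\<in>J2. smult (u (Inr (i, s))) (X i s c))" for c
  have rel': "(\<Sum>l<n. p l * ws ! l $ c) + x2 c = 0" if c: "c < m + n" for c
  proof -
    have "(\<Sum>j\<in>?J. smult (u j) (f j c))
        = (\<Sum>(l, s)\<in>J1. smult (u (Inl (l, s))) (monom 1 s * ws ! l $ c)) + x2 c"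
      using fin by (subst sum.union_disjoint) (auto simp: sum.reindex f_def x2_def o_def case_prod_unfold)
    also have "(\<Sum>(l, s)\<in>J1. smult (u (Inl (l, s))) (monom 1 s * ws ! l $ c)) = (\<Sum>l<n. p l * ws ! l $ c)"
      unfolding J1_def p_def sum_smult_monom_mult[symmetric] by (rule sum.Sigma[symmetric]) auto
    finally show ?thesis using rel c by simp
  qed
  have "v i = 0" if i: "i < m" for i
  proof -
    have "0 = mult_poly_vec M (\<lambda>c. (\<Sum>l<n. p l * ws ! l $ c) + x2 c) i"
      using rel' M by (simp add: mult_poly_vec_def)
    also have "\<dots> = (\<Sum>l<n. p l * mult_poly_vec M (($) (ws ! l)) i) + mult_poly_vec M x2 i"
      by (simp only: mult_poly_vec_add mult_poly_vec_sum mult_poly_vec_mult)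
    also have "(\<Sum>l<n. p l * mult_poly_vec M (($) (ws ! l)) i) = 0"
      using ker i ws(2) by (intro sum.neutral) auto
    also have "mult_poly_vec M x2 i
        = (\<Sum>(i', s)\<in>J2. smult (u (Inr (i', s))) (mult_poly_vec M (X i' s) i))"
      unfolding x2_def case_prod_unfold by (simp only: mult_poly_vec_sum mult_poly_vec_smult)
    also have "\<dots> = (\<Sum>i'<m. \<Sum>s<k + ds ! i'. smult (u (Inr (i', s))) (if i = i' then monom 1 s else 0))"
      unfolding J2_def using X(2) i by (subst sum.Sigma) (auto intro!: sum.cong)
    also have "\<dots> = (\<Sum>i'<m. if i' = i then v i else 0)"
      by (intro sum.cong) (auto simp: v_def smult_monom)
    finally show ?thesis using i by simp
  qed
  then have u2: "u (Inr (i, s)) = 0" if "(i, s) \<in> J2" for i s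
    using that coeff_sum_monom[of "\<lambda>s. u (Inr (i, s))" "k + ds ! i" s] by (auto simp: J2_def v_def)
  then have "x2 c = 0" for c unfolding x2_def by (intro sum.neutral) auto
  then have "p l = 0" if "l < n" for l
    using rel' indep_rowsD[OF ws(3), of p l] that ws(2) by simp
  then have u1: "u (Inl (l, s)) = 0" if "(l, s) \<in> J1" for l s
    using that coeff_sum_monom[of "\<lambda>s. u (Inl (l, s))" "k - e l" s] by (auto simp: J1_def p_def)
  show False using u u1 u2 by auto
qed

text \<open>The predictable degree property: independent leading coefficient vectors cannot cancel,
  so no product \<open>r l * vs ! l\<close> reaches beyond the sum. Here \<open>d l\<close> bounds
  the degree of row l, and k strictly bounds that of the sum.\<close>

lemma row_reduced_coeff_eq_0:
  fixes vs :: "'a::idom poly vec list"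
  assumes deg: "\<And>l c. l < length vs \<Longrightarrow> c < q \<Longrightarrow> degree (vs ! l $ c) \<le> d l"
    and lead: "\<And>a l. (\<And>c. c < q \<Longrightarrow> (\<Sum>l<length vs. a l * coeff (vs ! l $ c) (d l)) = 0) \<Longrightarrow>
      l < length vs \<Longrightarrow> a l = 0"
    and small: "\<And>c. c < q \<Longrightarrow> deg_lt k (\<Sum>l<length vs. r l * vs ! l $ c)"
    and l: "l < length vs" and k: "k \<le> s + d l"
  shows "coeff (r l) s = 0"
proof (rule ccontr)
  assume nz: "coeff (r l) s \<noteq> 0"
  define S where "S = {(l, s). l < length vs \<and> coeff (r l) s \<noteq> 0 \<and> k \<le> s + d l}"
  \<comment> \<open>The largest total degree, at or above k, reached by a nonzero coefficient of
    some \<open>r l\<close>. In degree E the sum involves only the leading coefficients of the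
    vs.\<close>
  define E where "E = Max ((\<lambda>(l, s). s + d l) ` S)"
  have "S \<subseteq> (SIGMA l:{..<length vs}. {..degree (r l)})" by (auto simp: S_def le_degree)
  then have fin: "finite S" by (rule finite_subset) auto
  have S: "(l, s) \<in> S" using nz l k by (simp add: S_def)
  then have "E \<in> (\<lambda>(l, s). s + d l) ` S" unfolding E_def using fin by (intro Max_in) auto
  then obtain l' s' where l's': "l' < length vs" "coeff (r l') s' \<noteq> 0" "k \<le> s' + d l'" "E = s' + d l'"
    by (auto simp: S_def)
  have max: "j + d i \<le> E" if "i < length vs" "coeff (r i) j \<noteq> 0" for i j
  proof (cases "k \<le> j + d i")
    case True
    then have "(i, j) \<in> S" using that by (simp add: S_def)
    then show ?thesis unfolding E_def using fin by (force intro!: Max_ge)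
  next
    case False
    then show ?thesis using l's' by simp
  qed
  \<comment> \<open>The case distinction avoids truncated subtraction: for \<open>E < d i\<close>
    the maximality of E forces \<open>r i = 0\<close>.\<close>
  define a where "a i = (if d i \<le> E then coeff (r i) (E - d i) else 0)" for i
  have top: "coeff (r i * v) E = a i * coeff v (d i)" if i: "i < length vs" and v: "degree v \<le> d i" for i v
  proof -
    have "coeff (r i) j * coeff v (E - j) = (if j = E - d i then a i * coeff v (d i) else 0)"
      if "j \<le> E" for j
      using max[OF i, of j] v that coeff_eq_0[of v "E - j"]
      by (cases "coeff (r i) j = 0") (auto simp: a_def)
    then have "coeff (r i * v) E = (\<Sum>j\<le>E. if j = E - d i then a i * coeff v (d i) else 0)"
      unfolding coeff_mult by (intro sum.cong) auto
    then show ?thesis by simp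
  qed
  have "(\<Sum>l<length vs. a l * coeff (vs ! l $ c) (d l)) = 0" if c: "c < q" for c
  proof -
    have "(\<Sum>l<length vs. a l * coeff (vs ! l $ c) (d l)) = coeff (\<Sum>l<length vs. r l * vs ! l $ c) E"
      unfolding coeff_sum using top deg c by (intro sum.cong) auto
    also have "\<dots> = 0" using small[OF c] l's' by (simp add: deg_lt_def)
    finally show ?thesis .
  qed
  from lead[OF this l's'(1)] l's' show False by (simp add: a_def)
qed

lemma indep_rows_if_row_reduced:
  fixes vs :: "'a::idom poly vec list"
  assumes "\<And>l c. l < length vs \<Longrightarrow> c < q \<Longrightarrow> degree (vs ! l $ c) \<le> d l"
    and "\<And>a l. (\<And>c. c < q \<Longrightarrow> (\<Sum>l<length vs. a l * coeff (vs ! l $ c) (d l)) = 0) \<Longrightarrow>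
      l < length vs \<Longrightarrow> a l = 0"
  shows "indep_rows q vs"
  unfolding indep_rows_def
proof (intro allI impI)
  fix r l assume "\<forall>i<q. (\<Sum>l<length vs. r l * vs ! l $ i) = 0" "l < length vs"
  then have "coeff (r l) s = 0" for s
  proof (intro row_reduced_coeff_eq_0[of vs q d 0 r])
    show "a l = 0" if "\<And>c. c < q \<Longrightarrow> (\<Sum>l<length vs. a l * coeff (vs ! l $ c) (d l)) = 0"
      "l < length vs" for a l
      using assms(2)[of a l] that by blast
  qed (use assms(1) in simp_all)
  then show "r l = 0" by (simp add: poly_eq_iff)
qed

text \<open>A relation a combines the coefficients of degree k - 1 + d_i of the rows of any image M
  x to 0, but some x has as image a single monomial of that degree in row l.\<close>

lemma sylvester_surj_leading_coeffs:
  fixes M :: "'a::field poly mat"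
  assumes M: "M \<in> carrier_mat m q" and deg: "\<And>i c. i < m \<Longrightarrow> c < q \<Longrightarrow> degree (M $$ (i, c)) \<le> ds ! i"
    and surj: "sylvester_surj ds k M" "1 \<le> k"
    and a: "\<And>c. c < q \<Longrightarrow> (\<Sum>i<m. a i * coeff (M $$ (i, c)) (ds ! i)) = 0" and l: "l < m"
  shows "a l = 0"
proof -
  obtain x where x: "\<And>c. c < q \<Longrightarrow> deg_lt k (x c)"
    and Mx: "\<And>i. i < m \<Longrightarrow> mult_poly_vec M x i = (if i = l then monom 1 (k - 1 + ds ! l) else 0)"
  proof -
    have "deg_lt (k + ds ! i) (if i = l then monom 1 (k - 1 + ds ! l) else 0 :: 'a poly)" for i
      using surj(2) by (auto intro: deg_lt_monom)
    then show ?thesis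
      using sylvester_surjD[OF surj(1) M, of "\<lambda>i. if i = l then monom 1 (k - 1 + ds ! l) else 0"] that
      by blast
  qed
  have top: "coeff (p * y) (k - 1 + e) = coeff p e * coeff y (k - 1)"
    if "degree p \<le> e" "deg_lt k y" for p y :: "'a poly" and e
  proof -
    have "degree y \<le> k - 1" using that(2) surj(2) by (intro degree_le_if_deg_lt) simp
    then show ?thesis using coeff_mult_degree_sum[of p y] that(1)
    proof -
      have "coeff p i * coeff y (k - 1 + e - i) = (if i = e then coeff p e * coeff y (k - 1) else 0)" for i
        using that(1) \<open>degree y \<le> k - 1\<close> coeff_eq_0[of p i] coeff_eq_0[of y "k - 1 + e - i"]
        by (cases "i \<le> e") auto
      then show ?thesis by (simp add: coeff_mult)
    qed
  qed
  have "0 = (\<Sum>c<q. (\<Sum>i<m. a i * coeff (M $$ (i, c)) (ds ! i)) * coeff (x c) (k - 1))" using a by simp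
  also have "\<dots> = (\<Sum>i<m. a i * (\<Sum>c<q. coeff (M $$ (i, c)) (ds ! i) * coeff (x c) (k - 1)))"
    unfolding sum_distrib_left sum_distrib_right by (subst sum.swap) (simp add: mult_ac)
  also have "\<dots> = (\<Sum>i<m. a i * coeff (mult_poly_vec M x i) (k - 1 + ds ! i))"
  proof -
    have "coeff (mult_poly_vec M x i) (k - 1 + ds ! i) = (\<Sum>c<q. coeff (M $$ (i, c)) (ds ! i) * coeff (x c) (k - 1))"
      if i: "i < m" for i
      unfolding mult_poly_vec_def coeff_sum using M x deg[OF i] by (intro sum.cong top) auto
    then show ?thesis by simp
  qed
  also have "\<dots> = (\<Sum>i<m. if i = l then a l else 0)"
    by (intro sum.cong) (auto simp: Mx)
  finally show ?thesis using l by simp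
qed

text \<open>Preimages of the constant unit vectors form a polynomial right inverse of M; it makes
  coordinates with respect to the rows of M polynomial.\<close>

lemma sylvester_surj_right_inverse:
  fixes M :: "'a::field poly mat"
  assumes M: "M \<in> carrier_mat m q" and surj: "sylvester_surj ds k M" "1 \<le> k"
  obtains Y where "\<And>i j. i < m \<Longrightarrow> mult_poly_vec M (Y j) i = (if i = j then 1 else 0)"
proof -
  have "\<exists>x. (\<forall>c<q. deg_lt k (x c)) \<and> (\<forall>i<m. mult_poly_vec M x i = (if i = j then 1 else 0))" for j
    using surj(2) by (intro sylvester_surjD[OF surj(1) M]) (auto intro: deg_lt_degree)
  then have "\<forall>j. \<exists>x. \<forall>i<m. mult_poly_vec M x i = (if i = j then 1 else 0)" by blast
  from this[unfolded choice_iff] show ?thesis using that by blast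
qed

text \<open>The kernel has rank at most n: n + 1 independent kernel vectors and the m columns of a
  right inverse would be m + n + 1 independent vectors of length m + n.\<close>

lemma in_row_span_if_in_kernel:
  fixes M :: "'a::field poly mat"
  assumes M: "M \<in> carrier_mat m (m + n)" and surj: "sylvester_surj ds k M" "1 \<le> k"
    and vs: "length vs = n" "indep_rows (m + n) vs"
    and ker: "\<And>v i. v \<in> set vs \<Longrightarrow> i < m \<Longrightarrow> mult_poly_vec M (($) v) i = 0"
    and x: "\<And>i. i < m \<Longrightarrow> mult_poly_vec M (($) x) i = 0"
  shows "in_row_span (m + n) vs x"
proof (rule ccontr)
  assume "\<not> ?thesis"
  define ws where "ws = vs @ [x]"
  have ws: "indep_rows (m + n) ws" "length ws = Suc n"
    unfolding ws_def using indep_rows_snoc[OF vs(2) \<open>\<not> _\<close>] vs(1) by auto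
  have ker': "mult_poly_vec M (($) (ws ! l)) i = 0" if "l < Suc n" "i < m" for l i
    using that ker x vs(1) by (cases "l < n") (auto simp: ws_def nth_append)
  obtain Y where Y: "\<And>i j. i < m \<Longrightarrow> mult_poly_vec M (Y j) i = (if i = j then 1 else 0)"
    using sylvester_surj_right_inverse[OF M surj] by metis
  define J where "J = Inl ` {..<Suc n} \<union> Inr ` {..<m}"
  define A where "A c j = (case j of Inl l \<Rightarrow> ws ! l $ c | Inr i \<Rightarrow> Y i c)" for c and j :: "nat + nat"
  have "card {..<m + n} < card J"
    unfolding J_def by (subst card_Un_disjoint) (auto simp: card_image)
  moreover have "finite J" by (simp add: J_def)
  ultimately have "\<exists>u. (\<exists>j\<in>J. u j \<noteq> 0) \<and> (\<forall>c\<in>{..<m + n}. (\<Sum>j\<in>J. A c j * u j) = 0)"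
    by (intro homogeneous_system_nontrivial_solution) simp_all
  then obtain u where u: "\<exists>j\<in>J. u j \<noteq> 0" and rel: "\<forall>c\<in>{..<m + n}. (\<Sum>j\<in>J. A c j * u j) = 0"
    by blast
  have rel': "(\<Sum>l<Suc n. u (Inl l) * ws ! l $ c) + (\<Sum>i<m. u (Inr i) * Y i c) = 0" if "c < m + n" for c
  proof -
    have "(\<Sum>j\<in>J. A c j * u j) = (\<Sum>l<Suc n. u (Inl l) * ws ! l $ c) + (\<Sum>i<m. u (Inr i) * Y i c)"
      unfolding J_def by (subst sum.union_disjoint)
        (auto simp: sum.reindex A_def mult.commute simp del: sum.lessThan_Suc)
    then show ?thesis using rel that by simp
  qed
  have u2: "u (Inr i) = 0" if i: "i < m" for i
  proof -
    have "0 = mult_poly_vec M (\<lambda>c. (\<Sum>l<Suc n. u (Inl l) * ws ! l $ c) + (\<Sum>i<m. u (Inr i) * Y i c)) i"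
      using rel' M by (simp add: mult_poly_vec_def)
    also have "\<dots> = (\<Sum>l<Suc n. u (Inl l) * mult_poly_vec M (($) (ws ! l)) i)
        + (\<Sum>j<m. u (Inr j) * mult_poly_vec M (Y j) i)"
      by (simp only: mult_poly_vec_add mult_poly_vec_sum mult_poly_vec_mult)
    also have "(\<Sum>l<Suc n. u (Inl l) * mult_poly_vec M (($) (ws ! l)) i) = 0"
      using ker' i by (intro sum.neutral) auto
    also have "(\<Sum>j<m. u (Inr j) * mult_poly_vec M (Y j) i) = (\<Sum>j<m. if j = i then u (Inr i) else 0)"
      using Y[OF i] by (intro sum.cong) auto
    finally show ?thesis using i by simp
  qed
  have "u (Inl l) = 0" if "l < Suc n" for l
  proof (rule indep_rowsD[OF ws(1), of "\<lambda>l. u (Inl l)"])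
    show "(\<Sum>l<length ws. u (Inl l) * ws ! l $ c) = 0" if "c < m + n" for c
      using rel'[OF that] u2 ws(2) by simp
  qed (use that ws(2) in simp)
  then show False using u u2 by (auto simp: J_def)
qed

text \<open>The coordinates \<rho> of the ws with respect to the rows of M are polynomials with
  nonzero determinant, so some permutation p meets only nonzero entries. By the predictable degree
  property, \<open>\<rho> (p i) i \<noteq> 0\<close> forces d_i to be at most the degree of
  \<open>ws ! p i\<close>.\<close>

lemma row_span_degree_sum_ge:
  fixes M :: "'a::field poly mat"
  assumes M: "M \<in> carrier_mat m q" and deg: "\<And>i c. i < m \<Longrightarrow> c < q \<Longrightarrow> degree (M $$ (i, c)) \<le> ds ! i"
    and surj: "sylvester_surj ds K M" "1 \<le> K"
    and ws: "set ws \<subseteq> carrier_vec q" "length ws = m" "indep_rows q ws"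
    and span: "\<And>w. w \<in> set ws \<Longrightarrow> in_row_span q (rows M) w"
  shows "(\<Sum>i<m. ds ! i) \<le> sum_list (map vec_degree ws)"
proof -
  define e where "e l = vec_degree (ws ! l)" for l
  obtain Y where Y: "\<And>i j. i < m \<Longrightarrow> mult_poly_vec M (Y j) i = (if i = j then 1 else 0)"
    using sylvester_surj_right_inverse[OF M surj] by metis
  define \<rho> where "\<rho> l i = (\<Sum>c<q. ws ! l $ c * Y i c)" for l i
  have rows: "rows M ! i $ c = M $$ (i, c)" if "i < m" "c < q" for i c
    using that M by simp
  \<comment> \<open>Span membership gives coordinates only up to the factor g; the right inverse
    identifies them as \<open>g * \<rho> l i\<close>, and g cancels.\<close>
  have expand: "ws ! l $ c = (\<Sum>i<m. \<rho> l i * M $$ (i, c))" if l: "l < m" and c: "c < q" for l c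
  proof -
    obtain g r where g: "g \<noteq> 0" and r: "\<And>c. c < q \<Longrightarrow> g * ws ! l $ c = (\<Sum>i<m. r i * M $$ (i, c))"
      using span[of "ws ! l"] l ws(2) M rows unfolding in_row_span_def by auto
    have "g * \<rho> l i = r i" if i: "i < m" for i
    proof -
      have "g * \<rho> l i = (\<Sum>c<q. (\<Sum>j<m. r j * M $$ (j, c)) * Y i c)"
        unfolding \<rho>_def sum_distrib_left by (intro sum.cong) (auto simp: r mult.assoc[symmetric])
      also have "\<dots> = (\<Sum>j<m. r j * mult_poly_vec M (Y i) j)"
        unfolding mult_poly_vec_def sum_distrib_left sum_distrib_right using M
        by (subst sum.swap) (simp add: mult_ac)
      also have "\<dots> = (\<Sum>j<m. if j = i then r i else 0)" using Y by (intro sum.cong) auto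
      finally show ?thesis using i by simp
    qed
    then have "g * ws ! l $ c = g * (\<Sum>i<m. \<rho> l i * M $$ (i, c))"
      unfolding r[OF c] sum_distrib_left by (intro sum.cong) (auto simp: mult.assoc[symmetric])
    then show ?thesis using g by simp
  qed
  define R where "R = mat m m (\<lambda>(i, l). \<rho> l i)"
  have R: "R \<in> carrier_mat m m" by (simp add: R_def)
  have "det R \<noteq> 0"
  proof
    assume "det R = 0"
    then obtain v where v: "v \<in> carrier_vec m" "v \<noteq> 0\<^sub>v m" and Rv: "R *\<^sub>v v = 0\<^sub>v m"
      using det_0_iff_vec_prod_zero[OF R] by blast
    have rel: "(\<Sum>l<m. v $ l * \<rho> l i) = 0" if "i < m" for i
      using arg_cong[OF Rv, of "\<lambda>w. w $ i"] that v(1)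
      by (simp add: R_def scalar_prod_def atLeast0LessThan mult.commute)
    have "v $ l = 0" if "l < m" for l
    proof (rule indep_rowsD[OF ws(3), of "($) v"])
      show "(\<Sum>l<length ws. v $ l * ws ! l $ c) = 0" if c: "c < q" for c
      proof -
        have "(\<Sum>l<length ws. v $ l * ws ! l $ c) = (\<Sum>l<m. \<Sum>i<m. v $ l * (\<rho> l i * M $$ (i, c)))"
          unfolding ws(2) using expand c by (intro sum.cong) (auto simp: sum_distrib_left)
        also have "\<dots> = (\<Sum>i<m. (\<Sum>l<m. v $ l * \<rho> l i) * M $$ (i, c))"
          by (subst sum.swap) (simp add: sum_distrib_left mult_ac)
        finally show ?thesis using rel by simp
      qed
    qed (use that ws(2) in simp)
    then show False using v by (auto simp: vec_eq_iff)
  qed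
  then obtain p where p: "p permutes {0..<m}" and prod: "(\<Prod>i = 0..<m. R $$ (i, p i)) \<noteq> 0"
    unfolding det_def'[OF R] by (metis (mono_tags, lifting) mem_Collect_eq mult_zero_right sum.neutral)
  have "ds ! i \<le> e (p i)" if i: "i < m" for i
  proof -
    let ?l = "p i"
    have l: "?l < m" using permutes_in_image[OF p, of i] i by simp
    have "R $$ (i, ?l) \<noteq> 0" using prod i by (simp add: prod_zero_iff)
    then have "\<rho> ?l i \<noteq> 0" using i l by (simp add: R_def)
    then obtain s where s: "coeff (\<rho> ?l i) s \<noteq> 0" by (auto simp: poly_eq_iff)
    have "coeff (\<rho> ?l i) s = 0" if "Suc (e ?l) \<le> s + ds ! i"
    proof (rule row_reduced_coeff_eq_0[of "rows M" q "(!) ds" "Suc (e ?l)" "\<rho> ?l"])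
      show "a l = 0"
        if "\<And>c. c < q \<Longrightarrow> (\<Sum>i<length (rows M). a i * coeff (rows M ! i $ c) (ds ! i)) = 0"
          "l < length (rows M)" for a l
        using sylvester_surj_leading_coeffs[OF M deg surj, of a l] that M by simp
      show "deg_lt (Suc (e ?l)) (\<Sum>i<length (rows M). \<rho> ?l i * rows M ! i $ c)" if c: "c < q" for c
      proof -
        have "ws ! ?l \<in> carrier_vec q" using ws l by auto
        then have "degree (ws ! ?l $ c) \<le> e ?l"
          using degree_le_vec_degree[of c "ws ! ?l"] c by (auto simp: e_def)
        moreover have "(\<Sum>i<length (rows M). \<rho> ?l i * rows M ! i $ c) = ws ! ?l $ c"
          unfolding expand[OF l c] using M c by (intro sum.cong) auto
        ultimately show ?thesis by (simp add: deg_lt_degree)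
      qed
    qed (use deg M i that in simp_all)
    with s show ?thesis by fastforce
  qed
  then have "(\<Sum>i<m. ds ! i) \<le> (\<Sum>i<m. e (p i))" by (intro sum_mono) auto
  also have "\<dots> = (\<Sum>l<m. e l)"
    using sum.permute[of p "{..<m}" e] p by (simp add: atLeast0LessThan o_def)
  finally show ?thesis by (simp add: sum_list_map_nth ws(2) e_def)
qed

text \<open>A maximal independent P has at most as many members as there are scalar equations, so at
  least t indices lie outside; each of those carries a relation in which no other one of them
  occurs.\<close>

lemma poly_family_kernel:
  fixes f :: "'j \<Rightarrow> 'i \<Rightarrow> 'a::idom poly"
  assumes I: "finite I" and J: "finite J" and deg: "\<And>j i. j \<in> J \<Longrightarrow> i \<in> I \<Longrightarrow> deg_lt (K i) (f j i)"
    and card: "card J = (\<Sum>i\<in>I. K i) + t"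
  obtains Q u where "Q \<subseteq> J" "card Q = t" "\<And>j. j \<in> Q \<Longrightarrow> u j j \<noteq> 0"
    "\<And>j j'. j \<in> Q \<Longrightarrow> j' \<in> Q \<Longrightarrow> j \<noteq> j' \<Longrightarrow> u j j' = 0"
    "\<And>j i. j \<in> Q \<Longrightarrow> i \<in> I \<Longrightarrow> (\<Sum>j'\<in>J. smult (u j j') (f j' i)) = 0"
proof -
  let ?I = "SIGMA i:I. {..<K i}" and ?A = "\<lambda>p j. coeff (f j (fst p)) (snd p)"
  obtain P where P: "P \<subseteq> J"
    and ind: "\<And>u. \<lbrakk>\<And>p. p \<in> ?I \<Longrightarrow> (\<Sum>j\<in>P. ?A p j * u j) = 0\<rbrakk> \<Longrightarrow> \<forall>j\<in>P. u j = 0"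
    and rel: "\<And>j. j \<in> J - P \<Longrightarrow>
      \<exists>u. u j \<noteq> 0 \<and> (\<forall>k. k \<notin> insert j P \<longrightarrow> u k = 0) \<and> (\<forall>p\<in>?I. (\<Sum>k\<in>J. ?A p k * u k) = 0)"
    using maximal_independent_columns[OF J, of ?I ?A] by blast
  have fin: "finite P" using P J finite_subset by blast
  have "card P \<le> card ?I"
  proof (rule ccontr)
    assume "\<not> ?thesis"
    then obtain u where "\<exists>j\<in>P. u j \<noteq> 0" "\<forall>p\<in>?I. (\<Sum>j\<in>P. ?A p j * u j) = 0"
      using homogeneous_system_nontrivial_solution[of ?I P ?A] fin I by auto
    with ind[of u] show False by blast
  qed
  then have "t \<le> card (J - P)" using card P fin I by (simp add: card_Diff_subset)
  then obtain Q where Q: "Q \<subseteq> J - P" "card Q = t" by (meson obtain_subset_with_card_n)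
  have "\<forall>j. \<exists>u. j \<in> Q \<longrightarrow> u j \<noteq> 0 \<and> (\<forall>k. k \<notin> insert j P \<longrightarrow> u k = 0) \<and>
      (\<forall>p\<in>?I. (\<Sum>k\<in>J. ?A p k * u k) = 0)" using rel Q(1) by blast
  from this[unfolded choice_iff] obtain u where u: "\<forall>j. j \<in> Q \<longrightarrow> u j j \<noteq> 0 \<and>
      (\<forall>k. k \<notin> insert j P \<longrightarrow> u j k = 0) \<and> (\<forall>p\<in>?I. (\<Sum>k\<in>J. ?A p k * u j k) = 0)" ..
  show ?thesis
  proof (rule that[of Q u])
    show "u j j' = 0" if "j \<in> Q" "j' \<in> Q" "j \<noteq> j'" for j j'
    proof -
      have "j' \<notin> insert j P" using that Q(1) by auto
      then show ?thesis using u that(1) by blast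
    qed
    show "(\<Sum>j'\<in>J. smult (u j j') (f j' i)) = 0" if "j \<in> Q" "i \<in> I" for j i
      using u that deg by (subst sum_smult_eq_0_iff[of _ "K i"]) auto
  qed (use u Q in auto)
qed

text \<open>The echelon pattern on Q makes the t kernel vectors independent over scalars. A scalar
  relation among their coefficients of degree k - 1 yields a kernel vector with degree bound k - 1,
  which \<open>inj\<close> makes zero; so the vectors are row reduced, hence independent over
  polynomials.\<close>

lemma sylvester_kernel_vectors:
  fixes M :: "'a::field poly mat"
  assumes M: "M \<in> carrier_mat m q" and deg: "\<And>i c. i < m \<Longrightarrow> c < q \<Longrightarrow> degree (M $$ (i, c)) \<le> ds ! i"
    and dim: "k * q = k * m + (\<Sum>i<m. ds ! i) + t" and k: "1 \<le> k" and inj: "sylvester_inj (k - 1) M"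
  obtains xs where "length xs = t" "set xs \<subseteq> carrier_vec q" "indep_rows q xs"
    "\<And>x c. x \<in> set xs \<Longrightarrow> c < q \<Longrightarrow> degree (x $ c) \<le> k - 1"
    "\<And>x i. x \<in> set xs \<Longrightarrow> i < m \<Longrightarrow> mult_poly_vec M (($) x) i = 0"
proof -
  define J where "J = {..<q} \<times> {..<k}"
  define f where "f cs i = (case cs of (c, s) \<Rightarrow> monom 1 s * M $$ (i, c))" for cs i
  have degf: "deg_lt (k + ds ! i) (f cs i)" if "cs \<in> J" "i \<in> {..<m}" for cs i
    using that deg by (auto simp: f_def J_def intro!: deg_lt_mult deg_lt_monom)
  have cardJ: "card J = (\<Sum>i\<in>{..<m}. k + ds ! i) + t"
    using dim by (simp add: J_def sum.distrib mult.commute)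
  have "finite J" by (simp add: J_def)
  obtain Q u
    where Q: "Q \<subseteq> J" "card Q = t" and u1: "\<And>j. j \<in> Q \<Longrightarrow> u j j \<noteq> 0"
      and u0: "\<And>j j'. j \<in> Q \<Longrightarrow> j' \<in> Q \<Longrightarrow> j \<noteq> j' \<Longrightarrow> u j j' = 0"
      and rel: "\<And>j i. j \<in> Q \<Longrightarrow> i < m \<Longrightarrow> (\<Sum>j'\<in>J. smult (u j j') (f j' i)) = 0"
    by (rule poly_family_kernel[OF finite_lessThan[of m] \<open>finite J\<close> degf cardJ]) auto
  have "finite Q" using Q(1) by (rule finite_subset) (simp add: J_def)
  then obtain js where js: "set js = Q" "distinct js" using finite_distinct_list by blast
  then have len: "length js = t" using Q(2) distinct_card by fastforce
  define x where "x j = vec q (\<lambda>c. \<Sum>s<k. monom (u j (c, s)) s)" for j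
  have ker: "mult_poly_vec M (($) (x j)) i = 0" if j: "j \<in> Q" and i: "i < m" for j i
  proof -
    have "mult_poly_vec M (($) (x j)) i = (\<Sum>c<q. (\<Sum>s<k. monom (u j (c, s)) s) * M $$ (i, c))"
      using M by (auto simp: mult_poly_vec_def x_def mult.commute)
    also have "\<dots> = (\<Sum>j'\<in>J. smult (u j j') (f j' i))"
      unfolding sum_smult_monom_mult[symmetric] J_def sum.cartesian_product
      by (intro sum.cong) (auto simp: f_def)
    finally show ?thesis using rel[OF j i] by simp
  qed
  have small: "deg_lt k (x j $ c)" if "c < q" for j c
    using that by (auto simp: x_def intro!: deg_lt_sum deg_lt_monom)
  have degx: "degree (x j $ c) \<le> k - 1" if "c < q" for j c
    using small[OF that] k by (intro degree_le_if_deg_lt) simp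
  have ind: "a l = 0" if rel: "\<And>c. c < q \<Longrightarrow> (\<Sum>l<t. smult (a l) (x (js ! l) $ c)) = 0" and l: "l < t" for a l
  proof -
    obtain c s where cs: "js ! l = (c, s)" by (cases "js ! l")
    have jl: "js ! l \<in> Q" using js(1) l len nth_mem by metis
    have c: "c < q" "s < k" using jl Q(1) cs by (auto simp: J_def)
    \<comment> \<open>Among the chosen vectors only the l-th has a nonzero entry at position
      \<open>js ! l\<close>, so this coefficient reads off \<open>a l\<close>.\<close>
    have "coeff (\<Sum>l<t. smult (a l) (x (js ! l) $ c)) s = (\<Sum>i<t. a i * u (js ! i) (js ! l))"
      using c by (simp add: coeff_sum x_def coeff_sum_monom cs)
    also have "\<dots> = (\<Sum>i<t. if i = l then a l * u (js ! l) (js ! l) else 0)"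
    proof (intro sum.cong refl)
      fix i assume "i \<in> {..<t}"
      then have "i < t" "js ! i \<in> Q" using js(1) len nth_mem by auto
      then show "a i * u (js ! i) (js ! l) = (if i = l then a l * u (js ! l) (js ! l) else 0)"
        using u0[OF _ jl, of "js ! i"] js(2) l len by (auto simp: nth_eq_iff_index_eq)
    qed
    finally show ?thesis using rel[OF c(1)] u1[OF jl] l by simp
  qed
  define xs where "xs = map x js"
  have lead: "a l = 0"
    if top: "\<And>c. c < q \<Longrightarrow> (\<Sum>l<length xs. a l * coeff (xs ! l $ c) (k - 1)) = 0" and l: "l < length xs" for a l
  proof (rule ind)
    let ?y = "\<lambda>c. \<Sum>l<t. smult (a l) (x (js ! l) $ c)"
    have "mult_poly_vec M ?y i = 0" if "i < m" for i
    proof -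
      have "mult_poly_vec M (($) (x (js ! l))) i = 0" if "l < t" for l
        using that \<open>i < m\<close> js(1) len by (intro ker) auto
      then show ?thesis unfolding mult_poly_vec_sum mult_poly_vec_smult by simp
    qed
    moreover have "deg_lt (k - 1) (?y c)" if c: "c < q" for c
      unfolding deg_lt_def
    proof (intro allI impI)
      fix s assume s: "k - 1 \<le> s"
      show "coeff (?y c) s = 0"
      proof (cases "s = k - 1")
        case True
        then show ?thesis using top[OF c] by (simp add: coeff_sum xs_def len)
      next
        case False
        then have "k \<le> s" using s by simp
        moreover have "deg_lt k (?y c)" by (intro deg_lt_sum deg_lt_smult small[OF c])
        ultimately show ?thesis by (simp add: deg_lt_def)
      qed
    qed
    ultimately show "?y c = 0" if "c < q" for c
      using inj[unfolded sylvester_inj_def, rule_format, of ?y c] M that by auto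
    show "l < t" using l len by (simp add: xs_def)
  qed
  have "indep_rows q xs"
  proof (rule indep_rows_if_row_reduced[of xs q "\<lambda>_. k - 1"])
    show "a l = 0" if "\<And>c. c < q \<Longrightarrow> (\<Sum>l<length xs. a l * coeff (xs ! l $ c) (k - 1)) = 0"
      "l < length xs" for a l
      using lead[of a l] that by blast
  qed (use degx in \<open>simp add: xs_def\<close>)
  moreover have "set xs \<subseteq> carrier_vec q" by (auto simp: xs_def x_def)
  ultimately show ?thesis using ker degx js(1) len by (intro that[of xs]) (auto simp: xs_def)
qed

lemma dual_degree_sum_le:
  fixes M N :: "'a::field poly mat"
  assumes M: "M \<in> carrier_mat m (m + n)"
    and deg: "\<And>i c. i < m \<Longrightarrow> c < m + n \<Longrightarrow> degree (M $$ (i, c)) \<le> ds ! i"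
    and surj: "sylvester_surj ds k M" and k: "1 \<le> k" and inj: "sylvester_inj (k - 1) M"
    and dim: "n * k = (\<Sum>i<m. ds ! i) + t" and n: "0 < n"
    and N: "N \<in> carrier_mat n (m + n)" "\<And>l c. l < n \<Longrightarrow> c < m + n \<Longrightarrow> degree (N $$ (l, c)) \<le> k"
    and min: "minimal_basis N" and ind: "indep_rows (m + n) (rows N)"
    and ker: "\<And>l i. l < n \<Longrightarrow> i < m \<Longrightarrow> mult_poly_vec M (\<lambda>c. N $$ (l, c)) i = 0"
  shows "(\<Sum>l<n. row_degree N l) \<le> (\<Sum>i<m. ds ! i)"
proof -
  have "k * (m + n) = k * m + (\<Sum>i<m. ds ! i) + t" using dim by (simp add: algebra_simps)
  from sylvester_kernel_vectors[OF M deg this k inj] obtain xs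
    where xs: "length xs = t" "set xs \<subseteq> carrier_vec (m + n)" "indep_rows (m + n) xs"
      and degx: "\<And>x c. x \<in> set xs \<Longrightarrow> c < m + n \<Longrightarrow> degree (x $ c) \<le> k - 1"
      and kerx: "\<And>x i. x \<in> set xs \<Longrightarrow> i < m \<Longrightarrow> mult_poly_vec M (($) x) i = 0" by blast
  have rows: "set (rows N) \<subseteq> carrier_vec (m + n)" "length (rows N) = n"
    using rows_carrier[of N] N by auto
  have kerN: "mult_poly_vec M (($) v) i = 0" if v: "v \<in> set (rows N)" and i: "i < m" for v i
  proof -
    obtain l where l: "l < n" "v = row N l" using v N by (auto simp: rows_def)
    then have "mult_poly_vec M (($) v) i = mult_poly_vec M (\<lambda>c. N $$ (l, c)) i"
      using M N by (intro mult_poly_vec_cong) auto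
    then show ?thesis using ker l i by simp
  qed
  have span: "in_row_span (m + n) (rows N) x" if "x \<in> set xs" for x
    by (rule in_row_span_if_in_kernel[OF M surj k rows(2) ind kerN kerx[OF that]])
  obtain ys where ys: "set ys \<subseteq> set (rows N)" "indep_rows (m + n) (xs @ ys)" "t + length ys = n"
    using indep_rows_exchange[OF xs(3) ind span] rows(2) xs(1) by metis
  have "sum_list (map vec_degree (rows N)) \<le> sum_list (map vec_degree (xs @ ys))"
  proof (rule minimal_basisD[OF min N(1)])
    show "in_row_span (m + n) (rows N) w" if "w \<in> set (xs @ ys)" for w
      using that span ys(1) in_row_span_member by fastforce
  qed (use xs ys rows in auto)
  also have "\<dots> \<le> t * (k - 1) + length ys * k"
  proof -
    have "vec_degree x \<le> k - 1" if "x \<in> set xs" for x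
      using degx[OF that] xs(2) that n by (intro vec_degree_le) auto
    then have "sum_list (map vec_degree xs) \<le> t * (k - 1)"
      using xs(1) sum_list_mono[of xs vec_degree "\<lambda>_. k - 1"] by (simp add: sum_list_triv)
    moreover have "vec_degree y \<le> k" if y: "y \<in> set ys" for y
    proof -
      obtain l where "l < n" "y = row N l" using y ys(1) N(1) by (auto simp: rows_def)
      then show ?thesis using N n by (intro vec_degree_le) auto
    qed
    then have "sum_list (map vec_degree ys) \<le> length ys * k"
      using sum_list_mono[of ys vec_degree "\<lambda>_. k"] by (simp add: sum_list_triv)
    ultimately show ?thesis by simp
  qed
  \<comment> \<open>t vectors of degree at most k - 1 and n - t of degree at most k: the total n k -
    t is exactly the sum of the d_i.\<close>
  also have "\<dots> = (\<Sum>i<m. ds ! i)"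
  proof -
    have "t * k + length ys * k = (\<Sum>i<m. ds ! i) + t" using dim ys(3) by (metis add_mult_distrib)
    then show ?thesis using k by (simp add: diff_mult_distrib2 algebra_simps)
  qed
  finally show ?thesis using rows(2) N(1) by (simp add: sum_list_map_nth row_degree_def)
qed

text \<open>Both degree sums are at most the sum of the d_i, by \<open>deg\<close> for M and by
  \<open>e\<close> for N, while \<open>row_span_degree_sum_ge\<close> and
  \<open>kernel_degree_sum_ge\<close> show that no competing basis falls below it.\<close>

lemma dual_minimal_basesI:
  fixes M N :: "'a::field poly mat"
  assumes M: "M \<in> carrier_mat m (m + n)"
    and deg: "\<And>i c. i < m \<Longrightarrow> c < m + n \<Longrightarrow> degree (M $$ (i, c)) \<le> ds ! i"
    and surj: "sylvester_surj ds k M" "1 \<le> k" and m: "0 < m" and n: "0 < n"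
    and N: "N \<in> carrier_mat n (m + n)" "\<And>l c. l < n \<Longrightarrow> c < m + n \<Longrightarrow> degree (N $$ (l, c)) \<le> e l"
    and lead: "\<And>a l. (\<And>c. c < m + n \<Longrightarrow> (\<Sum>l<n. a l * coeff (N $$ (l, c)) (e l)) = 0) \<Longrightarrow> l < n \<Longrightarrow> a l = 0"
    and ker: "\<And>l i. l < n \<Longrightarrow> i < m \<Longrightarrow> mult_poly_vec M (\<lambda>c. N $$ (l, c)) i = 0"
    and e: "(\<Sum>l<n. e l) \<le> (\<Sum>i<m. ds ! i)"
  shows "dual_minimal_bases m n M N"
proof -
  have rowsM: "rows M ! i $ c = M $$ (i, c)" if "i < m" "c < m + n" for i c using that M by simp
  have rowsN: "rows N ! i $ c = N $$ (i, c)" if "i < n" "c < m + n" for i c using that N by simp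
  have indM: "indep_rows (m + n) (rows M)"
  proof (rule indep_rows_if_row_reduced[of _ _ "(!) ds"])
    show "a l = 0" if "\<And>c. c < m + n \<Longrightarrow> (\<Sum>l<length (rows M). a l * coeff (rows M ! l $ c) (ds ! l)) = 0"
      "l < length (rows M)" for a l
      using sylvester_surj_leading_coeffs[OF M deg surj, of a l] that M by simp
  qed (use M deg in simp)
  have indN: "indep_rows (m + n) (rows N)"
  proof (rule indep_rows_if_row_reduced[of _ _ e])
    show "a l = 0" if "\<And>c. c < m + n \<Longrightarrow> (\<Sum>l<length (rows N). a l * coeff (rows N ! l $ c) (e l)) = 0"
      "l < length (rows N)" for a l
      using lead[of a l] that N by simp
  qed (use N in simp)
  have "minimal_basis M"
  proof (rule minimal_basisI[OF M _ indM])
    fix ws :: "'a poly vec list"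
    assume ws: "set ws \<subseteq> carrier_vec (m + n)" "length ws = m" "indep_rows (m + n) ws"
      and span: "\<And>w. w \<in> set ws \<Longrightarrow> in_row_span (m + n) (rows M) w"
    have "sum_list (map vec_degree (rows M)) \<le> (\<Sum>i<m. ds ! i)"
      using M deg m by (auto simp: sum_list_map_nth intro!: sum_mono vec_degree_le)
    also have "\<dots> \<le> sum_list (map vec_degree ws)"
      by (rule row_span_degree_sum_ge[OF M deg surj ws span])
    finally show "sum_list (map vec_degree (rows M)) \<le> sum_list (map vec_degree ws)" .
  qed (use n in simp)
  moreover have "minimal_basis N"
  proof (rule minimal_basisI[OF N(1) _ indN])
    fix ws :: "'a poly vec list"
    assume ws: "set ws \<subseteq> carrier_vec (m + n)" "length ws = n" "indep_rows (m + n) ws"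
      and span: "\<And>w. w \<in> set ws \<Longrightarrow> in_row_span (m + n) (rows N) w"
    \<comment> \<open>A vector in the row span of N need not be a polynomial combination of its
      rows; its multiple by g is one, and g cancels.\<close>
    have kerw: "mult_poly_vec M (($) w) i = 0" if w: "w \<in> set ws" and i: "i < m" for w i
    proof -
      obtain g c where g: "g \<noteq> 0" and c: "\<And>j. j < m + n \<Longrightarrow> g * w $ j = (\<Sum>l<n. c l * N $$ (l, j))"
        using span[OF w] N(1) rowsN unfolding in_row_span_def by auto
      have "g * mult_poly_vec M (($) w) i = mult_poly_vec M (\<lambda>j. \<Sum>l<n. c l * N $$ (l, j)) i"
        unfolding mult_poly_vec_mult[symmetric] using M c by (intro mult_poly_vec_cong) auto
      also have "\<dots> = 0" unfolding mult_poly_vec_sum mult_poly_vec_mult using ker i by simp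
      finally show ?thesis using g by simp
    qed
    have "sum_list (map vec_degree (rows N)) \<le> (\<Sum>l<n. e l)"
      using N n by (auto simp: sum_list_map_nth intro!: sum_mono vec_degree_le)
    also have "\<dots> \<le> sum_list (map vec_degree ws)"
      using kernel_degree_sum_ge[OF M surj ws kerw] e by simp
    finally show "sum_list (map vec_degree (rows N)) \<le> sum_list (map vec_degree ws)" .
  qed (use m in simp)
  moreover have "M * transpose_mat N = 0\<^sub>m m n"
  proof (rule eq_matI)
    fix i l assume "i < dim_row (0\<^sub>m m n :: 'a poly mat)" "l < dim_col (0\<^sub>m m n :: 'a poly mat)"
    then show "(M * transpose_mat N) $$ (i, l) = 0\<^sub>m m n $$ (i, l)"
      using ker[of l i] M N(1) by (simp add: scalar_prod_def mult_poly_vec_def atLeast0LessThan)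
  qed (use M N in auto)
  ultimately show ?thesis
    unfolding dual_minimal_bases_def
    using M N(1) indM indN full_row_rank_iff_indep_rows by blast
qed

section \<open>Trimmed Sylvester matrices\<close>

lemma sum_div_mod:
  fixes g :: "nat \<Rightarrow> nat \<Rightarrow> 'b::comm_monoid_add"
  shows "(\<Sum>b<k * q. g (b div q) (b mod q)) = (\<Sum>r<k. \<Sum>c<q. g r c)"
proof -
  have less: "r * q + c < k * q" if "r < k" "c < q" for r c
  proof -
    have "Suc r * q \<le> k * q" using that by (intro mult_le_mono1) simp
    then show ?thesis using that by simp
  qed
  have "(\<Sum>b<k * q. g (b div q) (b mod q)) = (\<Sum>(r, c)\<in>{..<k} \<times> {..<q}. g r c)"
  proof (rule sum.reindex_bij_witness[where i = "\<lambda>(r, c). r * q + c" and j = "\<lambda>b. (b div q, b mod q)"])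
    fix b assume b: "b \<in> {..<k * q}"
    then have "0 < q" by (cases q) auto
    then show "(b div q, b mod q) \<in> {..<k} \<times> {..<q}" using b by (simp add: less_mult_imp_div_less)
  qed (auto intro: less)
  then show ?thesis by (simp add: sum.cartesian_product)
qed

definition coeff_vec :: "nat \<Rightarrow> nat \<Rightarrow> (nat \<Rightarrow> 'a::zero poly) \<Rightarrow> 'a vec" where
  "coeff_vec k q x = vec (k * q) (\<lambda>b. coeff (x (b mod q)) (b div q))"

lemma coeff_vec_carrier [simp]: "coeff_vec k q x \<in> carrier_vec (k * q)"
  by (simp add: coeff_vec_def)

lemma coeff_vec_surj:
  assumes v: "v \<in> carrier_vec (k * q)"
  obtains x where "\<And>c. deg_lt k (x c)" "coeff_vec k q x = (v :: 'a::comm_monoid_add vec)"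
proof -
  define x where "x c = (\<Sum>s<k. monom (v $ (s * q + c)) s)" for c
  have "coeff_vec k q x = v"
  proof (rule eq_vecI)
    fix b assume "b < dim_vec v"
    then have b: "b < k * q" using v by simp
    then have "b div q < k" by (simp add: less_mult_imp_div_less)
    then show "coeff_vec k q x $ b = v $ b"
      using b by (simp add: coeff_vec_def x_def coeff_sum)
  qed (use v in \<open>simp add: coeff_vec_def\<close>)
  moreover have "deg_lt k (x c)" for c
    unfolding x_def by (auto simp: deg_lt_def coeff_sum)
  ultimately show ?thesis using that by blast
qed

lemma coeff_vec_eq_0_iff:
  assumes "\<And>c. c < q \<Longrightarrow> deg_lt k (x c)"
  shows "coeff_vec k q x = 0\<^sub>v (k * q) \<longleftrightarrow> (\<forall>c<q. x c = 0)"
proof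
  assume 0: "coeff_vec k q x = 0\<^sub>v (k * q)"
  show "\<forall>c<q. x c = 0"
  proof (intro allI impI poly_eqI)
    fix c s assume c: "c < q"
    show "coeff (x c) s = coeff 0 s"
    proof (cases "s < k")
      case True
      have "Suc s * q \<le> k * q" using True by (intro mult_le_mono1) simp
      then have "s * q + c < k * q" using c by simp
      moreover have "coeff_vec k q x $ (s * q + c) = 0\<^sub>v (k * q) $ (s * q + c)" using 0 by simp
      ultimately show ?thesis using c by (simp add: coeff_vec_def)
    qed (use assms c in \<open>simp add: deg_lt_def\<close>)
  qed
next
  assume 0: "\<forall>c<q. x c = 0"
  show "coeff_vec k q x = 0\<^sub>v (k * q)"
  proof (rule eq_vecI)
    fix b assume "b < dim_vec (0\<^sub>v (k * q) :: 'a vec)"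
    then have b: "b < k * q" by simp
    then have "b mod q < q" by (cases q) auto
    with 0 b show "coeff_vec k q x $ b = 0\<^sub>v (k * q) $ b" by (simp add: coeff_vec_def)
  qed (simp add: coeff_vec_def)
qed

definition poly_vec_norm :: "nat \<Rightarrow> nat \<Rightarrow> (nat \<Rightarrow> 'a::real_normed_vector poly) \<Rightarrow> real" where
  "poly_vec_norm k q x = sqrt (\<Sum>c<q. \<Sum>s<k. (norm (coeff (x c) s))\<^sup>2)"

lemma poly_vec_norm_nonneg [simp]: "0 \<le> poly_vec_norm k q x"
  by (simp add: poly_vec_norm_def sum_nonneg)

lemma poly_vec_norm_sq: "(poly_vec_norm k q x)\<^sup>2 = (\<Sum>c<q. \<Sum>s<k. (norm (coeff (x c) s))\<^sup>2)"
  by (simp add: poly_vec_norm_def sum_nonneg)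

lemma poly_vec_norm_deg_lt:
  assumes "\<And>c. c < q \<Longrightarrow> deg_lt k (x c)" "k \<le> l"
  shows "poly_vec_norm l q x = poly_vec_norm k q x"
proof -
  have "(\<Sum>s<l. (norm (coeff (x c) s))\<^sup>2) = (\<Sum>s<k. (norm (coeff (x c) s))\<^sup>2)" if "c < q" for c
    using assms(1)[OF that] assms(2) by (intro sum.mono_neutral_right) (auto simp: deg_lt_def)
  then show ?thesis by (simp add: poly_vec_norm_def)
qed

lemma euclidean_norm_coeff_vec: "euclidean_norm (coeff_vec k q x) = poly_vec_norm k q x"
proof -
  have "(euclidean_norm (coeff_vec k q x))\<^sup>2 = (\<Sum>b<k * q. (norm (coeff (x (b mod q)) (b div q)))\<^sup>2)"
    by (simp add: euclidean_norm_sq coeff_vec_def)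
  also have "\<dots> = (\<Sum>c<q. \<Sum>s<k. (norm (coeff (x c) s))\<^sup>2)"
    by (subst sum_div_mod[of "\<lambda>s c. (norm (coeff (x c) s))\<^sup>2"]) (rule sum.swap)
  finally show ?thesis
    by (metis euclidean_norm_nonneg poly_vec_norm_nonneg poly_vec_norm_sq power2_eq_iff_nonneg)
qed

text \<open>Trimming removes row i from the last d - d_i of the k + d block rows, which leaves it in
  those with index below k + d_i.\<close>

definition kept_rows :: "nat list \<Rightarrow> nat \<Rightarrow> nat set" where
  "kept_rows ds k = {a. a < (k + Max (set ds)) * length ds \<and> a div length ds < k + ds ! (a mod length ds)}"

definition row_position :: "nat list \<Rightarrow> nat \<Rightarrow> nat \<Rightarrow> nat \<times> nat" where
  "row_position ds k a = (pick (kept_rows ds k) a mod length ds, pick (kept_rows ds k) a div length ds)"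

text \<open>A pair (i, s) stands for the coefficient of degree s in component i of M x. Equations
  and norms over the rows of T_k(M) are reindexed along this bijection, and it yields the number of
  rows.\<close>

lemma bij_betw_row_position:
  assumes m: "0 < length ds"
  shows "bij_betw (row_position ds k) {..<card (kept_rows ds k)} (SIGMA i:{..<length ds}. {..<k + ds ! i})"
    and "card (kept_rows ds k) = k * length ds + sum_list ds"
proof -
  let ?R = "kept_rows ds k" and ?m = "length ds"
  let ?S = "SIGMA i:{..<length ds}. {..<k + ds ! i}"
  have fin: "finite ?R" by (simp add: kept_rows_def)
  have "bij_betw (pick ?R) {..<card ?R} ?R"
  proof -
    have "pick ?R ` {..<card ?R} = ?R"
    proof (intro equalityI subsetI)
      fix a assume "a \<in> pick ?R ` {..<card ?R}"
      then show "a \<in> ?R" using pick_in_set_le by auto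
    next
      fix a assume a: "a \<in> ?R"
      have "{b \<in> ?R. b < a} \<subset> ?R" using a by auto
      then have "card {b \<in> ?R. b < a} < card ?R" using fin by (rule psubset_card_mono[rotated])
      moreover have "pick ?R (card {b \<in> ?R. b < a}) = a" using a by (rule pick_card_in_set)
      ultimately show "a \<in> pick ?R ` {..<card ?R}"
        by (intro image_eqI[where x = "card {b \<in> ?R. b < a}"]) simp_all
    qed
    then show ?thesis using eq_card_imp_inj_on[of "{..<card ?R}" "pick ?R"] by (simp add: bij_betw_def)
  qed
  moreover have bij: "bij_betw (\<lambda>a. (a mod ?m, a div ?m)) ?R ?S"
  proof (rule bij_betw_byWitness[where f' = "\<lambda>(i, s). s * ?m + i"])
    show "(\<lambda>(i, s). s * ?m + i) ` ?S \<subseteq> ?R"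
    proof clarify
      fix i s assume i: "i < ?m" and s: "s < k + ds ! i"
      have "ds ! i \<le> Max (set ds)" using i by (intro Max_ge) auto
      then have "Suc s * ?m \<le> (k + Max (set ds)) * ?m" using s by (intro mult_le_mono1) simp
      moreover have "(s * ?m + i) div ?m = s" "(s * ?m + i) mod ?m = i" using i m by simp_all
      ultimately show "s * ?m + i \<in> ?R" using i s by (simp add: kept_rows_def)
    qed
  qed (use m in \<open>auto simp: kept_rows_def\<close>)
  ultimately show "bij_betw (row_position ds k) {..<card ?R} ?S"
    unfolding row_position_def using bij_betw_trans[of "pick ?R" _ ?R "\<lambda>a. (a mod ?m, a div ?m)" ?S]
    by (simp add: o_def)
  show "card ?R = k * ?m + sum_list ds"
    using bij_betw_same_card[OF bij] by (simp add: sum.distrib sum_list_sum_nth atLeast0LessThan mult.commute)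
qed

lemma
  assumes M: "M \<in> carrier_mat (length ds) q" and m: "0 < length ds"
  shows trimmed_sylvester_carrier: "trimmed_sylvester ds k M \<in> carrier_mat (k * length ds + sum_list ds) (k * q)"
    and trimmed_sylvester_eq_mat: "trimmed_sylvester ds k M = mat (k * length ds + sum_list ds) (k * q)
      (\<lambda>(a, b). sylvester (Max (set ds)) k M $$ (pick (kept_rows ds k) a, b))"
proof -
  let ?m = "length ds"
  let ?S = "sylvester (Max (set ds)) k M"
  let ?I = "{a. \<not> k + Max (set ds) - (Max (set ds) - ds ! (a mod ?m)) \<le> a div ?m}"
  have S: "?S \<in> carrier_mat ((k + Max (set ds)) * ?m) (k * q)" using M by (simp add: sylvester_def)
  \<comment> \<open>Each d_i is at most the maximum, so the inner truncated subtraction is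
    exact.\<close>
  have "k + Max (set ds) - (Max (set ds) - ds ! (a mod ?m)) = k + ds ! (a mod ?m)" for a
  proof -
    have "ds ! (a mod ?m) \<le> Max (set ds)" using m by (intro Max_ge) auto
    then show ?thesis by simp
  qed
  then have R: "{a. a < (k + Max (set ds)) * ?m \<and> a \<in> ?I} = kept_rows ds k"
    by (auto simp: kept_rows_def not_le)
  have pick: "pick ?I a = pick (kept_rows ds k) a" if "a < k * ?m + sum_list ds" for a
    using pick_reduce_set[of a "(k + Max (set ds)) * ?m" ?I] that
    unfolding R bij_betw_row_position(2)[OF m] by simp
  have card: "card {a. a < dim_row ?S \<and> a \<in> ?I} = k * ?m + sum_list ds"
    using S R bij_betw_row_position(2)[OF m, of k] by simp
  show T: "trimmed_sylvester ds k M = mat (k * ?m + sum_list ds) (k * q)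
      (\<lambda>(a, b). ?S $$ (pick (kept_rows ds k) a, b))"
    unfolding trimmed_sylvester_def submatrix_def Let_def using card S M
    by (intro eq_matI) (auto simp: pick pick_UNIV)
  show "trimmed_sylvester ds k M \<in> carrier_mat (k * ?m + sum_list ds) (k * q)" unfolding T by simp
qed

lemma trimmed_sylvester_mult_coeff_vec:
  fixes M :: "'a::field poly mat"
  assumes M: "M \<in> polymats_rowdeg ds q" and m: "0 < length ds"
    and x: "\<And>c. c < q \<Longrightarrow> deg_lt k (x c)" and a: "a < k * length ds + sum_list ds"
  shows "(trimmed_sylvester ds k M *\<^sub>v coeff_vec k q x) $ a
    = coeff (mult_poly_vec M x (fst (row_position ds k a))) (snd (row_position ds k a))"
proof -
  let ?m = "length ds" and ?d = "Max (set ds)"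
  have Mc: "M \<in> carrier_mat ?m q" and deg: "\<And>i c. i < ?m \<Longrightarrow> c < q \<Longrightarrow> degree (M $$ (i, c)) \<le> ds ! i"
    using M by (auto simp: polymats_rowdeg_def)
  define a' where "a' = pick (kept_rows ds k) a"
  define i p where "i = a' mod ?m" and "p = a' div ?m"
  have pos: "row_position ds k a = (i, p)" by (simp add: row_position_def i_def p_def a'_def)
  have "a' \<in> kept_rows ds k"
    unfolding a'_def using pick_in_set_le[of a "kept_rows ds k"] bij_betw_row_position(2)[OF m] a by simp
  then have a': "a' < (k + ?d) * ?m" by (simp add: kept_rows_def)
  have i: "i < ?m" using m by (simp add: i_def)
  \<comment> \<open>Beyond offset d the zero entries of \<open>sylvester\<close> agree with the
    vanishing coefficients of M, which leaves a pure convolution.\<close>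
  have S: "sylvester ?d k M $$ (a', b)
      = (if b div q \<le> p then coeff (M $$ (i, b mod q)) (p - b div q) else 0)" if b: "b < k * q" for b
  proof -
    have "b mod q < q" using b by (cases q) auto
    then have "degree (M $$ (i, b mod q)) \<le> ?d"
      using deg[OF i, of "b mod q"] Max_ge[OF finite_set nth_mem[OF i]] by (meson le_trans)
    then show ?thesis
      using a' b Mc by (auto simp: sylvester_def Let_def i_def p_def coeff_eq_0)
  qed
  have "(trimmed_sylvester ds k M *\<^sub>v coeff_vec k q x) $ a
      = (\<Sum>b<k * q. sylvester ?d k M $$ (a', b) * coeff (x (b mod q)) (b div q))"
    using a by (simp add: trimmed_sylvester_eq_mat[OF Mc m] scalar_prod_def coeff_vec_def
        atLeast0LessThan a'_def)
  also have "\<dots> = (\<Sum>b<k * q. if b div q \<le> p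
      then coeff (M $$ (i, b mod q)) (p - b div q) * coeff (x (b mod q)) (b div q) else 0)"
    using S by (intro sum.cong) auto
  also have "\<dots> = (\<Sum>c<q. \<Sum>r<k. if r \<le> p then coeff (M $$ (i, c)) (p - r) * coeff (x c) r else 0)"
    by (subst sum_div_mod[of "\<lambda>r c. if r \<le> p then coeff (M $$ (i, c)) (p - r) * coeff (x c) r else 0"])
      (rule sum.swap)
  also have "\<dots> = (\<Sum>c<q. coeff (M $$ (i, c) * x c) p)"
  proof (intro sum.cong refl)
    fix c assume "c \<in> {..<q}"
    then have xc: "deg_lt k (x c)" using x by simp
    have "(\<Sum>r<k. if r \<le> p then coeff (M $$ (i, c)) (p - r) * coeff (x c) r else 0)
        = (\<Sum>r\<in>{..<k} \<inter> {..p}. coeff (x c) r * coeff (M $$ (i, c)) (p - r))"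
      by (subst sum.inter_restrict) (auto simp: mult.commute intro!: sum.cong)
    also have "\<dots> = (\<Sum>r\<le>p. coeff (x c) r * coeff (M $$ (i, c)) (p - r))"
    proof -
      have "coeff (x c) r = 0" if "\<not> r < k" for r using xc that by (simp add: deg_lt_def)
      then show ?thesis by (intro sum.mono_neutral_left) auto
    qed
    finally show "(\<Sum>r<k. if r \<le> p then coeff (M $$ (i, c)) (p - r) * coeff (x c) r else 0)
        = coeff (M $$ (i, c) * x c) p"
      by (simp add: coeff_mult[of "x c"] mult.commute[of _ "x c"])
  qed
  also have "\<dots> = coeff (mult_poly_vec M x i) p" using Mc by (simp add: mult_poly_vec_def coeff_sum)
  finally show ?thesis by (simp add: pos)
qed

lemma mult_poly_vec_deg_lt:
  assumes M: "M \<in> polymats_rowdeg ds q" and x: "\<And>c. c < q \<Longrightarrow> deg_lt k (x c)" and i: "i < length ds"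
  shows "deg_lt (k + ds ! i) (mult_poly_vec M x i)"
  unfolding mult_poly_vec_def
proof (rule deg_lt_sum)
  fix c assume "c \<in> {..<dim_col M}"
  then have "c < q" using M by (auto simp: polymats_rowdeg_def)
  then show "deg_lt (k + ds ! i) (M $$ (i, c) * x c)"
    using deg_lt_mult[OF x, of c "M $$ (i, c)" "ds ! i"] M i by (auto simp: polymats_rowdeg_def mult.commute)
qed

lemma trimmed_sylvester_mult_eq_iff:
  fixes M :: "'a::field poly mat"
  assumes M: "M \<in> polymats_rowdeg ds q" and m: "0 < length ds"
    and x: "\<And>c. c < q \<Longrightarrow> deg_lt k (x c)" and y: "\<And>i. i < length ds \<Longrightarrow> deg_lt (k + ds ! i) (y i)"
    and b: "b = vec (k * length ds + sum_list ds)
      (\<lambda>a. coeff (y (fst (row_position ds k a))) (snd (row_position ds k a)))"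
  shows "trimmed_sylvester ds k M *\<^sub>v coeff_vec k q x = b \<longleftrightarrow>
    (\<forall>i<length ds. mult_poly_vec M x i = y i)"
proof -
  let ?n = "k * length ds + sum_list ds"
  note bij = bij_betw_row_position(1)[OF m, of k, unfolded bij_betw_row_position(2)[OF m]]
  have Mc: "M \<in> carrier_mat (length ds) q" using M by (simp add: polymats_rowdeg_def)
  have "trimmed_sylvester ds k M *\<^sub>v coeff_vec k q x = b \<longleftrightarrow>
      (\<forall>a<?n. (trimmed_sylvester ds k M *\<^sub>v coeff_vec k q x) $ a = b $ a)"
    using trimmed_sylvester_carrier[OF Mc m, of k] by (auto simp: b vec_eq_iff)
  also have "\<dots> \<longleftrightarrow> (\<forall>a<?n. (\<lambda>(i, s). coeff (mult_poly_vec M x i) s = coeff (y i) s) (row_position ds k a))"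
    using trimmed_sylvester_mult_coeff_vec[OF M m x] by (simp add: b case_prod_unfold)
  also have "\<dots> \<longleftrightarrow> (\<forall>(i, s)\<in>(SIGMA i:{..<length ds}. {..<k + ds ! i}).
      coeff (mult_poly_vec M x i) s = coeff (y i) s)"
    unfolding bij_betw_imp_surj_on[OF bij, symmetric] ball_simps by (simp only: Ball_def lessThan_iff)
  also have "\<dots> \<longleftrightarrow> (\<forall>i<length ds. mult_poly_vec M x i = y i)"
  proof (intro iffI allI impI poly_eqI)
    fix i s assume *: "\<forall>(i, s)\<in>(SIGMA i:{..<length ds}. {..<k + ds ! i}).
      coeff (mult_poly_vec M x i) s = coeff (y i) s" and i: "i < length ds"
    show "coeff (mult_poly_vec M x i) s = coeff (y i) s"
      using * i mult_poly_vec_deg_lt[OF M x i] y[OF i]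
      by (cases "s < k + ds ! i") (auto simp: deg_lt_def)
  qed auto
  finally show ?thesis .
qed

lemma row_vec_surj:
  assumes m: "0 < length ds" and b: "b \<in> carrier_vec (k * length ds + sum_list ds)"
  obtains y where "\<And>i. deg_lt (k + ds ! i) (y i)"
    "b = vec (k * length ds + sum_list ds)
      (\<lambda>a. coeff (y (fst (row_position ds k a))) (snd (row_position ds k a)) :: 'a::field)"
proof -
  let ?n = "k * length ds + sum_list ds"
  note bij = bij_betw_row_position(1)[OF m, of k, unfolded bij_betw_row_position(2)[OF m]]
  define y where "y i = (\<Sum>s<k + ds ! i. monom (b $ the_inv_into {..<?n} (row_position ds k) (i, s)) s)" for i
  have "b $ a = coeff (y (fst (row_position ds k a))) (snd (row_position ds k a))" if a: "a < ?n" for a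
  proof -
    obtain i s where ip: "row_position ds k a = (i, s)" by (cases "row_position ds k a")
    have "(i, s) \<in> (SIGMA i:{..<length ds}. {..<k + ds ! i})"
      using bspec[OF bij_betwE[OF bij], of a] a ip by simp
    moreover have "the_inv_into {..<?n} (row_position ds k) (i, s) = a"
      using bij a ip by (metis bij_betw_imp_inj_on lessThan_iff the_inv_into_f_f)
    ultimately show ?thesis by (simp add: ip y_def coeff_sum_monom)
  qed
  then have "b = vec ?n (\<lambda>a. coeff (y (fst (row_position ds k a))) (snd (row_position ds k a)))"
    using b by (intro eq_vecI) auto
  moreover have "deg_lt (k + ds ! i) (y i)" for i
    unfolding y_def by (auto simp: deg_lt_def coeff_sum)
  ultimately show ?thesis using that by blast
qed

lemma mat_rank_trimmed_sylvester_surj: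
  fixes M :: "'a::field poly mat"
  assumes M: "M \<in> polymats_rowdeg ds q" and m: "0 < length ds"
  shows "mat_rank (trimmed_sylvester ds k M) = k * length ds + sum_list ds \<longleftrightarrow> sylvester_surj ds k M"
proof -
  let ?T = "trimmed_sylvester ds k M" and ?n = "k * length ds + sum_list ds"
  have Mc: "M \<in> carrier_mat (length ds) q" using M by (simp add: polymats_rowdeg_def)
  note T = trimmed_sylvester_carrier[OF Mc m, of k]
  have "mat_rank ?T = ?n \<longleftrightarrow> (\<forall>b\<in>carrier_vec ?n. \<exists>v\<in>carrier_vec (k * q). ?T *\<^sub>v v = b)"
    using mat_rank_eq_dim_row_iff[of ?T] T by simp
  also have "\<dots> \<longleftrightarrow> sylvester_surj ds k M"
  proof
    assume surj: "\<forall>b\<in>carrier_vec ?n. \<exists>v\<in>carrier_vec (k * q). ?T *\<^sub>v v = b"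
    show "sylvester_surj ds k M"
      unfolding sylvester_surj_def
    proof (intro allI impI)
      fix y :: "nat \<Rightarrow> 'a poly" assume y: "\<forall>i<dim_row M. deg_lt (k + ds ! i) (y i)"
      define b where "b = vec ?n (\<lambda>a. coeff (y (fst (row_position ds k a))) (snd (row_position ds k a)))"
      have "b \<in> carrier_vec ?n" by (simp add: b_def)
      then obtain v where v: "v \<in> carrier_vec (k * q)" "?T *\<^sub>v v = b" using surj by blast
      obtain x where x: "\<And>c. deg_lt k (x c)" "coeff_vec k q x = v" using coeff_vec_surj[OF v(1)] by blast
      have "\<forall>i<length ds. mult_poly_vec M x i = y i"
        using trimmed_sylvester_mult_eq_iff[OF M m _ _ b_def, of x] y Mc v(2) x by simp
      then show "\<exists>x. (\<forall>c<dim_col M. deg_lt k (x c)) \<and> (\<forall>i<dim_row M. mult_poly_vec M x i = y i)"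
        using x(1) Mc by auto
    qed
  next
    assume surj: "sylvester_surj ds k M"
    show "\<forall>b\<in>carrier_vec ?n. \<exists>v\<in>carrier_vec (k * q). ?T *\<^sub>v v = b"
    proof
      fix b :: "'a vec" assume "b \<in> carrier_vec ?n"
      then obtain y where y: "\<And>i. deg_lt (k + ds ! i) (y i)"
        and b: "b = vec ?n (\<lambda>a. coeff (y (fst (row_position ds k a))) (snd (row_position ds k a)))"
        using row_vec_surj[OF m, of b k] by blast
      obtain x where x: "\<forall>c<q. deg_lt k (x c)" "\<forall>i<length ds. mult_poly_vec M x i = y i"
        using sylvester_surjD[OF surj Mc y] by blast
      then have "?T *\<^sub>v coeff_vec k q x = b"
        using trimmed_sylvester_mult_eq_iff[OF M m _ y b, of x] by simp
      then show "\<exists>v\<in>carrier_vec (k * q). ?T *\<^sub>v v = b" by (intro bexI[of _ "coeff_vec k q x"]) auto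
    qed
  qed
  finally show ?thesis .
qed

lemma trimmed_sylvester_mult_eq_0_iff:
  fixes M :: "'a::field poly mat"
  assumes M: "M \<in> polymats_rowdeg ds q" and m: "0 < length ds"
    and x: "\<And>c. c < q \<Longrightarrow> deg_lt k (x c)"
  shows "trimmed_sylvester ds k M *\<^sub>v coeff_vec k q x = 0\<^sub>v (k * length ds + sum_list ds) \<longleftrightarrow>
    (\<forall>i<length ds. mult_poly_vec M x i = 0)"
  by (rule trimmed_sylvester_mult_eq_iff[OF M m x]) (auto simp: vec_eq_iff)

lemma mat_rank_trimmed_sylvester_inj:
  fixes M :: "'a::field poly mat"
  assumes M: "M \<in> polymats_rowdeg ds q" and m: "0 < length ds"
  shows "mat_rank (trimmed_sylvester ds k M) = k * q \<longleftrightarrow> sylvester_inj k M"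
proof -
  let ?T = "trimmed_sylvester ds k M" and ?n = "k * length ds + sum_list ds"
  have Mc: "M \<in> carrier_mat (length ds) q" using M by (simp add: polymats_rowdeg_def)
  note T = trimmed_sylvester_carrier[OF Mc m, of k]
  have "mat_rank ?T = k * q \<longleftrightarrow>
      (\<forall>v\<in>carrier_vec (k * q). ?T *\<^sub>v v = 0\<^sub>v ?n \<longrightarrow> v = 0\<^sub>v (k * q))"
    using mat_rank_eq_dim_col_iff[of ?T] T by simp
  also have "\<dots> \<longleftrightarrow> sylvester_inj k M"
  proof
    assume inj: "\<forall>v\<in>carrier_vec (k * q). ?T *\<^sub>v v = 0\<^sub>v ?n \<longrightarrow> v = 0\<^sub>v (k * q)"
    show "sylvester_inj k M"
      unfolding sylvester_inj_def
    proof (intro allI impI)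
      fix x c assume x: "\<forall>c<dim_col M. deg_lt k (x c)" "\<forall>i<dim_row M. mult_poly_vec M x i = 0"
        and c: "c < dim_col M"
      have "?T *\<^sub>v coeff_vec k q x = 0\<^sub>v ?n"
        using trimmed_sylvester_mult_eq_0_iff[OF M m, of k x] x Mc by simp
      then have "coeff_vec k q x = 0\<^sub>v (k * q)" using inj by simp
      then show "x c = 0" using coeff_vec_eq_0_iff[of q k x] x(1) c Mc by simp
    qed
  next
    assume inj: "sylvester_inj k M"
    show "\<forall>v\<in>carrier_vec (k * q). ?T *\<^sub>v v = 0\<^sub>v ?n \<longrightarrow> v = 0\<^sub>v (k * q)"
    proof (intro ballI impI)
      fix v assume v: "v \<in> carrier_vec (k * q)" and 0: "?T *\<^sub>v v = 0\<^sub>v ?n"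
      obtain x where x: "\<And>c. deg_lt k (x c)" "coeff_vec k q x = v" using coeff_vec_surj[OF v] by blast
      have "\<forall>i<length ds. mult_poly_vec M x i = 0"
        using trimmed_sylvester_mult_eq_0_iff[OF M m, of k x] 0 x by simp
      then have "\<forall>c<q. x c = 0" using inj[unfolded sylvester_inj_def] x(1) Mc by auto
      then show "v = 0\<^sub>v (k * q)" using coeff_vec_eq_0_iff[of q k x] x by simp
    qed
  qed
  finally show ?thesis .
qed

text \<open>k m plus the sum of the d_i compares with k (m + n) as that sum does with n k; the
  smaller side decides between full row and full column rank, and equality means both.\<close>

lemma full_trimmed_sylvester_rank_iff:
  fixes M :: "'a::field poly mat"
  assumes M: "M \<in> polymats_rowdeg ds (length ds + n)" and m: "0 < length ds"
  shows "full_trimmed_sylvester_rank ds M \<longleftrightarrow>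
    (\<forall>k\<ge>1. (sum_list ds \<le> n * k \<longrightarrow> sylvester_surj ds k M) \<and> (n * k \<le> sum_list ds \<longrightarrow> sylvester_inj k M))"
proof -
  have "mat_rank (trimmed_sylvester ds k M) = min (k * dim_row M + sum_list ds) (k * dim_col M) \<longleftrightarrow>
      (sum_list ds \<le> n * k \<longrightarrow> sylvester_surj ds k M) \<and> (n * k \<le> sum_list ds \<longrightarrow> sylvester_inj k M)" for k
  proof -
    have dim: "dim_row M = length ds" "dim_col M = length ds + n" using M by (auto simp: polymats_rowdeg_def)
    have "k * (length ds + n) = k * length ds + n * k" by (simp add: algebra_simps)
    then show ?thesis
      using mat_rank_trimmed_sylvester_surj[OF M m, of k] mat_rank_trimmed_sylvester_inj[OF M m, of k]
      unfolding dim by (cases "sum_list ds \<le> n * k"; cases "n * k \<le> sum_list ds") (auto simp: min_def)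
  qed
  then show ?thesis by (simp add: full_trimmed_sylvester_rank_def)
qed


section \<open>Norm of the difference of two trimmed Sylvester matrices\<close>

lemma L2_set_sum_le: "L2_set (\<lambda>j. \<Sum>r\<in>R. f r j) J \<le> (\<Sum>r\<in>R. L2_set (f r) J)"
proof (induction R rule: infinite_finite_induct)
  case (insert r R)
  have "L2_set (\<lambda>j. f r j + (\<Sum>r\<in>R. f r j)) J \<le> L2_set (f r) J + L2_set (\<lambda>j. \<Sum>r\<in>R. f r j) J"
    by (rule L2_set_triangle_ineq)
  with insert show ?case by simp
qed (simp_all add: L2_set_def)

lemma euclidean_norm_trimmed_sylvester_diff:
  fixes M M' :: "'a::real_or_complex poly mat"
  assumes M: "M \<in> polymats_rowdeg ds q" and M': "M' \<in> polymats_rowdeg ds q" and m: "0 < length ds"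
    and x: "\<And>c. c < q \<Longrightarrow> deg_lt k (x c)"
  shows "euclidean_norm ((trimmed_sylvester ds k M - trimmed_sylvester ds k M') *\<^sub>v coeff_vec k q x)
    = L2_set (\<lambda>(i, s). norm (coeff (mult_poly_vec M x i - mult_poly_vec M' x i) s))
        (SIGMA i:{..<length ds}. {..<k + ds ! i})"
proof -
  let ?n = "k * length ds + sum_list ds"
  let ?f = "\<lambda>(i, s). norm (coeff (mult_poly_vec M x i - mult_poly_vec M' x i) s)"
  note bij = bij_betw_row_position(1)[OF m, of k, unfolded bij_betw_row_position(2)[OF m]]
  have Mc: "M \<in> carrier_mat (length ds) q" "M' \<in> carrier_mat (length ds) q"
    using M M' by (auto simp: polymats_rowdeg_def)
  note T = trimmed_sylvester_carrier[OF Mc(1) m, of k] trimmed_sylvester_carrier[OF Mc(2) m, of k]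
  have "((trimmed_sylvester ds k M - trimmed_sylvester ds k M') *\<^sub>v coeff_vec k q x) $ a
      = (case row_position ds k a of (i, s) \<Rightarrow> coeff (mult_poly_vec M x i - mult_poly_vec M' x i) s)"
    if "a < ?n" for a
    using that T by (simp add: minus_mult_distrib_mat_vec[OF T] trimmed_sylvester_mult_coeff_vec[OF M m x]
        trimmed_sylvester_mult_coeff_vec[OF M' m x] case_prod_unfold del: index_mult_mat_vec)
  then have "euclidean_norm ((trimmed_sylvester ds k M - trimmed_sylvester ds k M') *\<^sub>v coeff_vec k q x)
      = L2_set (\<lambda>a. ?f (row_position ds k a)) {..<?n}"
    unfolding euclidean_norm_def using T by (intro L2_set_cong) (auto simp: case_prod_unfold)
  also have "\<dots> = L2_set ?f (SIGMA i:{..<length ds}. {..<k + ds ! i})"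
    unfolding L2_set_def using sum.reindex_bij_betw[OF bij, of "\<lambda>p. (?f p)\<^sup>2"] by simp
  finally show ?thesis .
qed

text \<open>
  The block columns of a Sylvester matrix are shifted copies of its first one.
\<close>
lemma trimmed_sylvester_diff_le:
  fixes M M' :: "'a::real_or_complex poly mat"
  assumes M: "M \<in> polymats_rowdeg ds q" and M': "M' \<in> polymats_rowdeg ds q" and m: "0 < length ds"
    and v: "v \<in> carrier_vec (k * q)"
  shows "euclidean_norm ((trimmed_sylvester ds k M - trimmed_sylvester ds k M') *\<^sub>v v)
    \<le> sqrt (real k) * spectral_norm (trimmed_sylvester ds 1 M - trimmed_sylvester ds 1 M') * euclidean_norm v"
proof -
  let ?\<nu> = "spectral_norm (trimmed_sylvester ds 1 M - trimmed_sylvester ds 1 M')"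
  let ?S = "\<lambda>k. SIGMA i:{..<length ds}. {..<k + ds ! i}"
  have Mc: "M \<in> carrier_mat (length ds) q" "M' \<in> carrier_mat (length ds) q"
    using M M' by (auto simp: polymats_rowdeg_def)
  have T1: "trimmed_sylvester ds 1 M - trimmed_sylvester ds 1 M' \<in> carrier_mat (1 * length ds + sum_list ds) (1 * q)"
    using trimmed_sylvester_carrier[OF Mc(2) m, of 1] by (rule minus_carrier_mat)
  obtain x where x: "\<And>c. deg_lt k (x c)" and v_eq: "coeff_vec k q x = v" using coeff_vec_surj[OF v] by blast
  define D where "D x i = mult_poly_vec M x i - mult_poly_vec M' x i" for x i
  \<comment> \<open>The r-th block of v as constant polynomials: x is the sum of the shifted blocks,
    and the spectral norm for k = 1 applies to each block.\<close>
  define w where "w r c = [:coeff (x c) r:]" for r c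
  have w: "deg_lt 1 (w r c)" for r c by (simp add: w_def deg_lt_degree)
  have xc: "x c = (\<Sum>r<k. monom 1 r * w r c)" for c
  proof (rule poly_eqI)
    fix s
    show "coeff (x c) s = coeff (\<Sum>r<k. monom 1 r * w r c) s"
      using x[of c] by (simp add: w_def smult_monom coeff_sum deg_lt_def)
  qed
  have Dx: "D x i = (\<Sum>r<k. monom 1 r * D (w r) i)" for i
  proof -
    have "mult_poly_vec K x i = (\<Sum>r<k. monom 1 r * mult_poly_vec K (w r) i)" for K :: "'a poly mat"
      unfolding mult_poly_vec_mult[symmetric] mult_poly_vec_sum[symmetric] xc[symmetric] ..
    then show ?thesis by (simp add: D_def algebra_simps sum_subtractf)
  qed
  have Dw: "deg_lt (1 + ds ! i) (D (w r) i)" if "i < length ds" for r i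
    using mult_poly_vec_deg_lt[OF M, of 1 "w r" i] mult_poly_vec_deg_lt[OF M', of 1 "w r" i] w that
    by (simp add: D_def deg_lt_def)
  \<comment> \<open>Multiplication by a power of the variable only moves coefficients, so the norm
    does not grow.\<close>
  have shift: "L2_set (\<lambda>(i, s). norm (coeff (monom 1 r * D (w r) i) s)) (?S k)
      \<le> L2_set (\<lambda>(i, s). norm (coeff (D (w r) i) s)) (?S 1)" for r
  proof -
    have "(\<Sum>s<k + ds ! i. (norm (coeff (monom 1 r * D (w r) i) s))\<^sup>2)
        \<le> (\<Sum>s<1 + ds ! i. (norm (coeff (D (w r) i) s))\<^sup>2)" if i: "i < length ds" for i
    proof -
      let ?L = "1 + ds ! i"
      let ?g = "\<lambda>s. (norm (coeff (monom 1 r * D (w r) i) s))\<^sup>2"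
      have g: "?g s = (if r \<le> s then (norm (coeff (D (w r) i) (s - r)))\<^sup>2 else 0)" for s
        by (simp add: coeff_monom_mult)
      have "sum ?g {..<k + ds ! i} = sum ?g ({..<k + ds ! i} \<inter> {r..<r + ?L})"
      proof -
        have "coeff (D (w r) i) (s - r) = 0" if "r \<le> s" "\<not> s < r + ?L" for s
          using Dw[OF i, of r] that by (simp add: deg_lt_def)
        then show ?thesis by (intro sum.mono_neutral_right) (auto simp: g)
      qed
      also have "\<dots> \<le> sum ?g {r..<r + ?L}" by (intro sum_mono2) auto
      also have "\<dots> = (\<Sum>s<?L. (norm (coeff (D (w r) i) s))\<^sup>2)"
        by (rule sum.reindex_bij_witness[where i = "\<lambda>s. s + r" and j = "\<lambda>s. s - r"]) (auto simp: g)
      finally show ?thesis .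
    qed
    then have "(\<Sum>i<length ds. \<Sum>s<k + ds ! i. (norm (coeff (monom 1 r * D (w r) i) s))\<^sup>2)
        \<le> (\<Sum>i<length ds. \<Sum>s<1 + ds ! i. (norm (coeff (D (w r) i) s))\<^sup>2)"
      by (intro sum_mono) auto
    then show ?thesis
      by (simp add: L2_set_def sum.Sigma case_prod_unfold del: sum.lessThan_Suc)
  qed
  have step: "L2_set (\<lambda>(i, s). norm (coeff (D (w r) i) s)) (?S 1) \<le> ?\<nu> * euclidean_norm (coeff_vec 1 q (w r))" for r
    unfolding D_def euclidean_norm_trimmed_sylvester_diff[OF M M' m, of 1 "w r", OF w, symmetric]
    by (rule spectral_norm_ge[OF T1 coeff_vec_carrier])
  have "euclidean_norm ((trimmed_sylvester ds k M - trimmed_sylvester ds k M') *\<^sub>v v)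
      = L2_set (\<lambda>(i, s). norm (coeff (D x i) s)) (?S k)"
    unfolding v_eq[symmetric] D_def using x by (intro euclidean_norm_trimmed_sylvester_diff[OF M M' m]) auto
  also have "\<dots> \<le> L2_set (\<lambda>p. \<Sum>r<k. (case p of (i, s) \<Rightarrow> norm (coeff (monom 1 r * D (w r) i) s))) (?S k)"
    unfolding Dx coeff_sum case_prod_unfold by (intro L2_set_mono norm_sum) auto
  also have "\<dots> \<le> (\<Sum>r<k. L2_set (\<lambda>(i, s). norm (coeff (monom 1 r * D (w r) i) s)) (?S k))"
    by (rule L2_set_sum_le)
  also have "\<dots> \<le> (\<Sum>r<k. ?\<nu> * euclidean_norm (coeff_vec 1 q (w r)))"
    using shift step by (intro sum_mono) (meson order_trans)
  \<comment> \<open>Prepares Cauchy-Schwarz against the constant 1, which produces the factor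
    \<open>sqrt k\<close>: the squares of the k block norms add up to |v|^2.\<close>
  also have "\<dots> = ?\<nu> * (\<Sum>r<k. \<bar>1\<bar> * \<bar>euclidean_norm (coeff_vec 1 q (w r))\<bar>)" by (simp add: sum_distrib_left)
  also have "\<dots> \<le> ?\<nu> * (sqrt (real k) * euclidean_norm v)"
  \<comment> \<open>For \<open>q = 0\<close> the sign of the spectral norm is unknown, but both
    sides vanish.\<close>
  proof (cases "q = 0")
    case True
    moreover have "dim_vec v = 0" using v True by simp
    ultimately show ?thesis by (simp add: coeff_vec_def euclidean_norm_def)
  next
    case False
    have "(\<Sum>r<k. \<bar>1\<bar> * \<bar>euclidean_norm (coeff_vec 1 q (w r))\<bar>)
        \<le> L2_set (\<lambda>_. 1) {..<k} * L2_set (\<lambda>r. euclidean_norm (coeff_vec 1 q (w r))) {..<k}"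
      by (rule L2_set_mult_ineq)
    also have "L2_set (\<lambda>_. 1) {..<k} = sqrt (real k)" by (simp add: L2_set_def)
    also have "L2_set (\<lambda>r. euclidean_norm (coeff_vec 1 q (w r))) {..<k} = euclidean_norm v"
      unfolding v_eq[symmetric] euclidean_norm_coeff_vec L2_set_def poly_vec_norm_sq
      by (simp add: w_def poly_vec_norm_def sum.swap[of _ "{..<q}"])
    finally show ?thesis using spectral_norm_nonneg[OF T1] False by (intro mult_left_mono) auto
  qed
  finally show ?thesis by (simp add: mult_ac)
qed

section \<open>Perturbation\<close>

text \<open>The correction solves T' w = - T' v for the coefficient vector v of x. Since T v = 0,
  the right-hand side is (T - T') v, which is small, and \<open>perturbed_mat_surj\<close> bounds
  w.\<close>

lemma perturbed_sylvester_surj: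
  fixes M M' :: "'a::real_or_complex poly mat"
  assumes M: "M \<in> polymats_rowdeg ds q" and M': "M' \<in> polymats_rowdeg ds q" and m: "0 < length ds"
    and k: "1 \<le> k" and dim: "k * length ds + sum_list ds \<le> k * q"
    and \<nu>: "\<nu> = spectral_norm (trimmed_sylvester ds 1 M - trimmed_sylvester ds 1 M')" "0 \<le> \<nu>"
    and s: "s = \<sigma> (k * length ds + sum_list ds) (trimmed_sylvester ds k M)" and less: "sqrt (real k) * \<nu> < s"
  shows "sylvester_surj ds k M'"
    and "\<lbrakk>\<And>c. c < q \<Longrightarrow> deg_lt k (x c); \<And>i. i < length ds \<Longrightarrow> mult_poly_vec M x i = 0\<rbrakk> \<Longrightarrow>
      \<exists>\<delta>. (\<forall>c. deg_lt k (\<delta> c)) \<and> (\<forall>i<length ds. mult_poly_vec M' (\<lambda>c. x c + \<delta> c) i = 0) \<and>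
        (s - sqrt (real k) * \<nu>) * poly_vec_norm k q \<delta> \<le> sqrt (real k) * \<nu> * poly_vec_norm k q x"
proof -
  let ?n = "k * length ds + sum_list ds"
  let ?T = "trimmed_sylvester ds k M" and ?T' = "trimmed_sylvester ds k M'"
  have Mc: "M \<in> carrier_mat (length ds) q" "M' \<in> carrier_mat (length ds) q"
    using M M' by (auto simp: polymats_rowdeg_def)
  note T = trimmed_sylvester_carrier[OF Mc(1) m, of k] and T' = trimmed_sylvester_carrier[OF Mc(2) m, of k]
  have n: "0 < ?n" using k m by simp
  have c: "0 \<le> sqrt (real k) * \<nu>" using \<nu>(2) by simp
  note diff = trimmed_sylvester_diff_le[OF M M' m, folded \<nu>(1)]
  have surj: "\<exists>v\<in>carrier_vec (k * q). ?T' *\<^sub>v v = b \<and>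
      (s - sqrt (real k) * \<nu>) * euclidean_norm v \<le> euclidean_norm b" if b: "b \<in> carrier_vec ?n" for b
    unfolding s by (rule perturbed_mat_surj[OF T T' n dim c less[unfolded s] diff b])
  then have "mat_rank ?T' = ?n"
    using mat_rank_eq_dim_row_iff[of ?T'] T' by auto
  then show "sylvester_surj ds k M'" using mat_rank_trimmed_sylvester_surj[OF M' m] by simp
  assume x: "\<And>c. c < q \<Longrightarrow> deg_lt k (x c)" and ker: "\<And>i. i < length ds \<Longrightarrow> mult_poly_vec M x i = 0"
  let ?v = "coeff_vec k q x"
  have Tv: "?T *\<^sub>v ?v = 0\<^sub>v ?n" using trimmed_sylvester_mult_eq_0_iff[OF M m x] ker by simp
  have b: "(?T - ?T') *\<^sub>v ?v = - (?T' *\<^sub>v ?v)"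
    using minus_mult_distrib_mat_vec[OF T T', of ?v] T' by (simp add: Tv)
  have "(?T - ?T') *\<^sub>v ?v \<in> carrier_vec ?n"
    by (rule mult_mat_vec_carrier[OF minus_carrier_mat[OF T'] coeff_vec_carrier])
  from surj[OF this] obtain w where w: "w \<in> carrier_vec (k * q)" and T'w: "?T' *\<^sub>v w = - (?T' *\<^sub>v ?v)"
    and le: "(s - sqrt (real k) * \<nu>) * euclidean_norm w \<le> euclidean_norm ((?T - ?T') *\<^sub>v ?v)"
    unfolding b by blast
  obtain \<delta> where \<delta>: "\<And>c. deg_lt k (\<delta> c)" and w_eq: "coeff_vec k q \<delta> = w" using coeff_vec_surj[OF w] by blast
  have sum: "coeff_vec k q (\<lambda>c. x c + \<delta> c) = ?v + w"
    unfolding w_eq[symmetric] by (intro eq_vecI) (auto simp: coeff_vec_def)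
  have "?T' *\<^sub>v (?v + w) = 0\<^sub>v ?n"
    using mult_add_distrib_mat_vec[OF T' coeff_vec_carrier w] T'w T' by simp
  then have "\<forall>i<length ds. mult_poly_vec M' (\<lambda>c. x c + \<delta> c) i = 0"
    using trimmed_sylvester_mult_eq_0_iff[OF M' m, of k "\<lambda>c. x c + \<delta> c"] x \<delta> by (simp add: sum deg_lt_add)
  moreover have "(s - sqrt (real k) * \<nu>) * poly_vec_norm k q \<delta> \<le> sqrt (real k) * \<nu> * poly_vec_norm k q x"
    using le diff[OF coeff_vec_carrier[of k q x]] unfolding w_eq[symmetric] euclidean_norm_coeff_vec by simp
  ultimately show "\<exists>\<delta>. (\<forall>c. deg_lt k (\<delta> c)) \<and> (\<forall>i<length ds. mult_poly_vec M' (\<lambda>c. x c + \<delta> c) i = 0) \<and>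
      (s - sqrt (real k) * \<nu>) * poly_vec_norm k q \<delta> \<le> sqrt (real k) * \<nu> * poly_vec_norm k q x"
    using \<delta> by blast
qed

lemma perturbed_sylvester_inj:
  fixes M M' :: "'a::real_or_complex poly mat"
  assumes M: "M \<in> polymats_rowdeg ds q" and M': "M' \<in> polymats_rowdeg ds q" and m: "0 < length ds"
    and k: "1 \<le> k" and q: "0 < q"
    and less: "sqrt (real k) * spectral_norm (trimmed_sylvester ds 1 M - trimmed_sylvester ds 1 M')
      < \<sigma> (k * q) (trimmed_sylvester ds k M)"
  shows "sylvester_inj k M'"
proof -
  let ?T = "trimmed_sylvester ds k M" and ?T' = "trimmed_sylvester ds k M'"
  have Mc: "M \<in> carrier_mat (length ds) q" "M' \<in> carrier_mat (length ds) q"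
    using M M' by (auto simp: polymats_rowdeg_def)
  note T = trimmed_sylvester_carrier[OF Mc(1) m, of k] and T' = trimmed_sylvester_carrier[OF Mc(2) m, of k]
  have kq: "0 < k * q" using k q by simp
  have "mat_rank ?T' = k * q"
    using mat_rank_eq_dim_col_iff[of ?T'] T'
      perturbed_mat_inj[OF T T' kq less trimmed_sylvester_diff_le[OF M M' m]] by auto
  then show ?thesis using mat_rank_trimmed_sylvester_inj[OF M' m] by simp
qed

text \<open>S_1(N) contains every coefficient of degree at most e exactly once, so the norm can be
  collected row by row of N.\<close>

lemma frobenius_norm_sylvester:
  fixes N :: "'a::real_or_complex poly mat"
  assumes N: "N \<in> carrier_mat n q"
  shows "frobenius_norm (sylvester e 1 N) = sqrt (\<Sum>l<n. (poly_vec_norm (Suc e) q (\<lambda>c. N $$ (l, c)))\<^sup>2)"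
proof -
  have entry: "sylvester e 1 N $$ (a, b) = coeff (N $$ (a mod n, b)) (a div n)"
    if "a < Suc e * n" "b < q" for a b
  proof -
    have "a div n < Suc e" using that(1) by (rule less_mult_imp_div_less)
    then show ?thesis using that N by (simp add: sylvester_def Let_def)
  qed
  have "(\<Sum>ab\<in>{..<Suc e * n} \<times> {..<q}. (norm (sylvester e 1 N $$ ab))\<^sup>2)
      = (\<Sum>a<Suc e * n. \<Sum>b<q. (norm (coeff (N $$ (a mod n, b)) (a div n)))\<^sup>2)"
    unfolding sum.cartesian_product
  proof (intro sum.cong refl)
    fix ab assume "ab \<in> {..<Suc e * n} \<times> {..<q}"
    then obtain a b where "ab = (a, b)" "a < Suc e * n" "b < q" by blast
    then show "(norm (sylvester e 1 N $$ ab))\<^sup>2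
        = (case ab of (a, b) \<Rightarrow> (norm (coeff (N $$ (a mod n, b)) (a div n)))\<^sup>2)"
      using entry[of a b] by (simp only: prod.case)
  qed
  also have "\<dots> = (\<Sum>s<Suc e. \<Sum>l<n. \<Sum>b<q. (norm (coeff (N $$ (l, b)) s))\<^sup>2)"
    by (rule sum_div_mod)
  also have "\<dots> = (\<Sum>l<n. \<Sum>s<Suc e. \<Sum>b<q. (norm (coeff (N $$ (l, b)) s))\<^sup>2)"
    by (rule sum.swap)
  also have "\<dots> = (\<Sum>l<n. \<Sum>b<q. \<Sum>s<Suc e. (norm (coeff (N $$ (l, b)) s))\<^sup>2)"
    by (intro sum.cong refl sum.swap)
  finally have "(\<Sum>ab\<in>{..<Suc e * n} \<times> {..<q}. (norm (sylvester e 1 N $$ ab))\<^sup>2)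
      = (\<Sum>l<n. (poly_vec_norm (Suc e) q (\<lambda>c. N $$ (l, c)))\<^sup>2)" by (simp only: poly_vec_norm_sq)
  moreover have "dim_row (sylvester e 1 N) = Suc e * n" "dim_col (sylvester e 1 N) = q"
    using N by (simp_all add: sylvester_def)
  ultimately show ?thesis by (simp only: frobenius_norm_def L2_set_def)
qed

lemma sylvester_1_diff:
  fixes N N' :: "'a::real_or_complex poly mat"
  assumes "N \<in> carrier_mat n q" "N' \<in> carrier_mat n q"
  shows "sylvester e 1 N - sylvester e 1 N' = sylvester e 1 (N - N')"
proof (rule eq_matI)
  fix a b assume "a < dim_row (sylvester e 1 (N - N'))" "b < dim_col (sylvester e 1 (N - N'))"
  then have "a < Suc e * n" "b < q" using assms by (simp_all add: sylvester_def)
  moreover from this have "a mod n < n" by (cases n) auto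
  ultimately show "(sylvester e 1 N - sylvester e 1 N') $$ (a, b) = sylvester e 1 (N - N') $$ (a, b)"
    using assms by (simp add: sylvester_def Let_def)
qed (use assms in \<open>simp_all add: sylvester_def\<close>)

text \<open>
  The coefficients at fixed degrees \<open>e l\<close> form a submatrix of \<open>S\<^sub>1(N)\<close>.
\<close>
lemma frobenius_norm_coeff_mat_le:
  fixes N :: "'a::real_or_complex poly mat"
  assumes N: "N \<in> carrier_mat n q" and e: "\<And>l. l < n \<Longrightarrow> e l \<le> K"
  shows "frobenius_norm (mat n q (\<lambda>(l, c). coeff (N $$ (l, c)) (e l))) \<le> frobenius_norm (sylvester K 1 N)"
proof -
  have "(\<Sum>l<n. \<Sum>c<q. (norm (coeff (N $$ (l, c)) (e l)))\<^sup>2)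
      \<le> (\<Sum>l<n. (poly_vec_norm (Suc K) q (\<lambda>c. N $$ (l, c)))\<^sup>2)"
    unfolding poly_vec_norm_sq using e by (intro sum_mono member_le_sum) (auto simp: less_Suc_eq_le)
  moreover have "frobenius_norm (mat n q (\<lambda>(l, c). coeff (N $$ (l, c)) (e l)))
      = sqrt (\<Sum>l<n. \<Sum>c<q. (norm (coeff (N $$ (l, c)) (e l)))\<^sup>2)"
    unfolding frobenius_norm_def L2_set_def sum.cartesian_product by (auto intro!: sum.cong)
  ultimately show ?thesis unfolding frobenius_norm_sylvester[OF N] by (simp only: real_sqrt_le_mono)
qed

text \<open>H' takes the coefficients of N' at the same degrees \<open>e l\<close>. As H - H' is a
  submatrix of S_1(N) - S_1(N'), its norm is below \<sigma>_n(H), and H' keeps full row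
  rank.\<close>

lemma perturbed_leading_coeffs:
  fixes N N' :: "'a::real_or_complex poly mat"
  assumes N: "N \<in> carrier_mat n q" and N': "N' \<in> carrier_mat n q" and n: "0 < n" "n \<le> q"
    and e: "\<And>l. l < n \<Longrightarrow> e l \<le> K"
    and H: "H = mat n q (\<lambda>(l, c). coeff (N $$ (l, c)) (e l))"
    and less: "frobenius_norm (sylvester K 1 N - sylvester K 1 N') < \<sigma> n H"
    and a: "\<And>c. c < q \<Longrightarrow> (\<Sum>l<n. a l * coeff (N' $$ (l, c)) (e l)) = 0" and l: "l < n"
  shows "a l = 0"
proof -
  define H' where "H' = mat n q (\<lambda>(l, c). coeff (N' $$ (l, c)) (e l))"
  have Hc: "H \<in> carrier_mat n q" and H'c: "H' \<in> carrier_mat n q" by (simp_all add: H H'_def)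
  let ?F = "frobenius_norm (sylvester K 1 N - sylvester K 1 N')"
  have "H - H' = mat n q (\<lambda>(l, c). coeff ((N - N') $$ (l, c)) (e l))"
    using N N' by (intro eq_matI) (auto simp: H H'_def)
  then have "frobenius_norm (H - H') \<le> ?F"
    using frobenius_norm_coeff_mat_le[OF minus_carrier_mat[OF N', of N] e, of "\<lambda>l. l"]
    by (simp add: sylvester_1_diff[OF N N', simplified])
  then have le: "euclidean_norm ((H - H') *\<^sub>v x) \<le> ?F * euclidean_norm x" if "x \<in> carrier_vec q" for x
    using euclidean_norm_mult_mat_vec_le[OF minus_carrier_mat[OF H'c, of H] that]
    by (meson euclidean_norm_nonneg mult_right_mono order_trans)
  have "\<exists>x\<in>carrier_vec q. H' *\<^sub>v x = b" if "b \<in> carrier_vec n" for b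
    using perturbed_mat_surj[OF Hc H'c n frobenius_norm_nonneg less le that] by blast
  moreover have "\<forall>c<q. (\<Sum>l<n. a l * H' $$ (l, c)) = 0" using a by (simp add: H'_def)
  ultimately show ?thesis using surj_iff_left_kernel_trivial[OF H'c] l by blast
qed


theorem theorem8p1:
  fixes M N :: "'a::real_or_complex poly mat"
    and m n k' t :: nat
    and ds :: "nat list"
  assumes "0 < m" and "0 < n"
    and "length ds = m" and "0 < Max (set ds)"
    and "M \<in> polymats_rowdeg ds (m + n)"
    and "full_trimmed_sylvester_rank ds M"
    and "k' = nat \<lceil>real (sum_list ds) / real n\<rceil>"
    and "n * k' = sum_list ds + t"
    and "N \<in> polymats_deg n (m + n) k'"
    and "dual_minimal_bases m n M N"
  shows "(\<forall>M' \<in> polymats_rowdeg ds (m + n).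
            spectral_norm (trimmed_sylvester ds 1 M - trimmed_sylvester ds 1 M')
              < 1 / 2 * \<theta>\<^sub>1 m n ds k' t M
                  * (\<sigma> n (highest_row_degree_coeff N) / frobenius_norm (sylvester k' 1 N)) \<longrightarrow>
            full_trimmed_sylvester_rank ds M' \<and>
            (\<exists>N' \<in> polymats_deg n (m + n) k'.
               dual_minimal_bases m n M' N' \<and>
               frobenius_norm (sylvester k' 1 N - sylvester k' 1 N')
                   / frobenius_norm (sylvester k' 1 N)
                 \<le> 2 / \<theta>\<^sub>2 m ds k' t M
                     * spectral_norm (trimmed_sylvester ds 1 M - trimmed_sylvester ds 1 M') \<and>
               (t = 0 \<longrightarrow> (\<forall>i<n. row_degree N' i = k')))) \<and>
         (t = 0 \<longrightarrow> (\<forall>i<n. row_degree N i = k'))"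
proof -
  let ?q = "m + n" and ?D = "sum_list ds"
  let ?T = "\<lambda>k. trimmed_sylvester ds k M"
  note m = \<open>0 < m\<close> and n = \<open>0 < n\<close> and len = \<open>length ds = m\<close> and M = \<open>M \<in> polymats_rowdeg ds (m + n)\<close>
  have m': "0 < length ds" using m len by simp
  have D_sum: "(\<Sum>i<m. ds ! i) = ?D" using len by (simp add: sum_list_sum_nth atLeast0LessThan)
  have "0 < ?D"
  proof -
    have "Max (set ds) \<in> set ds" using m' by (intro Max_in) auto
    then have "Max (set ds) \<le> ?D" by (rule member_le_sum_list) simp
    then show ?thesis using assms(4) by simp
  qed
  then have "n * k' \<noteq> 0" using assms(8) by linarith
  then have k: "1 \<le> k'" by (cases k') auto
  have t: "t < n"
  proof -
    have "real k' = of_int \<lceil>real ?D / real n\<rceil>" unfolding assms(7) by (simp add: of_nat_nat)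
    then have "real k' < real ?D / real n + 1" by linarith
    then have "real n * real k' < real ?D + real n" using n by (simp add: field_simps)
    then have "n * k' < ?D + n" by (metis of_nat_add of_nat_less_iff of_nat_mult)
    then show ?thesis using assms(8) by simp
  qed
  have Mc: "M \<in> carrier_mat m ?q" and degM: "\<And>i c. i < m \<Longrightarrow> c < ?q \<Longrightarrow> degree (M $$ (i, c)) \<le> ds ! i"
    using M len by (auto simp: polymats_rowdeg_def)
  have N: "N \<in> carrier_mat n ?q" and degN: "\<And>l c. l < n \<Longrightarrow> c < ?q \<Longrightarrow> degree (N $$ (l, c)) \<le> k'"
    using assms(9) by (auto simp: polymats_deg_def)
  have rank: "1 \<le> k \<Longrightarrow> ?D \<le> n * k \<Longrightarrow> sylvester_surj ds k M" "1 \<le> k \<Longrightarrow> n * k \<le> ?D \<Longrightarrow> sylvester_inj k M" for k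
    using assms(6) full_trimmed_sylvester_rank_iff[of M ds n] M m' len by auto
  have surjM: "sylvester_surj ds k' M" using rank(1) k assms(8) by simp
  \<comment> \<open>t < n gives n (k' - 1) < D for the sum D of the d_i, so at k' - 1 full rank
    means injectivity.\<close>
  have small: "n * (k' - 1) \<le> ?D" using assms(8) t by (simp add: diff_mult_distrib2)
  have injM: "sylvester_inj (k' - 1) M"
  proof (cases "k' = 1")
    case False
    then show ?thesis using rank(2)[of "k' - 1"] k small by simp
  qed (simp add: sylvester_inj_0)
  have injM0: "t = 0 \<Longrightarrow> sylvester_inj k' M" using rank(2)[of k'] k assms(8) by simp
  have minN: "minimal_basis N" and indN: "indep_rows ?q (rows N)" and MN: "M * transpose_mat N = 0\<^sub>m m n"
    using assms(10) full_row_rank_iff_indep_rows[OF N] by (auto simp: dual_minimal_bases_def)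
  have kerN: "mult_poly_vec M (\<lambda>c. N $$ (l, c)) i = 0" if "l < n" "i < m" for l i
    using arg_cong[OF MN, of "\<lambda>X. X $$ (i, l)"] that Mc N
    by (simp add: scalar_prod_def mult_poly_vec_def atLeast0LessThan)
  define e where "e l = row_degree N l" for l
  have e_ge: "degree (N $$ (l, c)) \<le> e l" if "l < n" "c < ?q" for l c
    using degree_le_vec_degree[of c "row N l"] that N by (simp add: e_def row_degree_def)
  have e_le: "e l \<le> k'" if "l < n" for l
    unfolding e_def row_degree_def using that N degN n by (intro vec_degree_le) auto
  \<comment> \<open>Row l of N is a nonzero kernel vector, so injectivity at d excludes degrees
    below d. With \<open>d = k' - 1\<close>, and \<open>d = k'\<close> if \<open>t = 0\<close>, only
    the degrees k' - 1 and k' remain.\<close>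
  have row_ge: "d \<le> e l" if inj: "sylvester_inj d M" and l: "l < n" for d l
  proof (rule ccontr)
    assume "\<not> d \<le> e l"
    then have "deg_lt d (N $$ (l, c))" if "c < ?q" for c
      using e_ge[OF l that] by (intro deg_lt_degree) simp
    then have zero: "\<forall>c<?q. N $$ (l, c) = 0"
      using inj[unfolded sylvester_inj_def, rule_format, of "\<lambda>c. N $$ (l, c)"] kerN[OF l] Mc by auto
    have "(1 :: 'a poly) = 0"
    proof -
      have "(if l = l then 1 else 0 :: 'a poly) = 0"
      proof (rule indep_rowsD[OF indN, of "\<lambda>j. if j = l then 1 else 0"])
        show "(\<Sum>j<length (rows N). (if j = l then 1 else 0) * rows N ! j $ c) = 0" if "c < ?q" for c
          using zero that N l by (intro sum.neutral) auto
      qed (use N l in simp)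
      then show ?thesis by simp
    qed
    then show False by simp
  qed
  have e_sum: "(\<Sum>l<n. e l) \<le> (\<Sum>i<m. ds ! i)"
    unfolding e_def
    by (rule dual_degree_sum_le[OF Mc degM surjM k injM _ n N degN minN indN kerN])
      (use assms(8) D_sum in simp_all)
  have t0: "t = 0 \<longrightarrow> (\<forall>i<n. row_degree N i = k')"
    using row_ge[OF injM0] e_le by (auto simp: e_def intro: le_antisym)
  have "full_trimmed_sylvester_rank ds M' \<and>
      (\<exists>N' \<in> polymats_deg n (m + n) k'.
         dual_minimal_bases m n M' N' \<and>
         frobenius_norm (sylvester k' 1 N - sylvester k' 1 N') / frobenius_norm (sylvester k' 1 N)
           \<le> 2 / \<theta>\<^sub>2 m ds k' t M
               * spectral_norm (trimmed_sylvester ds 1 M - trimmed_sylvester ds 1 M') \<and>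
         (t = 0 \<longrightarrow> (\<forall>i<n. row_degree N' i = k')))"
    if M': "M' \<in> polymats_rowdeg ds (m + n)"
      and close: "spectral_norm (trimmed_sylvester ds 1 M - trimmed_sylvester ds 1 M')
        < 1 / 2 * \<theta>\<^sub>1 m n ds k' t M
            * (\<sigma> n (highest_row_degree_coeff N) / frobenius_norm (sylvester k' 1 N))" for M'
  proof -
    define \<nu> where "\<nu> = spectral_norm (trimmed_sylvester ds 1 M - trimmed_sylvester ds 1 M')"
    define F where "F = frobenius_norm (sylvester k' 1 N)"
    define H where "H = highest_row_degree_coeff N"
    have M'c: "M' \<in> carrier_mat m ?q" and degM': "\<And>i c. i < m \<Longrightarrow> c < ?q \<Longrightarrow> degree (M' $$ (i, c)) \<le> ds ! i"
      using M' len by (auto simp: polymats_rowdeg_def)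
    have "trimmed_sylvester ds 1 M - trimmed_sylvester ds 1 M' \<in> carrier_mat (1 * length ds + ?D) (1 * ?q)"
      using trimmed_sylvester_carrier[of M' ds ?q 1] M'c m' len by (intro minus_carrier_mat) simp
    then have \<nu>0: "0 \<le> \<nu>" unfolding \<nu>_def by (rule spectral_norm_nonneg) (use n in simp)
    have H: "H = mat n ?q (\<lambda>(l, c). coeff (N $$ (l, c)) (e l))"
      using N by (simp add: H_def highest_row_degree_coeff_def e_def)
    have Hc: "H \<in> carrier_mat n ?q" by (simp add: H)
    have \<sigma>H0: "0 \<le> \<sigma> n H" using \<sigma>_nonneg[of n H] n Hc by simp
    have F_eq: "F = sqrt (\<Sum>l<n. (poly_vec_norm (Suc k') ?q (\<lambda>c. N $$ (l, c)))\<^sup>2)"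
      unfolding F_def by (rule frobenius_norm_sylvester[OF N])
    have F0: "0 \<le> F" by (simp add: F_def)
    have "\<sigma> n H \<le> frobenius_norm H" by (rule \<sigma>_dim_row_le_frobenius[OF Hc n]) simp
    also have "\<dots> \<le> F" unfolding H F_def by (rule frobenius_norm_coeff_mat_le[OF N e_le])
    finally have "\<sigma> n H \<le> F" .
    \<comment> \<open>At most 1, so the hypothesis yields \<nu> < \<theta> / 2 for the singular
      values as well as the sharper \<nu> < \<theta> \<rho> / 2 for the leading
      coefficients.\<close>
    define \<rho> where "\<rho> = \<sigma> n H / F"
    have \<rho>: "0 \<le> \<rho>" "\<rho> \<le> 1"
      using \<sigma>H0 F0 \<open>\<sigma> n H \<le> F\<close> by (auto simp: \<rho>_def divide_le_eq_1)
    define \<theta> where "\<theta> = \<theta>\<^sub>1 m n ds k' t M"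
    have close': "\<nu> < 1 / 2 * \<theta> * \<rho>" using close by (simp add: \<nu>_def \<rho>_def H_def F_def \<theta>_def)
    then have "0 < \<theta> * \<rho>" using \<nu>0 by simp
    then have \<theta>0: "0 < \<theta>" and \<rho>0: "0 < \<rho>" using \<rho>(1) by (auto simp: zero_less_mult_iff)
    \<comment> \<open>For F = 0 the convention for division by 0 would give \<rho> = 0.\<close>
    have Fpos: "0 < F" using \<rho>0 F0 by (cases "F = 0") (auto simp: \<rho>_def)
    have "\<theta> * \<rho> \<le> \<theta>" using \<rho>(2) \<theta>0 by simp
    then have \<nu>_less: "\<nu> < 1 / 2 * \<theta>" using close' by simp
    define s where "s k = \<sigma> (k * m + ?D) (?T k)" for k
    define \<theta>' where "\<theta>' = \<theta>\<^sub>2 m ds k' t M"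
    have s_Suc: "\<sigma> (k' * m + m + ?D) (?T (k' + 1)) = s (k' + 1)" by (simp add: s_def add_ac)
    have s_2: "s (Suc (Suc 0)) = \<sigma> (2 * m + ?D) (?T 2)" by (simp add: s_def numeral_2_eq_2)
    \<comment> \<open>All that is used of the two minima. Injectivity at k' - 1 has its own term
      only for t > 0 and k' > 1: for k' = 1 it is trivial, and for t = 0 it follows from injectivity
      at k'.\<close>
    have \<theta>_le: "\<theta> \<le> s k' / sqrt (real k')" "\<theta> \<le> s (k' + 1) / sqrt (real (k' + 1))" "\<theta> \<le> \<theta>'"
      "\<theta>' \<le> s (k' + 1) / sqrt (real (k' + 1))" "t \<noteq> 0 \<Longrightarrow> \<theta>' \<le> s k' / sqrt (real k')"
      "t \<noteq> 0 \<Longrightarrow> k' \<noteq> 1 \<Longrightarrow> \<theta> \<le> \<sigma> ((k' - 1) * ?q) (?T (k' - 1)) / sqrt (real (k' - 1))"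
      unfolding \<theta>_def \<theta>'_def \<theta>\<^sub>1_def \<theta>\<^sub>2_def Let_def s_Suc
      using s_2 by (auto simp: s_def[of k'] min_le_iff_disj)
    have \<theta>'0: "0 < \<theta>'" using \<theta>0 \<theta>_le(3) by simp
    \<comment> \<open>\<nu> < \<theta> / 2 leaves at least half of the singular value
      \<open>s k\<close>, the source of the factor 2 in the final estimate.\<close>
    have bound: "sqrt (real k) * \<nu> < s k" "0 < s k" "sqrt (real k) * \<nu> \<le> s k / 2"
      if "1 \<le> k" "\<theta> \<le> s k / sqrt (real k)" for k
    proof -
      have "\<theta> * sqrt (real k) \<le> s k" "0 < sqrt (real k)" using that by (auto simp: field_simps)
      moreover have "sqrt (real k) * \<nu> < sqrt (real k) * (1 / 2 * \<theta>)"
        using \<nu>_less \<open>0 < sqrt (real k)\<close> by (intro mult_strict_left_mono)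
      moreover have "sqrt (real k) * (1 / 2 * \<theta>) = \<theta> * sqrt (real k) / 2" by simp
      moreover have "0 < \<theta> * sqrt (real k)" using \<theta>0 \<open>0 < sqrt (real k)\<close> by simp
      ultimately show "sqrt (real k) * \<nu> < s k" "0 < s k" "sqrt (real k) * \<nu> \<le> s k / 2"
        by linarith+
    qed
    have M2: "M \<in> polymats_rowdeg ds ?q" "M' \<in> polymats_rowdeg ds ?q" using M M' by auto
    have dim: "k * length ds + ?D \<le> k * ?q" if "k' \<le> k" for k
    proof -
      have "n * k' \<le> n * k" using that by simp
      then have "?D \<le> n * k" using assms(8) by linarith
      then show ?thesis using len by (simp add: algebra_simps)
    qed
    have s_len: "s k = \<sigma> (k * length ds + ?D) (?T k)" for k by (simp add: s_def len)
    note pert = perturbed_sylvester_surj[OF M2 m' _ dim \<nu>_def \<nu>0 s_len]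
    have surj': "sylvester_surj ds k' M'"
      using k bound(1)[OF k \<theta>_le(1)] by (intro pert(1)) auto
    have surj_ge: "sylvester_surj ds k M'" if "k' \<le> k" for k
      using sylvester_surj_mono[OF surj' k that] .
    \<comment> \<open>For t = 0 the matrix T_k at k = k' is square, so the singular value that gives
      surjectivity also gives injectivity.\<close>
    have injt: "sylvester_inj k' M'" if "t = 0"
    proof -
      have "k' * length ds + ?D = k' * ?q" using assms(8) that len by (simp add: algebra_simps)
      then show ?thesis
        using perturbed_sylvester_inj[OF M2 m' k, folded \<nu>_def] bound(1)[OF k \<theta>_le(1)] n by (simp add: s_len)
    qed
    have inj1: "sylvester_inj (k' - 1) M'"
    proof (cases "k' = 1 \<or> t = 0")
      case True
      then show ?thesis using sylvester_inj_0 sylvester_inj_mono[OF injt] by (metis diff_le_self diff_self_eq_0)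
    next
      case False
      then have k1: "1 \<le> k' - 1" using k by linarith
      let ?s = "\<sigma> ((k' - 1) * ?q) (?T (k' - 1))"
      have pos: "0 < sqrt (real (k' - 1))" using k1 by simp
      have "\<theta> * sqrt (real (k' - 1)) \<le> ?s" using \<theta>_le(6) False pos by (simp add: field_simps)
      moreover have "sqrt (real (k' - 1)) * \<nu> < sqrt (real (k' - 1)) * (1 / 2 * \<theta>)"
        using \<nu>_less pos by (intro mult_strict_left_mono)
      moreover have "sqrt (real (k' - 1)) * (1 / 2 * \<theta>) = \<theta> * sqrt (real (k' - 1)) / 2" by simp
      moreover have "0 < \<theta> * sqrt (real (k' - 1))" using \<theta>0 pos by simp
      ultimately have "sqrt (real (k' - 1)) * \<nu> < ?s" by linarith
      then show ?thesis using perturbed_sylvester_inj[OF M2 m' k1, folded \<nu>_def] n by simp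
    qed
    have full: "full_trimmed_sylvester_rank ds M'"
    proof (subst full_trimmed_sylvester_rank_iff[of _ _ n])
      show "M' \<in> polymats_rowdeg ds (length ds + n)" using M' len by simp
      show "\<forall>k\<ge>1. (?D \<le> n * k \<longrightarrow> sylvester_surj ds k M') \<and> (n * k \<le> ?D \<longrightarrow> sylvester_inj k M')"
      \<comment> \<open>Since n (k' - 1) < D \<le> n k', the condition D \<le> n k means k \<ge> k',
        and n k \<le> D means k \<le> k' with equality only for t = 0.\<close>
      proof (intro allI impI conjI)
        fix k :: nat assume k1: "1 \<le> k"
        {
          assume "?D \<le> n * k"
          have "k' \<le> k"
          proof (rule ccontr)
            assume "\<not> k' \<le> k"
            then have "n * Suc k \<le> n * k'" by (intro mult_le_mono2) simp
            then show False using \<open>?D \<le> n * k\<close> assms(8) t by simp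
          qed
          then show "sylvester_surj ds k M'" by (rule surj_ge)
        }
        assume kD: "n * k \<le> ?D"
        then have "n * k \<le> n * k'" using assms(8) by simp
        then have "k \<le> k'" using n by simp
        show "sylvester_inj k M'"
        proof (cases "k = k'")
          case True
          then show ?thesis using kD assms(8) injt by simp
        next
          case False
          then show ?thesis using \<open>k \<le> k'\<close> by (intro sylvester_inj_mono[OF inj1]) simp
        qed
      qed
    qed (use m' in simp)
    have row: "\<exists>\<delta>. (\<forall>c. deg_lt (Suc (e l)) (\<delta> c)) \<and>
        (\<forall>i<m. mult_poly_vec M' (\<lambda>c. N $$ (l, c) + \<delta> c) i = 0) \<and>
        poly_vec_norm (Suc k') ?q \<delta> \<le> 2 / \<theta>' * \<nu> * poly_vec_norm (Suc k') ?q (\<lambda>c. N $$ (l, c))"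
      if l: "l < n" for l
    proof -
      \<comment> \<open>Solving at size \<open>e l + 1\<close> instead of \<open>k' + 1\<close>
        keeps the correction from raising the degree of the row.\<close>
      let ?k = "Suc (e l)" and ?x = "\<lambda>c. N $$ (l, c)"
      have "k' - 1 \<le> e l" by (rule row_ge[OF injM l])
      then have "k' \<le> ?k" by simp
      \<comment> \<open>For t = 0 all rows have degree k', so only the size k' + 1 occurs; this is
        why \<open>\<theta>\<^sub>2\<close> then has a single term.\<close>
      have cases: "?k = k' + 1 \<or> ?k = k' \<and> t \<noteq> 0"
      proof (cases "t = 0")
        case True
        then show ?thesis using t0 l by (simp add: e_def)
      next
        case False
        then show ?thesis using \<open>k' \<le> ?k\<close> e_le[OF l] by auto
      qed
      then have \<theta>s: "\<theta> \<le> s ?k / sqrt (real ?k)" "\<theta>' \<le> s ?k / sqrt (real ?k)" using \<theta>_le by auto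
      have b: "sqrt (real ?k) * \<nu> < s ?k" "0 < s ?k" "sqrt (real ?k) * \<nu> \<le> s ?k / 2"
        using bound[OF _ \<theta>s(1)] by auto
      have x: "deg_lt ?k (?x c)" if "c < ?q" for c
        using e_ge[OF l that] by (intro deg_lt_degree) simp
      have "\<exists>\<delta>. (\<forall>c. deg_lt ?k (\<delta> c)) \<and> (\<forall>i<length ds. mult_poly_vec M' (\<lambda>c. ?x c + \<delta> c) i = 0) \<and>
        (s ?k - sqrt (real ?k) * \<nu>) * poly_vec_norm ?k ?q \<delta> \<le> sqrt (real ?k) * \<nu> * poly_vec_norm ?k ?q ?x"
        using \<open>k' \<le> ?k\<close> b(1) x kerN[OF l] len by (intro pert(2)) auto
      then obtain \<delta> where \<delta>: "\<And>c. deg_lt ?k (\<delta> c)" "\<forall>i<m. mult_poly_vec M' (\<lambda>c. ?x c + \<delta> c) i = 0"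
        "(s ?k - sqrt (real ?k) * \<nu>) * poly_vec_norm ?k ?q \<delta> \<le> sqrt (real ?k) * \<nu> * poly_vec_norm ?k ?q ?x"
        using len by blast
      have "s ?k / 2 * poly_vec_norm ?k ?q \<delta> \<le> (s ?k - sqrt (real ?k) * \<nu>) * poly_vec_norm ?k ?q \<delta>"
        using b(3) by (intro mult_right_mono) simp_all
      also note \<delta>(3)
      finally have le: "poly_vec_norm ?k ?q \<delta> \<le> 2 * (sqrt (real ?k) / s ?k) * (\<nu> * poly_vec_norm ?k ?q ?x)"
        using b(2) by (simp add: field_simps)
      also have "\<dots> \<le> 2 * (1 / \<theta>') * (\<nu> * poly_vec_norm ?k ?q ?x)"
      proof -
        have "sqrt (real ?k) / s ?k \<le> 1 / \<theta>'" using \<theta>s(2) \<theta>'0 b(2) by (simp add: field_simps)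
        then show ?thesis using \<nu>0 by (intro mult_right_mono) simp_all
      qed
      finally have "poly_vec_norm ?k ?q \<delta> \<le> 2 / \<theta>' * \<nu> * poly_vec_norm ?k ?q ?x" by simp
      moreover have "poly_vec_norm (Suc k') ?q \<delta> = poly_vec_norm ?k ?q \<delta>"
        "poly_vec_norm (Suc k') ?q ?x = poly_vec_norm ?k ?q ?x"
        by (rule poly_vec_norm_deg_lt, use \<delta>(1) x e_le[OF l] in simp_all)+
      ultimately have "poly_vec_norm (Suc k') ?q \<delta> \<le> 2 / \<theta>' * \<nu> * poly_vec_norm (Suc k') ?q ?x"
        by (simp only:)
      then show ?thesis using \<delta>(1,2) by (intro exI[of _ \<delta>] conjI) simp_all
    qed
    then have "\<forall>l. \<exists>\<delta>. l < n \<longrightarrow> (\<forall>c. deg_lt (Suc (e l)) (\<delta> c)) \<and>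
        (\<forall>i<m. mult_poly_vec M' (\<lambda>c. N $$ (l, c) + \<delta> c) i = 0) \<and>
        poly_vec_norm (Suc k') ?q \<delta> \<le> 2 / \<theta>' * \<nu> * poly_vec_norm (Suc k') ?q (\<lambda>c. N $$ (l, c))"
      by blast
    from this[unfolded choice_iff] obtain \<delta> where \<delta>: "\<forall>l. l < n \<longrightarrow> (\<forall>c. deg_lt (Suc (e l)) (\<delta> l c)) \<and>
        (\<forall>i<m. mult_poly_vec M' (\<lambda>c. N $$ (l, c) + \<delta> l c) i = 0) \<and>
        poly_vec_norm (Suc k') ?q (\<delta> l) \<le> 2 / \<theta>' * \<nu> * poly_vec_norm (Suc k') ?q (\<lambda>c. N $$ (l, c))" ..
    define N' where "N' = mat n ?q (\<lambda>(l, c). N $$ (l, c) + \<delta> l c)"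
    have N'c: "N' \<in> carrier_mat n ?q" by (simp add: N'_def)
    have degN': "degree (N' $$ (l, c)) \<le> e l" if "l < n" "c < ?q" for l c
    proof -
      have "degree (\<delta> l c) \<le> e l" using \<delta> that by (intro degree_le_if_deg_lt) blast
      then show ?thesis using e_ge[OF that] that by (simp add: N'_def degree_add_le)
    qed
    have N'_in: "N' \<in> polymats_deg n ?q k'"
      using N'c degN' e_le by (auto simp: polymats_deg_def intro: order_trans)
    have kerN': "mult_poly_vec M' (\<lambda>c. N' $$ (l, c)) i = 0" if "l < n" "i < m" for l i
    proof -
      have "mult_poly_vec M' (\<lambda>c. N' $$ (l, c)) i = mult_poly_vec M' (\<lambda>c. N $$ (l, c) + \<delta> l c) i"
        using that M'c by (intro mult_poly_vec_cong) (simp add: N'_def)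
      then show ?thesis using \<delta> that by simp
    qed
    have diff: "frobenius_norm (sylvester k' 1 N - sylvester k' 1 N') \<le> 2 / \<theta>' * \<nu> * F"
    proof -
      have "poly_vec_norm (Suc k') ?q (\<lambda>c. (N - N') $$ (l, c)) = poly_vec_norm (Suc k') ?q (\<delta> l)" if "l < n" for l
        using that N by (simp add: poly_vec_norm_def N'_def)
      then have "frobenius_norm (sylvester k' 1 N - sylvester k' 1 N')
          = sqrt (\<Sum>l<n. (poly_vec_norm (Suc k') ?q (\<delta> l))\<^sup>2)"
        unfolding sylvester_1_diff[OF N N'c] frobenius_norm_sylvester[OF minus_carrier_mat[OF N'c]] by simp
      also have "\<dots> \<le> sqrt (\<Sum>l<n. (2 / \<theta>' * \<nu> * poly_vec_norm (Suc k') ?q (\<lambda>c. N $$ (l, c)))\<^sup>2)"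
        using \<delta> by (intro real_sqrt_le_mono sum_mono power_mono) auto
      also have "\<dots> = 2 / \<theta>' * \<nu> * F"
        unfolding F_eq power_mult_distrib sum_distrib_left[symmetric] real_sqrt_mult
        using \<theta>'0 \<nu>0 by simp
      finally show ?thesis .
    qed
    \<comment> \<open>From \<open>\<theta> \<le> \<theta>'\<close> and the hypothesis, 2 \<nu> F /
      \<theta>' < \<rho> F, which is \<sigma>_n(H) by the choice of \<rho>.\<close>
    have less: "frobenius_norm (sylvester k' 1 N - sylvester k' 1 N') < \<sigma> n H"
    proof -
      have "2 / \<theta>' * \<nu> * F \<le> 2 / \<theta> * \<nu> * F"
        using \<theta>_le(3) \<theta>0 \<nu>0 F0 by (intro mult_right_mono divide_left_mono) auto
      also have "\<dots> < 2 / \<theta> * (1 / 2 * \<theta> * \<rho>) * F"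
        using close' \<theta>0 Fpos by (intro mult_strict_right_mono mult_strict_left_mono) auto
      also have "\<dots> = \<sigma> n H" using \<theta>0 Fpos by (simp add: \<rho>_def)
      finally show ?thesis using diff by simp
    qed
    have lead: "a l = 0" if "\<And>c. c < ?q \<Longrightarrow> (\<Sum>l<n. a l * coeff (N' $$ (l, c)) (e l)) = 0" "l < n" for a l
      by (rule perturbed_leading_coeffs[OF N N'c n _ e_le H less that]) simp
    have dual: "dual_minimal_bases m n M' N'"
    proof (rule dual_minimal_basesI[OF M'c degM' surj' k m n N'c degN' _ kerN' e_sum])
      show "a l = 0" if "\<And>c. c < ?q \<Longrightarrow> (\<Sum>l<n. a l * coeff (N' $$ (l, c)) (e l)) = 0" "l < n" for a l
        using that by (rule lead)
    qed
    have "row_degree N' l = k'" if t: "t = 0" and l: "l < n" for l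
    proof (rule le_antisym)
      show "row_degree N' l \<le> k'"
        unfolding row_degree_def using N'c degN' e_le l n by (intro vec_degree_le) (auto intro: order_trans)
      have "e l = k'" using t0 t l by (simp add: e_def)
      \<comment> \<open>If row l had only zero coefficients in degree \<open>e l\<close>, this would
        be a relation excluded by \<open>lead\<close>; so the degree does not drop.\<close>
      have "\<exists>c<?q. coeff (N' $$ (l, c)) (e l) \<noteq> 0"
      proof (rule ccontr)
        assume *: "\<not> ?thesis"
        have "(if l = l then 1 else 0 :: 'a) = 0"
        proof (rule lead[of "\<lambda>j. if j = l then 1 else 0"])
          show "(\<Sum>j<n. (if j = l then 1 else 0) * coeff (N' $$ (j, c)) (e j)) = 0" if "c < ?q" for c
            using * that by (intro sum.neutral) auto
        qed (use l in simp)
        then show False by simp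
      qed
      then obtain c where c: "c < ?q" "coeff (N' $$ (l, c)) (e l) \<noteq> 0" by blast
      then have "k' \<le> degree (N' $$ (l, c))" using \<open>e l = k'\<close> le_degree by metis
      also have "\<dots> \<le> row_degree N' l"
        using degree_le_vec_degree[of c "row N' l"] c l N'c by (simp add: row_degree_def)
      finally show "k' \<le> row_degree N' l" .
    qed
    moreover have "frobenius_norm (sylvester k' 1 N - sylvester k' 1 N') / F \<le> 2 / \<theta>' * \<nu>"
      using diff Fpos by (simp add: pos_divide_le_eq)
    ultimately show ?thesis
      using full dual N'_in unfolding F_def \<theta>'_def \<nu>_def by blast
  qed
  with t0 show ?thesis by blast
qed

end
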